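(* Let $M$ be a parallelizable smooth manifold of real dimension $2n$, $n\ge2$, with a global frame $\{v_1,\dots,v_n,w_1,\dots,w_n\}$ of $TM$ and dual coframe $\{v^1,\dots,v^n,w^1,\dots,w^n\}$. Let $J$ be the almost complex structure with $Jv_i=w_i$, $Jw_i=-v_i$, let $g=-\sum_{i=1}^n v^i\otimes v^i+\sum_{i=1}^n w^i\otimes w^i$, with Levi-Civita connection $\nabla^g$, and for $1\le i\le n$ let $\bar\nabla^{i}_XY=\nabla^g_XY+v^i(Y)JX$ and $\bar\nabla^{n+i}_XY=\nabla^g_XY+w^i(Y)JX$. Then for every $1\le\alpha\le2n$ the triple $(TM,\hat G_g^{\bar\nabla^\alpha},\hat J^{\bar\nabla^\alpha})$ is an almost Kähler manifold (with pseudo-Riemannian metric), i.e. it is almost Hermitian and its Kähler form $\omega(\cdot,\cdot)=\hat G_g^{\bar\nabla^\alpha}(\hat J^{\bar\nabla^\alpha}\cdot,\cdot)$ satisfies $d\omega=0$.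
   Context: Let $\nabla$ be an affine connection on $M$, $\pi:TM\to M$ the projection and $\pi_*:T(TM)\to TM$ its differential. Let $K:T(TM)\to TM$ be Dombrowski's connection map of $\nabla$, characterized by being linear on each $T_a(TM)$ with values in $T_{\pi(a)}M$, restricting to the canonical identification of vertical vectors with $T_{\pi(a)}M$, and satisfying $K(Y_*(X))=\nabla_XY$ for every vector field $Y$ (viewed as a map $M\to TM$) and tangent vector $X$. For each $a\in TM$, $(\pi_*,K):T_a(TM)\to T_{\pi(a)}M\oplus T_{\pi(a)}M$ is an isomorphism. The almost complex structure $\hat J^\nabla$ on $TM$ is defined by $\pi_*(\hat J^\nabla Z)=-KZ$, $K(\hat J^\nabla Z)=\pi_*Z$. The Sasaki metric $\hat G_g^\nabla=g\oplus g$ on $TM$ is $\hat G_g^\nabla(Z,Z')=g(\pi_*Z,\pi_*Z')+g(KZ,KZ')$. Almost Hermitian means that the (pseudo-Riemannian) metric is invariant under the almost complex structure. *)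

theory Defs
  imports "HOL-Analysis.Analysis" "HOL-Library.Function_Algebras"
begin

instantiation "fun" :: (type, real_vector) real_vector
begin

definition scaleR_fun :: "real \<Rightarrow> ('a \<Rightarrow> 'b) \<Rightarrow> 'a \<Rightarrow> 'b"
  where "scaleR_fun r f = (\<lambda>x. r *\<^sub>R f x)"

instance
  by standard (simp_all add: scaleR_fun_def fun_eq_iff scaleR_add_right scaleR_add_left)

end

definition linear_map_on :: "'a::real_vector set \<Rightarrow> ('a \<Rightarrow> 'b::real_vector) \<Rightarrow> bool" where
  "linear_map_on S f \<longleftrightarrow>
     (\<forall>x\<in>S. \<forall>y\<in>S. f (x + y) = f x + f y) \<and> (\<forall>r. \<forall>x\<in>S. f (r *\<^sub>R x) = r *\<^sub>R f x)"

text \<open>\<open>Ck_on\<close> and \<open>smooth_on\<close> are meant for open subsets of finite-dimensional spaces.\<close>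

primrec Ck_on ::
  "nat \<Rightarrow> 'a::real_normed_vector set \<Rightarrow> ('a \<Rightarrow> 'b::real_normed_vector) \<Rightarrow> bool" where
  "Ck_on 0 S f \<longleftrightarrow> continuous_on S f"
| "Ck_on (Suc k) S f \<longleftrightarrow>
     (\<forall>x\<in>S. f differentiable (at x)) \<and> (\<forall>v. Ck_on k S (\<lambda>x. frechet_derivative f (at x) v))"

definition smooth_on ::
  "'a::real_normed_vector set \<Rightarrow> ('a \<Rightarrow> 'b::real_normed_vector) \<Rightarrow> bool" where
  "smooth_on S f \<longleftrightarrow> (\<forall>k. Ck_on k S f)"

text \<open>
  A chart is a pair of its domain and its coordinate map; the values of the map outside the
  domain are irrelevant. A manifold modelled on \<open>'e\<close> is given by an atlas (not necessarily
  maximal), which also determines the set of points and the topology.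
\<close>

type_synonym ('p, 'e) chart = "'p set \<times> ('p \<Rightarrow> 'e)"
type_synonym ('p, 'e) atlas = "('p, 'e) chart set"

definition chart_image :: "('p, 'e) chart \<Rightarrow> 'e set" where
  "chart_image c = snd c ` fst c"

definition chart_inv :: "('p, 'e) chart \<Rightarrow> 'e \<Rightarrow> 'p" where
  "chart_inv c = inv_into (fst c) (snd c)"

definition points :: "('p, 'e) atlas \<Rightarrow> 'p set" where
  "points A = (\<Union>c\<in>A. fst c)"

definition smooth_atlas :: "('p, 'e::euclidean_space) atlas \<Rightarrow> bool" where
  "smooth_atlas A \<longleftrightarrow>
     (\<forall>c\<in>A. inj_on (snd c) (fst c) \<and> open (chart_image c)) \<and>
     (\<forall>c\<in>A. \<forall>d\<in>A. open (snd c ` (fst c \<inter> fst d)) \<and>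
        smooth_on (snd c ` (fst c \<inter> fst d)) (snd d \<circ> chart_inv c))"

definition atlas_topology :: "('p, 'e::euclidean_space) atlas \<Rightarrow> 'p topology" where
  "atlas_topology A =
     topology (\<lambda>W. W \<subseteq> points A \<and> (\<forall>c\<in>A. open (snd c ` (W \<inter> fst c))))"

definition smooth_manifold :: "('p, 'e::euclidean_space) atlas \<Rightarrow> bool" where
  "smooth_manifold A \<longleftrightarrow>
     smooth_atlas A \<and> Hausdorff_space (atlas_topology A) \<and> second_countable (atlas_topology A)"

definition chart_at :: "('p, 'e) atlas \<Rightarrow> 'p \<Rightarrow> ('p, 'e) chart" where
  "chart_at A p = (SOME c. c \<in> A \<and> p \<in> fst c)"

definition smooth_function ::
  "('p, 'e::euclidean_space) atlas \<Rightarrow> ('p \<Rightarrow> real) \<Rightarrow> bool" where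
  "smooth_function A f \<longleftrightarrow> (\<forall>c\<in>A. smooth_on (chart_image c) (f \<circ> chart_inv c))"

text \<open>
  A tangent vector at \<open>p\<close> is the family of its components in all charts of the atlas around
  \<open>p\<close>, transforming by the derivatives of the transition maps; the component in any other
  pair is 0 by convention. In particular the tangent space at a non-point is \<open>{0}\<close>.
\<close>

type_synonym ('p, 'e) tvec = "('p, 'e) chart \<Rightarrow> 'e"

definition tangent_space ::
  "('p, 'e::euclidean_space) atlas \<Rightarrow> 'p \<Rightarrow> ('p, 'e) tvec set" where
  "tangent_space A p = {u.
     (\<forall>c. \<not> (c \<in> A \<and> p \<in> fst c) \<longrightarrow> u c = 0) \<and>
     (\<forall>c\<in>A. \<forall>d\<in>A. p \<in> fst c \<longrightarrow> p \<in> fst d \<longrightarrow>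
        u d = frechet_derivative (snd d \<circ> chart_inv c) (at (snd c p)) (u c))}"

text \<open>The tangent vector at \<open>p\<close> with component \<open>\<xi>\<close> in the chart \<open>c\<close>.\<close>

definition coord_vec ::
  "('p, 'e::euclidean_space) atlas \<Rightarrow> ('p, 'e) chart \<Rightarrow> 'p \<Rightarrow> 'e \<Rightarrow> ('p, 'e) tvec" where
  "coord_vec A c p \<xi> = (\<lambda>d. if d \<in> A \<and> p \<in> fst d
     then frechet_derivative (snd d \<circ> chart_inv c) (at (snd c p)) \<xi> else 0)"

definition dir_deriv ::
  "('p, 'e::euclidean_space) atlas \<Rightarrow> 'p \<Rightarrow> ('p, 'e) tvec \<Rightarrow> ('p \<Rightarrow> real) \<Rightarrow> real" where
  "dir_deriv A p u f =
     (let c = chart_at A p in frechet_derivative (f \<circ> chart_inv c) (at (snd c p)) (u c))"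

definition tangent_map ::
  "('p, 'e::euclidean_space) atlas \<Rightarrow> ('q, 'f::euclidean_space) atlas \<Rightarrow> ('p \<Rightarrow> 'q) \<Rightarrow>
    'p \<Rightarrow> ('p, 'e) tvec \<Rightarrow> ('q, 'f) tvec" where
  "tangent_map A B F p u = (let c = chart_at A p in
     (\<lambda>d. if d \<in> B \<and> F p \<in> fst d
       then frechet_derivative (snd d \<circ> F \<circ> chart_inv c) (at (snd c p)) (u c) else 0))"

definition curve_velocity ::
  "('p, 'e::euclidean_space) atlas \<Rightarrow> (real \<Rightarrow> 'p) \<Rightarrow> real \<Rightarrow> ('p, 'e) tvec" where
  "curve_velocity A \<gamma> t = (\<lambda>d. if d \<in> A \<and> \<gamma> t \<in> fst d
     then vector_derivative (snd d \<circ> \<gamma>) (at t) else 0)"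

type_synonym ('p, 'e) vfield = "'p \<Rightarrow> ('p, 'e) tvec"

definition smooth_components ::
  "('p, 'e::euclidean_space) atlas \<Rightarrow> ('p, 'e) vfield \<Rightarrow> bool" where
  "smooth_components A X \<longleftrightarrow>
     (\<forall>c\<in>A. smooth_on (chart_image c) (\<lambda>x. X (chart_inv c x) c))"

definition vector_fields :: "('p, 'e::euclidean_space) atlas \<Rightarrow> ('p, 'e) vfield set" where
  "vector_fields A = {X. (\<forall>p. X p \<in> tangent_space A p) \<and> smooth_components A X}"

definition lie_bracket ::
  "('p, 'e::euclidean_space) atlas \<Rightarrow> ('p, 'e) vfield \<Rightarrow> ('p, 'e) vfield \<Rightarrow> ('p, 'e) vfield" where
  "lie_bracket A X Y p = (\<lambda>c. if c \<in> A \<and> p \<in> fst c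
     then frechet_derivative (\<lambda>x. Y (chart_inv c x) c) (at (snd c p)) (X p c)
        - frechet_derivative (\<lambda>x. X (chart_inv c x) c) (at (snd c p)) (Y p c) else 0)"

definition global_frame ::
  "('p, 'e::euclidean_space) atlas \<Rightarrow> 'i set \<Rightarrow> ('i \<Rightarrow> ('p, 'e) vfield) \<Rightarrow> bool" where
  "global_frame A I e \<longleftrightarrow>
     (\<forall>i\<in>I. e i \<in> vector_fields A) \<and>
     (\<forall>p\<in>points A. inj_on (\<lambda>i. e i p) I \<and> independent ((\<lambda>i. e i p) ` I) \<and>
        span ((\<lambda>i. e i p) ` I) = tangent_space A p)"

definition dual_coframe ::
  "('p, 'e::euclidean_space) atlas \<Rightarrow> 'i set \<Rightarrow> ('i \<Rightarrow> ('p, 'e) vfield) \<Rightarrow>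
    ('i \<Rightarrow> 'p \<Rightarrow> ('p, 'e) tvec \<Rightarrow> real) \<Rightarrow> bool" where
  "dual_coframe A I e \<theta> \<longleftrightarrow>
     (\<forall>p\<in>points A. \<forall>i\<in>I. linear_map_on (tangent_space A p) (\<theta> i p) \<and>
        (\<forall>j\<in>I. \<theta> i p (e j p) = (if i = j then 1 else 0)))"

definition almost_complex_structure ::
  "('p, 'e::euclidean_space) atlas \<Rightarrow> ('p \<Rightarrow> ('p, 'e) tvec \<Rightarrow> ('p, 'e) tvec) \<Rightarrow> bool" where
  "almost_complex_structure A J \<longleftrightarrow>
     (\<forall>p\<in>points A. linear_map_on (tangent_space A p) (J p) \<and>
        (\<forall>u\<in>tangent_space A p. J p u \<in> tangent_space A p \<and> J p (J p u) = - u)) \<and>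
     (\<forall>c\<in>A. \<forall>\<xi>. smooth_on (chart_image c)
        (\<lambda>x. J (chart_inv c x) (coord_vec A c (chart_inv c x) \<xi>) c))"

definition pseudo_riemannian_metric ::
  "('p, 'e::euclidean_space) atlas \<Rightarrow> ('p \<Rightarrow> ('p, 'e) tvec \<Rightarrow> ('p, 'e) tvec \<Rightarrow> real) \<Rightarrow> bool" where
  "pseudo_riemannian_metric A g \<longleftrightarrow>
     (\<forall>p\<in>points A.
        (\<forall>u\<in>tangent_space A p. linear_map_on (tangent_space A p) (g p u)) \<and>
        (\<forall>u\<in>tangent_space A p. \<forall>v\<in>tangent_space A p. g p u v = g p v u) \<and>
        (\<forall>u\<in>tangent_space A p. (\<forall>v\<in>tangent_space A p. g p u v = 0) \<longrightarrow> u = 0)) \<and>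
     (\<forall>c\<in>A. \<forall>\<xi> \<eta>. smooth_on (chart_image c)
        (\<lambda>x. g (chart_inv c x) (coord_vec A c (chart_inv c x) \<xi>) (coord_vec A c (chart_inv c x) \<eta>)))"

text \<open>
  Exterior derivative of a 2-form: in the coordinates of a chart,
  \<open>d\<omega>(u,v,w) = \<partial>\<^sub>u \<omega>(v,w) - \<partial>\<^sub>v \<omega>(u,w) + \<partial>\<^sub>w \<omega>(u,v)\<close>, the two remaining vectors being extended
  with constant coordinates.
\<close>

definition ext_deriv2 ::
  "('p, 'e::euclidean_space) atlas \<Rightarrow> ('p \<Rightarrow> ('p, 'e) tvec \<Rightarrow> ('p, 'e) tvec \<Rightarrow> real) \<Rightarrow>
    'p \<Rightarrow> ('p, 'e) tvec \<Rightarrow> ('p, 'e) tvec \<Rightarrow> ('p, 'e) tvec \<Rightarrow> real" where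
  "ext_deriv2 A \<omega> p u v w = (let
       c = chart_at A p;
       \<omega>c = (\<lambda>\<xi> \<eta> x. \<omega> (chart_inv c x)
         (coord_vec A c (chart_inv c x) \<xi>) (coord_vec A c (chart_inv c x) \<eta>))
     in frechet_derivative (\<omega>c (v c) (w c)) (at (snd c p)) (u c)
      - frechet_derivative (\<omega>c (u c) (w c)) (at (snd c p)) (v c)
      + frechet_derivative (\<omega>c (u c) (v c)) (at (snd c p)) (w c))"

definition kaehler_form ::
  "('p \<Rightarrow> ('p, 'e) tvec \<Rightarrow> ('p, 'e) tvec \<Rightarrow> real) \<Rightarrow> ('p \<Rightarrow> ('p, 'e) tvec \<Rightarrow> ('p, 'e) tvec) \<Rightarrow>
    'p \<Rightarrow> ('p, 'e) tvec \<Rightarrow> ('p, 'e) tvec \<Rightarrow> real" where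
  "kaehler_form G J p u v = G p (J p u) v"

definition almost_hermitian ::
  "('p, 'e::euclidean_space) atlas \<Rightarrow> ('p \<Rightarrow> ('p, 'e) tvec \<Rightarrow> ('p, 'e) tvec \<Rightarrow> real) \<Rightarrow>
    ('p \<Rightarrow> ('p, 'e) tvec \<Rightarrow> ('p, 'e) tvec) \<Rightarrow> bool" where
  "almost_hermitian A G J \<longleftrightarrow>
     smooth_manifold A \<and> pseudo_riemannian_metric A G \<and> almost_complex_structure A J \<and>
     (\<forall>p\<in>points A. \<forall>u\<in>tangent_space A p. \<forall>v\<in>tangent_space A p.
        G p (J p u) (J p v) = G p u v)"

definition almost_kaehler ::
  "('p, 'e::euclidean_space) atlas \<Rightarrow> ('p \<Rightarrow> ('p, 'e) tvec \<Rightarrow> ('p, 'e) tvec \<Rightarrow> real) \<Rightarrow>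
    ('p \<Rightarrow> ('p, 'e) tvec \<Rightarrow> ('p, 'e) tvec) \<Rightarrow> bool" where
  "almost_kaehler A G J \<longleftrightarrow>
     almost_hermitian A G J \<and>
     (\<forall>p\<in>points A. \<forall>u\<in>tangent_space A p. \<forall>v\<in>tangent_space A p. \<forall>w\<in>tangent_space A p.
        ext_deriv2 A (kaehler_form G J) p u v w = 0)"

text \<open>\<open>D p u Y\<close> is the covariant derivative of the field \<open>Y\<close> along the tangent vector \<open>u\<close> at \<open>p\<close>.\<close>

type_synonym ('p, 'e) connection = "'p \<Rightarrow> ('p, 'e) tvec \<Rightarrow> ('p, 'e) vfield \<Rightarrow> ('p, 'e) tvec"

definition affine_connection ::
  "('p, 'e::euclidean_space) atlas \<Rightarrow> ('p, 'e) connection \<Rightarrow> bool" where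
  "affine_connection A D \<longleftrightarrow>
     (\<forall>p\<in>points A. \<forall>Y\<in>vector_fields A. linear_map_on (tangent_space A p) (\<lambda>u. D p u Y)) \<and>
     (\<forall>p\<in>points A. \<forall>u\<in>tangent_space A p. \<forall>Y\<in>vector_fields A. D p u Y \<in> tangent_space A p) \<and>
     (\<forall>p\<in>points A. \<forall>u\<in>tangent_space A p. \<forall>Y\<in>vector_fields A. \<forall>Z\<in>vector_fields A.
        D p u (Y + Z) = D p u Y + D p u Z) \<and>
     (\<forall>p\<in>points A. \<forall>u\<in>tangent_space A p. \<forall>Y\<in>vector_fields A. \<forall>f. smooth_function A f \<longrightarrow>
        D p u (\<lambda>q. f q *\<^sub>R Y q) = dir_deriv A p u f *\<^sub>R Y p + f p *\<^sub>R D p u Y) \<and>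
     (\<forall>X\<in>vector_fields A. \<forall>Y\<in>vector_fields A. smooth_components A (\<lambda>p. D p (X p) Y))"

definition levi_civita_connection ::
  "('p, 'e::euclidean_space) atlas \<Rightarrow> ('p \<Rightarrow> ('p, 'e) tvec \<Rightarrow> ('p, 'e) tvec \<Rightarrow> real) \<Rightarrow>
    ('p, 'e) connection \<Rightarrow> bool" where
  "levi_civita_connection A g D \<longleftrightarrow>
     affine_connection A D \<and>
     (\<forall>X\<in>vector_fields A. \<forall>Y\<in>vector_fields A. \<forall>p\<in>points A.
        D p (X p) Y - D p (Y p) X = lie_bracket A X Y p) \<and>
     (\<forall>p\<in>points A. \<forall>u\<in>tangent_space A p. \<forall>Y\<in>vector_fields A. \<forall>Z\<in>vector_fields A.
        dir_deriv A p u (\<lambda>q. g q (Y q) (Z q)) = g p (D p u Y) (Z p) + g p (Y p) (D p u Z))"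

type_synonym ('p, 'e) tpoint = "'p \<times> ('p, 'e) tvec"

definition tangent_chart ::
  "('p, 'e::euclidean_space) atlas \<Rightarrow> ('p, 'e) chart \<Rightarrow> (('p, 'e) tpoint, 'e \<times> 'e) chart" where
  "tangent_chart A c =
     (Sigma (fst c) (tangent_space A), \<lambda>(p, u). (snd c p, u c))"

definition tangent_bundle ::
  "('p, 'e::euclidean_space) atlas \<Rightarrow> (('p, 'e) tpoint, 'e \<times> 'e) atlas" where
  "tangent_bundle A = tangent_chart A ` A"

definition bundle_proj ::
  "('p, 'e::euclidean_space) atlas \<Rightarrow> ('p, 'e) tpoint \<Rightarrow> (('p, 'e) tpoint, 'e \<times> 'e) tvec \<Rightarrow>
    ('p, 'e) tvec" where
  "bundle_proj A = tangent_map (tangent_bundle A) A fst"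

text \<open>The canonical isomorphism of \<open>T\<^sub>pM\<close> with the vertical subspace at \<open>a = (p, u)\<close>.\<close>

definition vertical_lift ::
  "('p, 'e::euclidean_space) atlas \<Rightarrow> ('p, 'e) tpoint \<Rightarrow> ('p, 'e) tvec \<Rightarrow>
    (('p, 'e) tpoint, 'e \<times> 'e) tvec" where
  "vertical_lift A a w =
     curve_velocity (tangent_bundle A) (\<lambda>t. (fst a, snd a + t *\<^sub>R w)) 0"

definition is_connection_map ::
  "('p, 'e::euclidean_space) atlas \<Rightarrow> ('p, 'e) connection \<Rightarrow>
    (('p, 'e) tpoint \<Rightarrow> (('p, 'e) tpoint, 'e \<times> 'e) tvec \<Rightarrow> ('p, 'e) tvec) \<Rightarrow> bool" where
  "is_connection_map A D K \<longleftrightarrow>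
     (\<forall>a\<in>points (tangent_bundle A).
        linear_map_on (tangent_space (tangent_bundle A) a) (K a) \<and>
        (\<forall>Z\<in>tangent_space (tangent_bundle A) a. K a Z \<in> tangent_space A (fst a)) \<and>
        (\<forall>w\<in>tangent_space A (fst a). K a (vertical_lift A a w) = w)) \<and>
     (\<forall>Y\<in>vector_fields A. \<forall>p\<in>points A. \<forall>u\<in>tangent_space A p.
        K (p, Y p) (tangent_map A (tangent_bundle A) (\<lambda>q. (q, Y q)) p u) = D p u Y)"

text \<open>
  For an affine connection \<open>D\<close>, the conditions determine \<open>K a\<close> on the tangent space at every
  point \<open>a\<close> of the tangent bundle; the choice only concerns irrelevant arguments.
\<close>

definition connection_map ::
  "('p, 'e::euclidean_space) atlas \<Rightarrow> ('p, 'e) connection \<Rightarrow>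
    ('p, 'e) tpoint \<Rightarrow> (('p, 'e) tpoint, 'e \<times> 'e) tvec \<Rightarrow> ('p, 'e) tvec" where
  "connection_map A D = (SOME K. is_connection_map A D K)"

definition bundle_J ::
  "('p, 'e::euclidean_space) atlas \<Rightarrow> ('p, 'e) connection \<Rightarrow>
    ('p, 'e) tpoint \<Rightarrow> (('p, 'e) tpoint, 'e \<times> 'e) tvec \<Rightarrow> (('p, 'e) tpoint, 'e \<times> 'e) tvec" where
  "bundle_J A D a Z = (THE W. W \<in> tangent_space (tangent_bundle A) a \<and>
     bundle_proj A a W = - connection_map A D a Z \<and>
     connection_map A D a W = bundle_proj A a Z)"

definition sasaki_metric ::
  "('p, 'e::euclidean_space) atlas \<Rightarrow> ('p \<Rightarrow> ('p, 'e) tvec \<Rightarrow> ('p, 'e) tvec \<Rightarrow> real) \<Rightarrow>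
    ('p, 'e) connection \<Rightarrow> ('p, 'e) tpoint \<Rightarrow>
    (('p, 'e) tpoint, 'e \<times> 'e) tvec \<Rightarrow> (('p, 'e) tpoint, 'e \<times> 'e) tvec \<Rightarrow> real" where
  "sasaki_metric A g D a Z Z' =
     g (fst a) (bundle_proj A a Z) (bundle_proj A a Z')
     + g (fst a) (connection_map A D a Z) (connection_map A D a Z')"

definition join :: "nat \<Rightarrow> (nat \<Rightarrow> 'a) \<Rightarrow> (nat \<Rightarrow> 'a) \<Rightarrow> nat \<Rightarrow> 'a" where
  "join n x y \<alpha> = (if \<alpha> \<le> n then x \<alpha> else y (\<alpha> - n))"

end

theory Submission
  imports Defs
begin

text \<open>
  The Kaehler form is \<open>\<omega>(Z, W) = g(\<pi>\<^sub>* Z, K W) - g(K Z, \<pi>\<^sub>* W)\<close>. Passing from the Levi-Civita connection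
  to \<open>X, Y \<mapsto> \<nabla>\<^sub>X Y + \<theta>(Y) J X\<close> replaces \<open>K Z\<close> at \<open>y \<in> TM\<close> by \<open>K Z + \<theta>(y) J \<pi>\<^sub>* Z\<close>; since \<open>J\<close> is
  \<open>g\<close>-self-adjoint (\<open>g\<close> is a Norden metric), the two additional terms of \<open>\<omega>\<close> cancel. For the
  Levi-Civita connection itself \<open>\<omega>\<close> is exact: it is minus the differential of the 1-form
  \<open>Z \<mapsto> g(y, \<pi>\<^sub>* Z)\<close>, the pullback of the Liouville form by \<open>g\<close>.

  The global frame gives vector fields through every tangent vector and smooth coefficient functions
  for every vector field, so that the connection map is determined without cut-off functions.
\<close>

section \<open>Calculus of smooth maps\<close>

text \<open>Tangent vectors are by definition families of components, and \<open>ext_deriv2\<close>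
  extends vectors with constant coordinates, so the computations take place in charts. Fields with
  constant coordinates are only local, however, while a connection acts on global fields; this is
  why the Christoffel symbols are obtained by expansion in the frame. The coframe is assumed to be
  linear and dual only point by point, so its smoothness has to be derived from that of the frame.
  That a family of components transforms correctly is usually seen by writing it through global
  fields, which avoids the transformation law of Christoffel symbols. In coordinates
  \<open>(x, y)\<close> of the tangent bundle the Kaehler form contains only the metric and its
  first derivatives, and \<open>d\<omega> = 0\<close> comes down to the symmetry of the metric and
  of its second derivatives. The opposite signs of \<open>g\<close> on \<open>v i\<close> and
  \<open>w i\<close> are what makes \<open>J\<close> self-adjoint. With equal signs \<open>J\<close>
  would be skew-adjoint, and the two additional terms of \<open>\<omega>\<close> would add up
  instead of cancelling.\<close>

lemma Ck_on_cong:
  assumes "open S" "\<And>x. x \<in> S \<Longrightarrow> f x = g x"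
  shows "Ck_on k S f \<longleftrightarrow> Ck_on k S g"
  using assms(2)
proof (induction k arbitrary: f g)
  case 0
  then show ?case by (simp cong: continuous_on_cong)
next
  case (Suc k)
  have d: "(f has_derivative f') (at x) \<longleftrightarrow> (g has_derivative f') (at x)" if "x \<in> S" for x f'
    by (rule iffI; erule has_derivative_transform_within_open[OF _ \<open>open S\<close> that])
      (simp_all add: Suc.prems)
  \<comment> \<open>\<open>frechet_derivative\<close> is a choice from the set of derivatives, so
    equal sets are enough, even where there is no derivative.\<close>
  then have "frechet_derivative f (at x) = frechet_derivative g (at x)" if "x \<in> S" for x
    using that by (simp add: frechet_derivative_def)
  then have "Ck_on k S (\<lambda>x. frechet_derivative f (at x) v) \<longleftrightarrow>
      Ck_on k S (\<lambda>x. frechet_derivative g (at x) v)" for v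
    by (intro Suc.IH) simp
  moreover have "f differentiable at x \<longleftrightarrow> g differentiable at x" if "x \<in> S" for x
    using d[OF that] by (simp add: differentiable_def)
  ultimately show ?case by auto
qed

text \<open>The inductions on \<open>k\<close> below know their derivative by a formula; this lets
  the formula stand for the choice made by \<open>frechet_derivative\<close>.\<close>

lemma Ck_on_SucI:
  assumes "open S" "\<And>x. x \<in> S \<Longrightarrow> (f has_derivative f' x) (at x)" "\<And>v. Ck_on k S (\<lambda>x. f' x v)"
  shows "Ck_on (Suc k) S f"
proof -
  have "Ck_on k S (\<lambda>x. frechet_derivative f (at x) v) \<longleftrightarrow> Ck_on k S (\<lambda>x. f' x v)" for v
    using assms(2) by (intro Ck_on_cong[OF \<open>open S\<close>]) (metis assms(2) frechet_derivative_at)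
  then show ?thesis
    using assms by (auto simp: differentiable_def)
qed

lemma Ck_on_Suc_has_derivative:
  "Ck_on (Suc k) S f \<Longrightarrow> x \<in> S \<Longrightarrow> (f has_derivative frechet_derivative f (at x)) (at x)"
  by (simp add: frechet_derivative_works)

lemma Ck_on_SucD: "Ck_on (Suc k) S f \<Longrightarrow> Ck_on k S f"
proof (induction k arbitrary: f)
  case 0
  then show ?case
    by (simp add: continuous_at_imp_continuous_on differentiable_imp_continuous_within)
next
  case (Suc k)
  \<comment> \<open>Only the outer \<open>Suc\<close> is unfolded, so that the inner one stays in
    the form that the induction hypothesis expects.\<close>
  have "Ck_on k S (\<lambda>x. frechet_derivative f (at x) v)" for v
    by (rule Suc.IH) (use Suc.prems in \<open>simp del: Ck_on.simps(2) add: Ck_on.simps(2)[of "Suc k"]\<close>)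
  with Suc.prems show ?case by simp
qed

lemma Ck_on_subset: "Ck_on k S f \<Longrightarrow> T \<subseteq> S \<Longrightarrow> Ck_on k T f"
  by (induction k arbitrary: f) (auto intro: continuous_on_subset)

lemma Ck_on_const: "Ck_on k S (\<lambda>x. c)"
  by (induction k arbitrary: c) auto

lemma Ck_on_bounded_linear:
  assumes "bounded_linear L" "open S" "Ck_on k S f"
  shows "Ck_on k S (\<lambda>x. L (f x))"
  using assms(3)
proof (induction k arbitrary: f)
  case 0
  then show ?case
    using linear_continuous_on_compose assms(1) bounded_linear.continuous_on by auto
next
  case (Suc k)
  show ?case
    by (rule Ck_on_SucI[OF \<open>open S\<close> bounded_linear.has_derivative[OF assms(1)
            Ck_on_Suc_has_derivative[OF Suc.prems]]])
      (assumption | rule Suc.IH | use Suc.prems in simp)+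
qed

lemma Ck_on_add:
  assumes "open S" "Ck_on k S f" "Ck_on k S g"
  shows "Ck_on k S (\<lambda>x. f x + g x)"
  using assms(2,3)
proof (induction k arbitrary: f g)
  case 0
  then show ?case by (auto intro: continuous_on_add)
next
  case (Suc k)
  show ?case
    by (rule Ck_on_SucI[OF \<open>open S\<close> has_derivative_add[OF Ck_on_Suc_has_derivative[OF Suc.prems(1)]
          Ck_on_Suc_has_derivative[OF Suc.prems(2)]]])
      (assumption | rule Suc.IH | use Suc.prems in simp)+
qed

lemma Ck_on_sum:
  assumes "open S" "\<And>i. i \<in> I \<Longrightarrow> Ck_on k S (f i)"
  shows "Ck_on k S (\<lambda>x. \<Sum>i\<in>I. f i x)"
  using assms(2)
  by (induction I rule: infinite_finite_induct) (auto intro: Ck_on_add[OF \<open>open S\<close>] Ck_on_const)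

lemma Ck_on_Pair:
  assumes "open S" "Ck_on k S f" "Ck_on k S g"
  shows "Ck_on k S (\<lambda>x. (f x, g x))"
  using assms(2,3)
proof (induction k arbitrary: f g)
  case 0
  then show ?case by (auto intro: continuous_on_Pair)
next
  case (Suc k)
  show ?case
    by (rule Ck_on_SucI[OF \<open>open S\<close> has_derivative_Pair[OF Ck_on_Suc_has_derivative[OF Suc.prems(1)]
          Ck_on_Suc_has_derivative[OF Suc.prems(2)]]])
      (assumption | rule Suc.IH | use Suc.prems in simp)+
qed

text \<open>The product rule leaves one factor undifferentiated; \<open>Ck_on_SucD\<close> lowers
  its order to that of the induction hypothesis.\<close>

lemma Ck_on_bounded_bilinear:
  assumes "bounded_bilinear p" "open S" "Ck_on k S f" "Ck_on k S g"
  shows "Ck_on k S (\<lambda>x. p (f x) (g x))"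
  using assms(3,4)
proof (induction k arbitrary: f g)
  case 0
  then show ?case by (auto intro: bounded_bilinear.continuous_on[OF assms(1)])
next
  case (Suc k)
  show ?case
    by (rule Ck_on_SucI[OF \<open>open S\<close> bounded_bilinear.FDERIV[OF assms(1)
            Ck_on_Suc_has_derivative[OF Suc.prems(1)] Ck_on_Suc_has_derivative[OF Suc.prems(2)]]])
      (assumption | rule Ck_on_add[OF \<open>open S\<close>] Suc.IH Suc.prems[THEN Ck_on_SucD]
        | use Suc.prems in simp)+
qed

lemma linear_sum_Basis:
  fixes x :: "'a::euclidean_space"
  assumes "linear L"
  shows "L x = (\<Sum>b\<in>Basis. (x \<bullet> b) *\<^sub>R L b)"
proof -
  have "L x = L (\<Sum>b\<in>Basis. (x \<bullet> b) *\<^sub>R b)"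
    by (simp add: euclidean_representation)
  also have "\<dots> = (\<Sum>b\<in>Basis. (x \<bullet> b) *\<^sub>R L b)"
    using assms by (simp add: linear_sum linear_cmul)
  finally show ?thesis .
qed

text \<open>The chain rule evaluates the derivative of \<open>g\<close> at a direction that moves
  with \<open>x\<close>, but \<open>Ck_on\<close> controls fixed directions only. Expanding the
  moving direction in a basis of the intermediate space gives a finite sum of products of functions
  that the induction hypothesis covers.\<close>

lemma Ck_on_compose:
  fixes f :: "'a::real_normed_vector \<Rightarrow> 'b::euclidean_space"
  assumes "open S" "open T" "f ` S \<subseteq> T" "Ck_on k S f" "Ck_on k T g"
  shows "Ck_on k S (\<lambda>x. g (f x))"
  using assms(4,5)
proof (induction k arbitrary: g)
  case 0
  then show ?case using assms(3) by (auto intro: continuous_on_compose2)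
next
  case (Suc k)
  have fd: "(f has_derivative frechet_derivative f (at x)) (at x)" if "x \<in> S" for x
    using Ck_on_Suc_has_derivative[OF Suc.prems(1) that] .
  have gd: "(g has_derivative frechet_derivative g (at (f x))) (at (f x))" if "x \<in> S" for x
    using Ck_on_Suc_has_derivative[OF Suc.prems(2)] that assms(3) by blast
  show ?case
  proof (rule Ck_on_SucI[OF \<open>open S\<close>])
    fix x assume x: "x \<in> S"
    have "((\<lambda>x. g (f x)) has_derivative (\<lambda>v. frechet_derivative g (at (f x))
        (frechet_derivative f (at x) v))) (at x)"
      by (rule has_derivative_compose[OF fd[OF x] gd[OF x]])
    moreover have "linear (frechet_derivative g (at (f x)))"
      using gd[OF x] has_derivative_linear by blast
    ultimately show "((\<lambda>x. g (f x)) has_derivative (\<lambda>v. \<Sum>b\<in>Basis.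
        (frechet_derivative f (at x) v \<bullet> b) *\<^sub>R frechet_derivative g (at (f x)) b)) (at x)"
      by (simp add: linear_sum_Basis[symmetric])
  next
    fix v
    have "Ck_on k S (\<lambda>x. frechet_derivative g (at (f x)) b)" for b
      by (rule Suc.IH[OF Ck_on_SucD[OF Suc.prems(1)]]) (use Suc.prems in simp)
    moreover have "Ck_on k S (\<lambda>x. frechet_derivative f (at x) v \<bullet> b)" for b
      by (rule Ck_on_bounded_linear[OF bounded_linear_inner_left \<open>open S\<close>]) (use Suc.prems in simp)
    ultimately show "Ck_on k S (\<lambda>x. \<Sum>b\<in>Basis.
        (frechet_derivative f (at x) v \<bullet> b) *\<^sub>R frechet_derivative g (at (f x)) b)"
      by (intro Ck_on_sum Ck_on_bounded_bilinear[OF bounded_bilinear_scaleR] \<open>open S\<close>)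
  qed
qed

lemma smooth_on_cong:
  assumes "open S" "smooth_on S g" "\<And>x. x \<in> S \<Longrightarrow> f x = g x"
  shows "smooth_on S f"
proof -
  have "Ck_on k S f \<longleftrightarrow> Ck_on k S g" for k
    by (rule Ck_on_cong) (use assms in auto)
  with assms(2) show ?thesis by (simp add: smooth_on_def)
qed

lemma smooth_on_subset: "smooth_on S f \<Longrightarrow> T \<subseteq> S \<Longrightarrow> smooth_on T f"
  by (auto simp: smooth_on_def intro: Ck_on_subset)

lemma smooth_on_const: "smooth_on S (\<lambda>x. c)"
  by (simp add: smooth_on_def Ck_on_const)

lemma smooth_on_bounded_linear:
  "bounded_linear L \<Longrightarrow> open S \<Longrightarrow> smooth_on S f \<Longrightarrow> smooth_on S (\<lambda>x. L (f x))"
  by (simp add: smooth_on_def Ck_on_bounded_linear)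

lemma smooth_on_add:
  "open S \<Longrightarrow> smooth_on S f \<Longrightarrow> smooth_on S g \<Longrightarrow> smooth_on S (\<lambda>x. f x + g x)"
  by (simp add: smooth_on_def Ck_on_add)

lemma smooth_on_sum:
  "open S \<Longrightarrow> (\<And>i. i \<in> I \<Longrightarrow> smooth_on S (f i)) \<Longrightarrow> smooth_on S (\<lambda>x. \<Sum>i\<in>I. f i x)"
  by (simp add: smooth_on_def Ck_on_sum)

lemma smooth_on_minus: "open S \<Longrightarrow> smooth_on S f \<Longrightarrow> smooth_on S (\<lambda>x. - f x)"
  by (rule smooth_on_bounded_linear[OF bounded_linear_minus[OF bounded_linear_ident]])

lemma smooth_on_diff:
  "open S \<Longrightarrow> smooth_on S f \<Longrightarrow> smooth_on S g \<Longrightarrow> smooth_on S (\<lambda>x. f x - g x)"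
  using smooth_on_add[of S f "\<lambda>x. - g x"] smooth_on_minus[of S g] by simp

lemma smooth_on_Pair:
  "open S \<Longrightarrow> smooth_on S f \<Longrightarrow> smooth_on S g \<Longrightarrow> smooth_on S (\<lambda>x. (f x, g x))"
  by (simp add: smooth_on_def Ck_on_Pair)

lemma smooth_on_scaleR:
  "open S \<Longrightarrow> smooth_on S f \<Longrightarrow> smooth_on S g \<Longrightarrow> smooth_on S (\<lambda>x. f x *\<^sub>R g x)"
  by (simp add: smooth_on_def Ck_on_bounded_bilinear[OF bounded_bilinear_scaleR])

lemma smooth_on_mult:
  fixes f g :: "_ \<Rightarrow> real"
  shows "open S \<Longrightarrow> smooth_on S f \<Longrightarrow> smooth_on S g \<Longrightarrow> smooth_on S (\<lambda>x. f x * g x)"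
  by (simp add: smooth_on_def Ck_on_bounded_bilinear[OF bounded_bilinear_mult])

lemma smooth_on_compose:
  fixes f :: "'a::real_normed_vector \<Rightarrow> 'b::euclidean_space"
  shows "open S \<Longrightarrow> open T \<Longrightarrow> f ` S \<subseteq> T \<Longrightarrow> smooth_on S f \<Longrightarrow> smooth_on T g \<Longrightarrow>
    smooth_on S (\<lambda>x. g (f x))"
  by (simp add: smooth_on_def Ck_on_compose)

lemma smooth_on_ident: "smooth_on S (\<lambda>x. x)"
proof -
  have "Ck_on k S (\<lambda>x. x)" for k by (cases k) (auto intro: Ck_on_const)
  then show ?thesis by (simp add: smooth_on_def)
qed

lemma smooth_on_linear:
  "bounded_linear L \<Longrightarrow> smooth_on S L"
  using smooth_on_subset[OF smooth_on_bounded_linear[OF _ open_UNIV smooth_on_ident]] by blast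

lemma smooth_on_has_derivative:
  "smooth_on S f \<Longrightarrow> x \<in> S \<Longrightarrow> (f has_derivative frechet_derivative f (at x)) (at x)"
  unfolding smooth_on_def using Ck_on_Suc_has_derivative[of 0 S f x] by blast

lemma smooth_on_continuous_on: "smooth_on S f \<Longrightarrow> continuous_on S f"
  unfolding smooth_on_def using Ck_on.simps(1)[of S f] by blast

lemma smooth_on_frechet_derivative:
  "smooth_on S f \<Longrightarrow> smooth_on S (\<lambda>x. frechet_derivative f (at x) v)"
  unfolding smooth_on_def using Ck_on.simps(2)[of _ S f] by blast

text \<open>Transition derivatives, Christoffel symbols and metrics are known to be smooth at fixed
  vectors and are needed at moving ones. Linearity reduces the moving vector to the finitely many
  basis vectors.\<close>

lemma smooth_on_linear_family:
  fixes h :: "'a::real_normed_vector \<Rightarrow> 'b::euclidean_space" and f :: "'a \<Rightarrow> 'c::euclidean_space"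
  assumes "open S" "open U" "f ` S \<subseteq> U" "smooth_on S f" "smooth_on S h"
    and lin: "\<And>x. x \<in> U \<Longrightarrow> linear (L x)" and sm: "\<And>b. smooth_on U (\<lambda>x. L x b)"
  shows "smooth_on S (\<lambda>s. L (f s) (h s))"
proof -
  have "smooth_on S (\<lambda>s. \<Sum>b\<in>Basis. (h s \<bullet> b) *\<^sub>R L (f s) b)"
    by (intro smooth_on_sum smooth_on_scaleR smooth_on_bounded_linear[OF bounded_linear_inner_left]
        smooth_on_compose[OF \<open>open S\<close> \<open>open U\<close> assms(3,4)] assms(1,5) sm)
  moreover have "L (f s) (h s) = (\<Sum>b\<in>Basis. (h s \<bullet> b) *\<^sub>R L (f s) b)" if "s \<in> S" for s
    using that assms(3) by (intro linear_sum_Basis lin) auto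
  ultimately show ?thesis
    by (rule smooth_on_cong[OF \<open>open S\<close>])
qed

section \<open>Symmetry of second derivatives\<close>

text \<open>The mean value theorem along \<open>u\<close> and again along \<open>v\<close> turns the
  quotient into the mixed derivative at some point of the small parallelogram, and the mixed
  derivative is continuous.\<close>

lemma second_difference_tendsto:
  fixes f :: "'a::real_normed_vector \<Rightarrow> real"
  assumes "open S" "smooth_on S f" "x \<in> S"
  shows "((\<lambda>t. (f (x + t *\<^sub>R u + t *\<^sub>R v) - f (x + t *\<^sub>R u) - f (x + t *\<^sub>R v) + f x) / (t * t))
    \<longlongrightarrow> frechet_derivative (\<lambda>z. frechet_derivative f (at z) u) (at x) v) (at_right 0)"
proof (rule tendstoI)
  fix \<epsilon> :: real assume "\<epsilon> > 0"
  define Df where "Df = (\<lambda>z. frechet_derivative f (at z) u)"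
  define H where "H = (\<lambda>z. frechet_derivative Df (at z) v)"
  have sDf: "smooth_on S Df"
    unfolding Df_def by (rule smooth_on_frechet_derivative[OF assms(2)])
  have sH: "smooth_on S H"
    unfolding H_def by (rule smooth_on_frechet_derivative[OF sDf])
  have "isCont H x"
    using smooth_on_continuous_on[OF sH] assms(1,3) continuous_on_eq_continuous_at by blast
  then obtain r1 where r1: "r1 > 0" "\<And>z. dist z x < r1 \<Longrightarrow> dist (H z) (H x) < \<epsilon>"
    using \<open>\<epsilon> > 0\<close> unfolding continuous_at_eps_delta by blast
  obtain r2 where r2: "r2 > 0" "ball x r2 \<subseteq> S"
    using assms(1,3) openE by blast
  define r where "r = min r1 r2"
  \<comment> \<open>For parameters below \<delta> the parallelogram at \<open>x\<close> lies in the
    ball of radius \<open>r\<close>; the summand 1 keeps the denominator positive when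
    \<open>u\<close> and \<open>v\<close> vanish.\<close>
  define \<delta> where "\<delta> = r / (norm u + norm v + 1)"
  have npos: "norm u + norm v + 1 > 0" by (simp add: add_nonneg_pos)
  have "r > 0" using r1 r2 by (simp add: r_def)
  then have "\<delta> > 0" using npos by (simp add: \<delta>_def)
  have near: "x + s *\<^sub>R u + t *\<^sub>R v \<in> S \<and> dist (H (x + s *\<^sub>R u + t *\<^sub>R v)) (H x) < \<epsilon>"
    if "0 \<le> s" "s < \<delta>" "0 \<le> t" "t < \<delta>" for s t
  proof -
    have "dist (x + s *\<^sub>R u + t *\<^sub>R v) x = norm (s *\<^sub>R u + t *\<^sub>R v)"
      by (simp add: dist_norm add.assoc)
    also have "\<dots> \<le> s * norm u + t * norm v"
      using norm_triangle_ineq[of "s *\<^sub>R u" "t *\<^sub>R v"] that by simp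
    also have "\<dots> \<le> \<delta> * norm u + \<delta> * norm v"
      using that by (intro add_mono mult_right_mono) auto
    also have "\<dots> < \<delta> * (norm u + norm v + 1)"
      using \<open>\<delta> > 0\<close> by (simp add: algebra_simps)
    also have "\<dots> = r"
      using npos by (simp add: \<delta>_def)
    finally have "dist (x + s *\<^sub>R u + t *\<^sub>R v) x < r" .
    then have d: "dist (x + s *\<^sub>R u + t *\<^sub>R v) x < r1" "dist (x + s *\<^sub>R u + t *\<^sub>R v) x < r2"
      by (simp_all add: r_def)
    then have "x + s *\<^sub>R u + t *\<^sub>R v \<in> ball x r2"
      by (metis dist_commute mem_ball)
    with d(1) show ?thesis
      using r1(2) r2(2) by blast
  qed
  have line: "((\<lambda>s. h (y + s *\<^sub>R e)) has_real_derivative frechet_derivative h (at (y + s *\<^sub>R e)) e) (at s)"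
    if "smooth_on S h" "y + s *\<^sub>R e \<in> S" for h :: "'a \<Rightarrow> real" and y e s
  proof -
    have d: "(h has_derivative frechet_derivative h (at (y + s *\<^sub>R e))) (at (y + s *\<^sub>R e))"
      by (rule smooth_on_has_derivative[OF that])
    have "((\<lambda>s. y + s *\<^sub>R e) has_derivative (\<lambda>k. k *\<^sub>R e)) (at s)"
      by (auto intro!: derivative_eq_intros)
    from has_derivative_compose[OF this d]
    have "((\<lambda>s. h (y + s *\<^sub>R e)) has_derivative
        (\<lambda>k. frechet_derivative h (at (y + s *\<^sub>R e)) (k *\<^sub>R e))) (at s)" .
    moreover have "frechet_derivative h (at (y + s *\<^sub>R e)) (k *\<^sub>R e) =
        frechet_derivative h (at (y + s *\<^sub>R e)) e * k" for k
      using has_derivative_linear[OF d] by (simp add: linear_cmul)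
    ultimately show ?thesis
      by (simp add: has_field_derivative_def)
  qed
  have "dist ((f (x + t *\<^sub>R u + t *\<^sub>R v) - f (x + t *\<^sub>R u) - f (x + t *\<^sub>R v) + f x) / (t * t)) (H x) < \<epsilon>"
    if t: "0 < t" "t < \<delta>" for t
  proof -
    \<comment> \<open>The second difference is the increment of this function between 0 and
      \<open>t\<close>: the difference of \<open>f\<close> along two parallel lines in direction
      \<open>u\<close>.\<close>
    have "((\<lambda>s. f ((x + t *\<^sub>R v) + s *\<^sub>R u) - f (x + s *\<^sub>R u)) has_real_derivative
        Df ((x + t *\<^sub>R v) + s *\<^sub>R u) - Df (x + s *\<^sub>R u)) (at s)" if "0 \<le> s" "s \<le> t" for s
    proof -
      have "x + t *\<^sub>R v + s *\<^sub>R u \<in> S" "x + s *\<^sub>R u \<in> S"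
        using near[of s t] near[of s 0] that t by (simp_all add: add_ac)
      from line[OF assms(2) this(1)] line[OF assms(2) this(2)] show ?thesis
        unfolding Df_def by (rule DERIV_diff)
    qed
    then obtain s where s: "0 < s" "s < t" and
      eq1: "(f ((x + t *\<^sub>R v) + t *\<^sub>R u) - f (x + t *\<^sub>R u)) - (f ((x + t *\<^sub>R v) + 0 *\<^sub>R u) - f (x + 0 *\<^sub>R u)) =
        (t - 0) * (Df ((x + t *\<^sub>R v) + s *\<^sub>R u) - Df (x + s *\<^sub>R u))"
      using MVT2[OF t(1), of "\<lambda>s. f ((x + t *\<^sub>R v) + s *\<^sub>R u) - f (x + s *\<^sub>R u)"
          "\<lambda>s. Df ((x + t *\<^sub>R v) + s *\<^sub>R u) - Df (x + s *\<^sub>R u)"] by auto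
    have "((\<lambda>q. Df ((x + s *\<^sub>R u) + q *\<^sub>R v)) has_real_derivative
        H ((x + s *\<^sub>R u) + q *\<^sub>R v)) (at q)" if "0 \<le> q" "q \<le> t" for q
      unfolding H_def by (rule line[OF sDf]) (use near[of s q] that t s in auto)
    then obtain q where q: "0 < q" "q < t" and
      eq2: "Df ((x + s *\<^sub>R u) + t *\<^sub>R v) - Df ((x + s *\<^sub>R u) + 0 *\<^sub>R v) =
        (t - 0) * H ((x + s *\<^sub>R u) + q *\<^sub>R v)"
      using MVT2[OF t(1), of "\<lambda>q. Df ((x + s *\<^sub>R u) + q *\<^sub>R v)"
          "\<lambda>q. H ((x + s *\<^sub>R u) + q *\<^sub>R v)"] by auto
    have "f (x + t *\<^sub>R u + t *\<^sub>R v) - f (x + t *\<^sub>R u) - f (x + t *\<^sub>R v) + f x =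
        t * t * H (x + s *\<^sub>R u + q *\<^sub>R v)"
    proof -
      have c: "x + t *\<^sub>R v + r *\<^sub>R u = x + r *\<^sub>R u + t *\<^sub>R v" for r by (simp add: add_ac)
      show ?thesis using eq1 eq2 unfolding c by simp
    qed
    then show ?thesis
      using near[of s q] s q t by simp
  qed
  then show "\<forall>\<^sub>F t in at_right 0. dist ((f (x + t *\<^sub>R u + t *\<^sub>R v) - f (x + t *\<^sub>R u)
      - f (x + t *\<^sub>R v) + f x) / (t * t))
      (frechet_derivative (\<lambda>z. frechet_derivative f (at z) u) (at x) v) < \<epsilon>"
    unfolding eventually_at_right_field using \<open>\<delta> > 0\<close> by (auto simp: H_def Df_def)
qed

text \<open>The second difference is symmetric in \<open>u\<close> and \<open>v\<close>, so both
  mixed derivatives are the limit of the same quotient.\<close>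

lemma frechet_derivative_commute:
  fixes f :: "'a::real_normed_vector \<Rightarrow> real"
  assumes "open S" "smooth_on S f" "x \<in> S"
  shows "frechet_derivative (\<lambda>z. frechet_derivative f (at z) u) (at x) v =
    frechet_derivative (\<lambda>z. frechet_derivative f (at z) v) (at x) u"
proof -
  have "f (x + t *\<^sub>R v + t *\<^sub>R u) - f (x + t *\<^sub>R v) - f (x + t *\<^sub>R u) + f x =
      f (x + t *\<^sub>R u + t *\<^sub>R v) - f (x + t *\<^sub>R u) - f (x + t *\<^sub>R v) + f x" for t
    unfolding add.assoc[of x] add.commute[of "t *\<^sub>R v"] by linarith
  note second_difference_tendsto[OF assms, of v u, unfolded this]
  then show ?thesis
    using second_difference_tendsto[OF assms, of u v]
    by (rule tendsto_unique[OF trivial_limit_at_right_real, rotated])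
qed

section \<open>Smoothness of dual frames\<close>

text \<open>As \<open>f\<close> vanishes at \<open>a\<close>, the product rule asks only for
  continuity of \<open>h\<close>. This is how a dual frame that is so far merely continuous can be
  differentiated.\<close>

lemma has_derivative_mult_vanishing:
  fixes f h :: "'a::real_normed_vector \<Rightarrow> real"
  assumes f: "(f has_derivative f') (at a)" "f a = 0" and h: "isCont h a"
  shows "((\<lambda>x. f x * h x) has_derivative (\<lambda>v. f' v * h a)) (at a)"
proof -
  have bl: "bounded_linear f'" using f(1) by (rule has_derivative_bounded_linear)
  obtain K where K: "\<And>v. norm (f' v) \<le> norm v * K"
    using bounded_linear.bounded[OF bl] by blast
  have t1: "((\<lambda>x. norm (f x - f a - f' (x - a)) / norm (x - a)) \<longlongrightarrow> 0) (at a)"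
    using f(1) by (simp add: has_derivative_iff_norm)
  have h': "(h \<longlongrightarrow> h a) (at a)" using h by (simp add: isCont_def)
  \<comment> \<open>The error splits into the remainder of \<open>f\<close> times \<open>h\<close>
    and \<open>f'\<close> times the increment of \<open>h\<close>: one factor of each product tends
    to 0 and the other stays bounded after division by the distance.\<close>
  have t2: "((\<lambda>x. norm (f x - f a - f' (x - a)) / norm (x - a) * \<bar>h x\<bar> + K * \<bar>h x - h a\<bar>) \<longlongrightarrow> 0) (at a)"
    using tendsto_add[OF tendsto_mult[OF t1 tendsto_rabs[OF h']]
        tendsto_mult[OF tendsto_const[of K] tendsto_rabs[OF tendsto_diff[OF h' tendsto_const[of "h a"]]]]]
    by simp
  have "((\<lambda>x. norm (f x * h x - f a * h a - f' (x - a) * h a) / norm (x - a)) \<longlongrightarrow> 0) (at a)"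
  proof (rule tendsto_sandwich[OF _ _ tendsto_const t2])
    show "\<forall>\<^sub>F x in at a. norm (f x * h x - f a * h a - f' (x - a) * h a) / norm (x - a)
        \<le> norm (f x - f a - f' (x - a)) / norm (x - a) * \<bar>h x\<bar> + K * \<bar>h x - h a\<bar>"
      unfolding eventually_at_filter
    proof (intro always_eventually allI impI)
      fix x assume "x \<noteq> a"
      then have n: "norm (x - a) > 0" by simp
      have "f x * h x - f a * h a - f' (x - a) * h a =
          (f x - f a - f' (x - a)) * h x + f' (x - a) * (h x - h a)"
        using f(2) by (simp add: algebra_simps)
      then have "norm (f x * h x - f a * h a - f' (x - a) * h a) \<le>
          norm (f x - f a - f' (x - a)) * \<bar>h x\<bar> + norm (f' (x - a)) * \<bar>h x - h a\<bar>"
        by (metis abs_mult norm_triangle_ineq real_norm_def)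
      also have "\<dots> \<le> norm (f x - f a - f' (x - a)) * \<bar>h x\<bar> + (norm (x - a) * K) * \<bar>h x - h a\<bar>"
        using K by (intro add_left_mono mult_right_mono) auto
      finally show "norm (f x * h x - f a * h a - f' (x - a) * h a) / norm (x - a)
        \<le> norm (f x - f a - f' (x - a)) / norm (x - a) * \<bar>h x\<bar> + K * \<bar>h x - h a\<bar>"
        using n by (simp add: field_simps)
    qed
  qed auto
  moreover have "bounded_linear (\<lambda>v. f' v * h a)"
    using bl by (rule bounded_linear_mult_const)
  ultimately show ?thesis
    by (simp add: has_derivative_iff_norm)
qed

text \<open>This is the identity \<open>B - A = - B (E - F) A\<close> for the inverses
  \<open>B\<close> of \<open>E\<close> and \<open>A\<close> of \<open>F\<close>, written for frames:
  apply \<open>\<theta> i x\<close> to the expansion of \<xi> in the frame at \<open>y\<close> and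
  compare the frames at \<open>x\<close> and \<open>y\<close>.\<close>

lemma dual_frame_diff:
  fixes E :: "'i \<Rightarrow> 'a \<Rightarrow> 'b::real_vector" and \<theta> :: "'i \<Rightarrow> 'a \<Rightarrow> 'b \<Rightarrow> real"
  assumes "finite I" "i \<in> I" "linear (\<theta> i x)"
    and "\<And>j. j \<in> I \<Longrightarrow> \<theta> i x (E j x) = (if i = j then 1 else 0)"
    and "(\<Sum>j\<in>I. \<theta> j y \<xi> *\<^sub>R E j y) = \<xi>"
  shows "\<theta> i x \<xi> = \<theta> i y \<xi> - (\<Sum>j\<in>I. \<theta> j y \<xi> * \<theta> i x (E j x - E j y))"
proof -
  have "\<theta> i x \<xi> = \<theta> i x (\<Sum>j\<in>I. \<theta> j y \<xi> *\<^sub>R E j y)"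
    using assms(5) by simp
  also have "\<dots> = (\<Sum>j\<in>I. \<theta> j y \<xi> * \<theta> i x (E j y))"
    using assms(3) by (simp add: linear_sum linear_cmul)
  also have "\<dots> = (\<Sum>j\<in>I. \<theta> j y \<xi> * \<theta> i x (E j x)) - (\<Sum>j\<in>I. \<theta> j y \<xi> * \<theta> i x (E j x - E j y))"
    using assms(3) by (simp add: linear_diff sum_subtractf algebra_simps)
  also have "(\<Sum>j\<in>I. \<theta> j y \<xi> * \<theta> i x (E j x)) = (\<Sum>j\<in>I. if j = i then \<theta> j y \<xi> else 0)"
    using assms(4) by (intro sum.cong) auto
  also have "\<dots> = \<theta> i y \<xi>"
    using assms(1,2) by simp
  finally show ?thesis .
qed

text \<open>By \<open>dual_frame_diff\<close> the increment of the dual frame is small with that of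
  the frame, provided that the dual frame is bounded near \<open>y\<close>. The bound comes from the
  same identity by absorption, so no determinants or matrix inverses are involved.\<close>

lemma continuous_on_dual_frame:
  fixes E :: "'i \<Rightarrow> 'a::t2_space \<Rightarrow> 'b::euclidean_space" and \<theta> :: "'i \<Rightarrow> 'a \<Rightarrow> 'b \<Rightarrow> real"
  assumes "open S" "finite I" and E: "\<And>i. i \<in> I \<Longrightarrow> continuous_on S (E i)"
    and lin: "\<And>i x. i \<in> I \<Longrightarrow> x \<in> S \<Longrightarrow> linear (\<theta> i x)"
    and dual: "\<And>i j x. i \<in> I \<Longrightarrow> j \<in> I \<Longrightarrow> x \<in> S \<Longrightarrow> \<theta> i x (E j x) = (if i = j then 1 else 0)"
    and span: "\<And>x \<xi>. x \<in> S \<Longrightarrow> (\<Sum>i\<in>I. \<theta> i x \<xi> *\<^sub>R E i x) = \<xi>"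
    and "i \<in> I"
  shows "continuous_on S (\<lambda>x. \<theta> i x \<xi>)"
  unfolding continuous_on_eq_continuous_at[OF \<open>open S\<close>]
proof
  fix y assume y: "y \<in> S"
  define N where "N = (\<lambda>x. \<Sum>i\<in>I. \<Sum>b\<in>Basis. \<bar>\<theta> i x b\<bar>)"
  define M where "M = (\<lambda>x. \<Sum>j\<in>I. norm (E j x - E j y))"
  \<comment> \<open>The constant arises by summing the estimate \<open>diff\<close> over all indices
    and all basis vectors, which have norm 1.\<close>
  define C where "C = real (card I) * real DIM('b) * N y"
  have N0: "N x \<ge> 0" for x by (simp add: N_def sum_nonneg)
  have M0: "M x \<ge> 0" for x by (simp add: M_def sum_nonneg)
  have C0: "C \<ge> 0" by (simp add: C_def N0)
  have bN: "\<bar>\<theta> i x b\<bar> \<le> N x" if "i \<in> I" "b \<in> Basis" for i x b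
  proof -
    have "\<bar>\<theta> i x b\<bar> \<le> (\<Sum>b\<in>Basis. \<bar>\<theta> i x b\<bar>)"
      by (rule member_le_sum) (use that in auto)
    also have "\<dots> \<le> N x"
      unfolding N_def
      by (rule member_le_sum[of i I "\<lambda>i. \<Sum>b\<in>Basis. \<bar>\<theta> i x b\<bar>"])
        (use that \<open>finite I\<close> in \<open>auto intro: sum_nonneg\<close>)
    finally show ?thesis .
  qed
  have opN: "\<bar>\<theta> i x \<eta>\<bar> \<le> N x * norm \<eta>" if "i \<in> I" "x \<in> S" for i x \<eta>
  proof -
    have "\<bar>\<theta> i x \<eta>\<bar> = \<bar>\<Sum>b\<in>Basis. (\<eta> \<bullet> b) * \<theta> i x b\<bar>"
      using linear_sum_Basis[OF lin[OF that], of \<eta>] by simp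
    also have "\<dots> \<le> (\<Sum>b\<in>Basis. norm \<eta> * \<bar>\<theta> i x b\<bar>)"
      by (rule order_trans[OF sum_abs])
        (auto simp: abs_mult Basis_le_norm intro!: sum_mono mult_right_mono)
    also have "\<dots> = (\<Sum>b\<in>Basis. \<bar>\<theta> i x b\<bar>) * norm \<eta>"
      by (simp add: sum_distrib_left sum_distrib_right mult.commute)
    also have "(\<Sum>b\<in>Basis. \<bar>\<theta> i x b\<bar>) \<le> N x"
      unfolding N_def
      by (rule member_le_sum[of i I "\<lambda>i. \<Sum>b\<in>Basis. \<bar>\<theta> i x b\<bar>"])
        (use that \<open>finite I\<close> in \<open>auto intro: sum_nonneg\<close>)
    finally show ?thesis by (simp add: mult_right_mono)
  qed
  have diff: "\<bar>\<theta> i x \<eta> - \<theta> i y \<eta>\<bar> \<le> N y * norm \<eta> * N x * M x" if "i \<in> I" "x \<in> S" for i x \<eta>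
  proof -
    have "\<theta> i x \<eta> = \<theta> i y \<eta> - (\<Sum>j\<in>I. \<theta> j y \<eta> * \<theta> i x (E j x - E j y))"
      by (rule dual_frame_diff) (use assms(2) lin dual span that y in auto)
    then have "\<bar>\<theta> i x \<eta> - \<theta> i y \<eta>\<bar> = \<bar>\<Sum>j\<in>I. \<theta> j y \<eta> * \<theta> i x (E j x - E j y)\<bar>"
      by simp
    also have "\<dots> \<le> (\<Sum>j\<in>I. (N y * norm \<eta>) * (N x * norm (E j x - E j y)))"
      by (rule order_trans[OF sum_abs])
        (use opN that y N0 in \<open>auto simp: abs_mult intro!: sum_mono mult_mono\<close>)
    also have "\<dots> = N y * norm \<eta> * N x * M x"
      by (simp add: M_def sum_distrib_left mult.assoc)
    finally show ?thesis .
  qed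
  have M_tendsto: "(M \<longlongrightarrow> 0) (at y)"
  proof -
    have "isCont M y"
      unfolding M_def using E y \<open>open S\<close> by (intro continuous_intros) (auto simp: continuous_on_eq_continuous_at)
    then show ?thesis by (simp add: isCont_def M_def)
  qed
  have evS: "\<forall>\<^sub>F x in at y. x \<in> S"
    using \<open>open S\<close> y by (rule eventually_at_in_open')
  \<comment> \<open>Summation gives \<open>N x \<le> N y + C * M x * N x\<close>. Once
    \<open>C * M x\<close> is below 1/2, the last term can be absorbed on the left, which yields
    \<open>N x \<le> 2 * N y\<close>.\<close>
  have "((\<lambda>x. C * M x) \<longlongrightarrow> C * 0) (at y)"
    by (intro tendsto_intros M_tendsto)
  then have "\<forall>\<^sub>F x in at y. C * M x < 1/2"
    by (rule order_tendstoD) simp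
  with evS have evN: "\<forall>\<^sub>F x in at y. N x \<le> 2 * N y"
  proof eventually_elim
    case (elim x)
    have "N x \<le> (\<Sum>i\<in>I. \<Sum>b\<in>(Basis::'b set). \<bar>\<theta> i y b\<bar> + N y * N x * M x)"
      unfolding N_def
    proof (intro sum_mono)
      fix i and b :: 'b assume "i \<in> I" "b \<in> Basis"
      then show "\<bar>\<theta> i x b\<bar> \<le> \<bar>\<theta> i y b\<bar> + (\<Sum>i\<in>I. \<Sum>b\<in>Basis. \<bar>\<theta> i y b\<bar>) * (\<Sum>i\<in>I. \<Sum>b\<in>Basis. \<bar>\<theta> i x b\<bar>) * M x"
        using diff[of i x b] elim unfolding N_def by simp
    qed
    also have "\<dots> = N y + (C * M x) * N x"
      by (simp add: N_def C_def sum.distrib mult_ac)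
    also have "\<dots> \<le> N y + 1/2 * N x"
      using elim N0[of x] by (intro add_left_mono mult_right_mono) auto
    finally show ?case by simp
  qed
  have "((\<lambda>x. (N y * norm \<xi> * (2 * N y)) * M x) \<longlongrightarrow> (N y * norm \<xi> * (2 * N y)) * 0) (at y)"
    by (intro tendsto_intros M_tendsto)
  then have z: "((\<lambda>x. (N y * norm \<xi> * (2 * N y)) * M x) \<longlongrightarrow> 0) (at y)" by simp
  have "((\<lambda>x. \<theta> i x \<xi> - \<theta> i y \<xi>) \<longlongrightarrow> 0) (at y)"
  proof (rule Lim_null_comparison[OF _ z])
    from evS evN show "\<forall>\<^sub>F x in at y. norm (\<theta> i x \<xi> - \<theta> i y \<xi>) \<le> (N y * norm \<xi> * (2 * N y)) * M x"
    proof eventually_elim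
      case (elim x)
      have "norm (\<theta> i x \<xi> - \<theta> i y \<xi>) \<le> N y * norm \<xi> * N x * M x"
        using diff[OF \<open>i \<in> I\<close> elim(1)] by simp
      also have "\<dots> \<le> N y * norm \<xi> * (2 * N y) * M x"
        using elim N0[of y] M0[of x] by (intro mult_right_mono mult_left_mono) auto
      finally show ?case .
    qed
  qed
  then show "isCont (\<lambda>x. \<theta> i x \<xi>) y"
    by (simp add: isCont_def LIM_zero_cancel)
qed

text \<open>In \<open>dual_frame_diff\<close> the frame increments vanish at \<open>x = y\<close>,
  so by \<open>has_derivative_mult_vanishing\<close> continuity of the dual frame already makes it
  differentiable. The derivative is \<open>- \<theta> E' \<theta>\<close>.\<close>

lemma smooth_on_dual_frame:
  fixes E :: "'i \<Rightarrow> 'a::real_normed_vector \<Rightarrow> 'b::euclidean_space" and \<theta> :: "'i \<Rightarrow> 'a \<Rightarrow> 'b \<Rightarrow> real"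
  assumes "open S" "finite I" and E: "\<And>i. i \<in> I \<Longrightarrow> smooth_on S (E i)"
    and lin: "\<And>i x. i \<in> I \<Longrightarrow> x \<in> S \<Longrightarrow> linear (\<theta> i x)"
    and dual: "\<And>i j x. i \<in> I \<Longrightarrow> j \<in> I \<Longrightarrow> x \<in> S \<Longrightarrow> \<theta> i x (E j x) = (if i = j then 1 else 0)"
    and span: "\<And>x \<xi>. x \<in> S \<Longrightarrow> (\<Sum>i\<in>I. \<theta> i x \<xi> *\<^sub>R E i x) = \<xi>"
    and "i \<in> I"
  shows "smooth_on S (\<lambda>x. \<theta> i x \<xi>)"
proof -
  have cont: "continuous_on S (\<lambda>x. \<theta> i x \<xi>)" if "i \<in> I" for i \<xi>
    by (rule continuous_on_dual_frame[OF assms(1,2) smooth_on_continuous_on[OF E] lin dual span that])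
  define E' where "E' = (\<lambda>j x. frechet_derivative (E j) (at x))"
  have expand: "\<theta> i x \<eta> = (\<Sum>b\<in>Basis. (\<eta> \<bullet> b) * \<theta> i x b)" if "i \<in> I" "x \<in> S" for i x \<eta>
    using linear_sum_Basis[OF lin[OF that], of \<eta>] by simp
  have deriv: "((\<lambda>x. \<theta> i x \<xi>) has_derivative
      (\<lambda>v. - (\<Sum>j\<in>I. \<theta> j y \<xi> * (\<Sum>b\<in>Basis. (E' j y v \<bullet> b) * \<theta> i y b)))) (at y)"
    if i: "i \<in> I" and y: "y \<in> S" for i y \<xi>
  proof -
    have "((\<lambda>x. \<theta> i y \<xi> - (\<Sum>j\<in>I. \<theta> j y \<xi> * (\<Sum>b\<in>Basis. ((E j x - E j y) \<bullet> b) * \<theta> i x b)))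
      has_derivative
      (\<lambda>v. 0 - (\<Sum>j\<in>I. \<theta> j y \<xi> * (\<Sum>b\<in>Basis. (E' j y v \<bullet> b) * \<theta> i y b)))) (at y)"
    proof (intro has_derivative_diff has_derivative_const has_derivative_sum
        has_derivative_mult_right has_derivative_mult_vanishing)
      fix j and b :: 'b assume "j \<in> I"
      have "(E j has_derivative E' j y) (at y)"
        unfolding E'_def by (rule smooth_on_has_derivative[OF E[OF \<open>j \<in> I\<close>] y])
      then show "((\<lambda>x. (E j x - E j y) \<bullet> b) has_derivative (\<lambda>v. E' j y v \<bullet> b)) (at y)"
        by (auto intro!: derivative_eq_intros)
      show "isCont (\<lambda>x. \<theta> i x b) y"
        using cont[OF i] y \<open>open S\<close> continuous_on_eq_continuous_at by blast
    qed simp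
    then have "((\<lambda>x. \<theta> i y \<xi> - (\<Sum>j\<in>I. \<theta> j y \<xi> * (\<Sum>b\<in>Basis. ((E j x - E j y) \<bullet> b) * \<theta> i x b)))
      has_derivative
      (\<lambda>v. - (\<Sum>j\<in>I. \<theta> j y \<xi> * (\<Sum>b\<in>Basis. (E' j y v \<bullet> b) * \<theta> i y b)))) (at y)"
      by simp
    then show ?thesis
    proof (rule has_derivative_transform_within_open[OF _ \<open>open S\<close> y])
      fix x assume "x \<in> S"
      have "\<theta> i x \<xi> = \<theta> i y \<xi> - (\<Sum>j\<in>I. \<theta> j y \<xi> * \<theta> i x (E j x - E j y))"
        by (rule dual_frame_diff) (use assms(2) lin dual span i y \<open>x \<in> S\<close> in auto)
      then show "\<theta> i y \<xi> - (\<Sum>j\<in>I. \<theta> j y \<xi> * (\<Sum>b\<in>Basis. ((E j x - E j y) \<bullet> b) * \<theta> i x b)) = \<theta> i x \<xi>"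
        by (simp only: expand[OF i \<open>x \<in> S\<close>, symmetric])
    qed
  qed
  \<comment> \<open>The derivative is polynomial in the dual frame itself and the derivatives of the
    frame, so each order of differentiability gives the next one.\<close>
  have "Ck_on k S (\<lambda>x. \<theta> i x \<xi>)" if "i \<in> I" for k i \<xi>
    using that
  proof (induction k arbitrary: i \<xi>)
    case 0
    then show ?case using cont by simp
  next
    case (Suc k)
    have E': "Ck_on k S (\<lambda>x. E' j x v)" if "j \<in> I" for j v
      using smooth_on_frechet_derivative[OF E[OF that]] by (simp add: E'_def smooth_on_def)
    show ?case
    proof (rule Ck_on_SucI[OF \<open>open S\<close> deriv[OF Suc.prems]])
      fix v
      show "Ck_on k S (\<lambda>x. - (\<Sum>j\<in>I. \<theta> j x \<xi> * (\<Sum>b\<in>Basis. (E' j x v \<bullet> b) * \<theta> i x b)))"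
        by (intro Ck_on_bounded_linear[OF bounded_linear_minus[OF bounded_linear_ident] \<open>open S\<close>]
            Ck_on_sum[OF \<open>open S\<close>] Ck_on_bounded_bilinear[OF bounded_bilinear_mult \<open>open S\<close>]
            Ck_on_bounded_linear[OF bounded_linear_inner_left \<open>open S\<close>] E' Suc.IH Suc.prems)
    qed
  qed
  with \<open>i \<in> I\<close> show ?thesis by (simp add: smooth_on_def)
qed

section \<open>Charts and tangent spaces\<close>

lemma chart_inv_in: "x \<in> chart_image c \<Longrightarrow> chart_inv c x \<in> fst c"
  by (simp add: chart_image_def chart_inv_def inv_into_into)

lemma chart_chart_inv: "x \<in> chart_image c \<Longrightarrow> snd c (chart_inv c x) = x"
  by (simp add: chart_image_def chart_inv_def f_inv_into_f)

lemma scaleR_fun_apply [simp]: "(r *\<^sub>R f) x = r *\<^sub>R f x"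
  by (simp add: scaleR_fun_def)

lemma frechet_derivative_eqI:
  "(f has_derivative f') (at x) \<Longrightarrow> frechet_derivative f (at x) = f'"
  using frechet_derivative_at by metis

lemma frechet_derivative_cong_open:
  assumes "open S" "x \<in> S" "\<And>y. y \<in> S \<Longrightarrow> f y = g y"
  shows "frechet_derivative f (at x) = frechet_derivative g (at x)"
proof -
  have "(f has_derivative f') (at x) \<longleftrightarrow> (g has_derivative f') (at x)" for f'
    by (rule iffI; erule has_derivative_transform_within_open[OF _ assms(1,2)])
      (simp_all add: assms(3))
  then show ?thesis by (simp add: frechet_derivative_def)
qed

lemma subspace_linear_map_on_sum:
  assumes "subspace S" "linear_map_on S f" "finite I" "\<And>i. i \<in> I \<Longrightarrow> u i \<in> S"
  shows "f (\<Sum>i\<in>I. r i *\<^sub>R u i) = (\<Sum>i\<in>I. r i *\<^sub>R f (u i))"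
  using assms(3,4)
proof (induction I)
  case empty
  have "f (0 *\<^sub>R 0) = 0 *\<^sub>R f 0"
    using assms(1,2) subspace_0 unfolding linear_map_on_def by blast
  then show ?case by simp
next
  case (insert i I)
  have "(\<Sum>i\<in>I. r i *\<^sub>R u i) \<in> S" "r i *\<^sub>R u i \<in> S"
    using insert.prems assms(1) by (auto intro!: subspace_sum subspace_scale)
  then show ?case
    using insert assms(2) by (simp add: linear_map_on_def)
qed

text \<open>Restricted to the atlas condition so that the tangent bundle can be an instance before
  its topology has been examined.\<close>

locale smooth_structure =
  fixes A :: "('p, 'e::euclidean_space) atlas"
  assumes smooth_atlas: "smooth_atlas A"
begin

abbreviation overlap :: "('p, 'e) chart \<Rightarrow> ('p, 'e) chart \<Rightarrow> 'e set" where
  "overlap c d \<equiv> snd c ` (fst c \<inter> fst d)"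

lemma chart_inv_chart: "c \<in> A \<Longrightarrow> p \<in> fst c \<Longrightarrow> chart_inv c (snd c p) = p"
  using smooth_atlas by (auto simp: smooth_atlas_def chart_inv_def)

lemma open_chart_image: "c \<in> A \<Longrightarrow> open (chart_image c)"
  using smooth_atlas by (auto simp: smooth_atlas_def)

lemma chart_in_image: "p \<in> fst c \<Longrightarrow> snd c p \<in> chart_image c"
  by (auto simp: chart_image_def)

lemma open_overlap: "c \<in> A \<Longrightarrow> d \<in> A \<Longrightarrow> open (overlap c d)"
  using smooth_atlas by (auto simp: smooth_atlas_def)

lemma smooth_transition: "c \<in> A \<Longrightarrow> d \<in> A \<Longrightarrow> smooth_on (overlap c d) (snd d \<circ> chart_inv c)"
  using smooth_atlas by (auto simp: smooth_atlas_def)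

lemma overlap_iff: "c \<in> A \<Longrightarrow> x \<in> overlap c d \<longleftrightarrow> x \<in> chart_image c \<and> chart_inv c x \<in> fst d"
proof
  assume "c \<in> A" "x \<in> overlap c d"
  then show "x \<in> chart_image c \<and> chart_inv c x \<in> fst d"
    by (auto simp: chart_image_def chart_inv_chart)
next
  assume "x \<in> chart_image c \<and> chart_inv c x \<in> fst d"
  then show "x \<in> overlap c d"
    using chart_inv_in[of x c] chart_chart_inv[of x c] by (intro image_eqI[of _ _ "chart_inv c x"]) auto
qed

lemma transition_has_derivative:
  assumes "c \<in> A" "d \<in> A" "p \<in> fst c" "p \<in> fst d"
  shows "(snd d \<circ> chart_inv c has_derivative
    frechet_derivative (snd d \<circ> chart_inv c) (at (snd c p))) (at (snd c p))"
  by (rule smooth_on_has_derivative[OF smooth_transition]) (use assms in auto)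

lemma linear_transition_derivative:
  assumes "c \<in> A" "d \<in> A" "p \<in> fst c" "p \<in> fst d"
  shows "linear (frechet_derivative (snd d \<circ> chart_inv c) (at (snd c p)))"
  by (rule has_derivative_linear[OF transition_has_derivative[OF assms]])

text \<open>The cocycle identity, by the chain rule on the open overlap of \<open>c\<close> and
  \<open>d\<close>. It makes \<open>coord_vec\<close> satisfy the transformation law of tangent
  vectors.\<close>

lemma transition_derivative_trans:
  assumes "c \<in> A" "d \<in> A" "e \<in> A" "p \<in> fst c" "p \<in> fst d" "p \<in> fst e"
  shows "frechet_derivative (snd e \<circ> chart_inv c) (at (snd c p)) \<xi> =
    frechet_derivative (snd e \<circ> chart_inv d) (at (snd d p))
      (frechet_derivative (snd d \<circ> chart_inv c) (at (snd c p)) \<xi>)"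
proof -
  have eq: "(snd d \<circ> chart_inv c) (snd c p) = snd d p"
    using assms by (simp add: chart_inv_chart)
  have "((\<lambda>x. (snd e \<circ> chart_inv d) ((snd d \<circ> chart_inv c) x)) has_derivative
      (\<lambda>\<xi>. frechet_derivative (snd e \<circ> chart_inv d) (at (snd d p))
        (frechet_derivative (snd d \<circ> chart_inv c) (at (snd c p)) \<xi>))) (at (snd c p))"
    by (rule has_derivative_compose[OF transition_has_derivative[OF assms(1,2,4,5)]],
        unfold eq, rule transition_has_derivative[OF assms(2,3,5,6)])
  then have "(snd e \<circ> chart_inv c has_derivative
      (\<lambda>\<xi>. frechet_derivative (snd e \<circ> chart_inv d) (at (snd d p))
        (frechet_derivative (snd d \<circ> chart_inv c) (at (snd c p)) \<xi>))) (at (snd c p))"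
  proof (rule has_derivative_transform_within_open)
    show "open (overlap c d)" "snd c p \<in> overlap c d"
      using assms by (auto intro: open_overlap)
    fix x assume "x \<in> overlap c d"
    then show "(snd e \<circ> chart_inv d) ((snd d \<circ> chart_inv c) x) = (snd e \<circ> chart_inv c) x"
      using assms by (auto simp: chart_inv_chart)
  qed
  then show ?thesis
    by (simp add: frechet_derivative_eqI)
qed

lemma transition_derivative_refl:
  assumes "c \<in> A" "p \<in> fst c"
  shows "frechet_derivative (snd c \<circ> chart_inv c) (at (snd c p)) \<xi> = \<xi>"
proof -
  have "frechet_derivative (snd c \<circ> chart_inv c) (at (snd c p)) = frechet_derivative (\<lambda>x. x) (at (snd c p))"
    by (rule frechet_derivative_cong_open[OF open_chart_image[OF assms(1)] chart_in_image[OF assms(2)]])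
      (simp add: chart_chart_inv)
  then show ?thesis by simp
qed

lemma tangent_component:
  assumes "u \<in> tangent_space A p" "c \<in> A" "d \<in> A" "p \<in> fst c" "p \<in> fst d"
  shows "u d = frechet_derivative (snd d \<circ> chart_inv c) (at (snd c p)) (u c)"
  using assms unfolding tangent_space_def by blast

lemma tangent_component_zero: "u \<in> tangent_space A p \<Longrightarrow> \<not> (c \<in> A \<and> p \<in> fst c) \<Longrightarrow> u c = 0"
  unfolding tangent_space_def by blast

lemma subspace_tangent_space: "subspace (tangent_space A p)"
proof (rule subspaceI)
  show "0 \<in> tangent_space A p"
    by (simp add: tangent_space_def linear_0[OF linear_transition_derivative])
next
  fix u v assume uv: "u \<in> tangent_space A p" "v \<in> tangent_space A p"
  show "u + v \<in> tangent_space A p"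
    unfolding tangent_space_def mem_Collect_eq plus_fun_apply
  proof (intro conjI allI impI ballI)
    show "u c + v c = 0" if "\<not> (c \<in> A \<and> p \<in> fst c)" for c
      using uv[THEN tangent_component_zero, OF that] by simp
    show "u d + v d = frechet_derivative (snd d \<circ> chart_inv c) (at (snd c p)) (u c + v c)"
      if cd: "c \<in> A" "d \<in> A" "p \<in> fst c" "p \<in> fst d" for c d
      by (simp only: linear_add[OF linear_transition_derivative[OF cd]]
          tangent_component[OF uv(1) cd, symmetric] tangent_component[OF uv(2) cd, symmetric])
  qed
next
  fix r u assume u: "u \<in> tangent_space A p"
  show "r *\<^sub>R u \<in> tangent_space A p"
    unfolding tangent_space_def mem_Collect_eq scaleR_fun_def
  proof (intro conjI allI impI ballI)
    show "r *\<^sub>R u c = 0" if "\<not> (c \<in> A \<and> p \<in> fst c)" for c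
      using tangent_component_zero[OF u that] by simp
    show "r *\<^sub>R u d = frechet_derivative (snd d \<circ> chart_inv c) (at (snd c p)) (r *\<^sub>R u c)"
      if cd: "c \<in> A" "d \<in> A" "p \<in> fst c" "p \<in> fst d" for c d
      by (simp only: linear_scale[OF linear_transition_derivative[OF cd]]
          tangent_component[OF u cd, symmetric])
  qed
qed

lemma coord_vec_tangent: "c \<in> A \<Longrightarrow> p \<in> fst c \<Longrightarrow> coord_vec A c p \<xi> \<in> tangent_space A p"
  by (auto simp: tangent_space_def coord_vec_def intro!: transition_derivative_trans)

lemma coord_vec_same: "c \<in> A \<Longrightarrow> p \<in> fst c \<Longrightarrow> coord_vec A c p \<xi> c = \<xi>"
  by (simp add: coord_vec_def transition_derivative_refl)

lemma coord_vec_component: "c \<in> A \<Longrightarrow> p \<in> fst c \<Longrightarrow> u \<in> tangent_space A p \<Longrightarrow> coord_vec A c p (u c) = u"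
  by (rule ext) (simp add: coord_vec_def tangent_component[symmetric] tangent_component_zero[symmetric])

text \<open>The way in which identities between tangent vectors are proved below: one chart around
  the point decides.\<close>

lemma tangent_eqI:
  "c \<in> A \<Longrightarrow> p \<in> fst c \<Longrightarrow> u \<in> tangent_space A p \<Longrightarrow> v \<in> tangent_space A p \<Longrightarrow> u c = v c \<Longrightarrow> u = v"
  using coord_vec_component by metis

lemma coord_vec_linear:
  assumes "c \<in> A" "p \<in> fst c"
  shows "linear (coord_vec A c p)"
  using subspace_tangent_space[of p] coord_vec_tangent[OF assms]
  by (intro linearI tangent_eqI[OF assms])
    (auto simp: coord_vec_same[OF assms] intro: subspace_add subspace_scale)

text \<open>The law from one fixed chart \<open>c\<close> to all others is enough, since the vector
  is then a \<open>coord_vec\<close> and the cocycle identity supplies the remaining pairs of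
  charts.\<close>

lemma tangent_spaceI:
  assumes "\<And>d. \<not> (d \<in> A \<and> p \<in> fst d) \<Longrightarrow> u d = 0" "c \<in> A" "p \<in> fst c"
    and "\<And>d. d \<in> A \<Longrightarrow> p \<in> fst d \<Longrightarrow> u d = frechet_derivative (snd d \<circ> chart_inv c) (at (snd c p)) (u c)"
  shows "u \<in> tangent_space A p"
proof -
  have "u = coord_vec A c p (u c)"
    by (rule ext) (simp add: coord_vec_def assms(1) assms(4)[symmetric])
  then show ?thesis
    using coord_vec_tangent[OF assms(2,3)] by metis
qed

lemma tangent_space_nonpoint: "p \<notin> points A \<Longrightarrow> u \<in> tangent_space A p \<Longrightarrow> u = 0"
  by (auto simp: tangent_space_def points_def)

lemma chart_at:
  assumes "p \<in> points A"
  shows "chart_at A p \<in> A" "p \<in> fst (chart_at A p)"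
proof -
  have "\<exists>c. c \<in> A \<and> p \<in> fst c" using assms by (auto simp: points_def)
  from someI_ex[OF this] show "chart_at A p \<in> A" "p \<in> fst (chart_at A p)"
    by (auto simp: chart_at_def)
qed

text \<open>\<open>dir_deriv\<close> refers to the chart picked by \<open>chart_at\<close>. The
  chain rule through the transition map shows that any chart around the point gives the same
  number.\<close>

lemma dir_deriv_chart:
  assumes "c \<in> A" "p \<in> fst c" "u \<in> tangent_space A p" "smooth_function A f"
  shows "dir_deriv A p u f = frechet_derivative (f \<circ> chart_inv c) (at (snd c p)) (u c)"
proof -
  have p: "p \<in> points A" using assms by (auto simp: points_def)
  define d where "d = chart_at A p"
  have d: "d \<in> A" "p \<in> fst d" using chart_at[OF p] by (auto simp: d_def)
  have "smooth_on (chart_image c) (f \<circ> chart_inv c)"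
    using assms by (simp add: smooth_function_def)
  then have fd: "(f \<circ> chart_inv c has_derivative frechet_derivative (f \<circ> chart_inv c) (at (snd c p))) (at (snd c p))"
    by (rule smooth_on_has_derivative[OF _ chart_in_image[OF assms(2)]])
  have eq: "(snd c \<circ> chart_inv d) (snd d p) = snd c p" using d by (simp add: chart_inv_chart)
  have "((\<lambda>x. (f \<circ> chart_inv c) ((snd c \<circ> chart_inv d) x)) has_derivative
     (\<lambda>\<xi>. frechet_derivative (f \<circ> chart_inv c) (at (snd c p))
       (frechet_derivative (snd c \<circ> chart_inv d) (at (snd d p)) \<xi>))) (at (snd d p))"
    by (rule has_derivative_compose[OF transition_has_derivative[OF d(1) assms(1) d(2) assms(2)]],
        unfold eq, rule fd)
  then have "(f \<circ> chart_inv d has_derivative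
     (\<lambda>\<xi>. frechet_derivative (f \<circ> chart_inv c) (at (snd c p))
       (frechet_derivative (snd c \<circ> chart_inv d) (at (snd d p)) \<xi>))) (at (snd d p))"
  proof (rule has_derivative_transform_within_open)
    show "open (overlap d c)" "snd d p \<in> overlap d c"
      using assms d by (auto intro: open_overlap)
    fix x assume "x \<in> overlap d c"
    then show "(f \<circ> chart_inv c) ((snd c \<circ> chart_inv d) x) = (f \<circ> chart_inv d) x"
      using assms d by (auto simp: chart_inv_chart)
  qed
  then have "dir_deriv A p u f = frechet_derivative (f \<circ> chart_inv c) (at (snd c p))
       (frechet_derivative (snd c \<circ> chart_inv d) (at (snd d p)) (u d))"
    by (simp add: dir_deriv_def d_def[symmetric] frechet_derivative_eqI)
  also have "frechet_derivative (snd c \<circ> chart_inv d) (at (snd d p)) (u d) = u c"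
    using tangent_component[OF assms(3) d(1) assms(1) d(2) assms(2)] by simp
  finally show ?thesis .
qed

subsection \<open>The atlas topology\<close>

text \<open>\<open>topology\<close> returns the intended open sets only for a family closed under
  finite intersections and arbitrary unions. For intersections this rests on the injectivity of the
  charts.\<close>

lemma openin_atlas_topology:
  "openin (atlas_topology A) W \<longleftrightarrow> W \<subseteq> points A \<and> (\<forall>c\<in>A. open (snd c ` (W \<inter> fst c)))"
proof -
  have "istopology (\<lambda>W. W \<subseteq> points A \<and> (\<forall>c\<in>A. open (snd c ` (W \<inter> fst c))))"
    unfolding istopology_def
  proof (intro conjI allI impI ballI)
    fix V W c
    assume VW: "V \<subseteq> points A \<and> (\<forall>c\<in>A. open (snd c ` (V \<inter> fst c)))"
      "W \<subseteq> points A \<and> (\<forall>c\<in>A. open (snd c ` (W \<inter> fst c)))"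
    then show "V \<inter> W \<subseteq> points A" by blast
    assume c: "c \<in> A"
    have "inj_on (snd c) (fst c)" using smooth_atlas c by (auto simp: smooth_atlas_def)
    then have "snd c ` (V \<inter> W \<inter> fst c) = snd c ` (V \<inter> fst c) \<inter> snd c ` (W \<inter> fst c)"
      unfolding inj_on_def by auto
    with VW c show "open (snd c ` (V \<inter> W \<inter> fst c))" by auto
  next
    fix \<K> c
    assume K: "\<forall>W\<in>\<K>. W \<subseteq> points A \<and> (\<forall>c\<in>A. open (snd c ` (W \<inter> fst c)))"
    then show "\<Union>\<K> \<subseteq> points A" by blast
    assume c: "c \<in> A"
    have "snd c ` (\<Union>\<K> \<inter> fst c) = (\<Union>W\<in>\<K>. snd c ` (W \<inter> fst c))" by blast
    with K c show "open (snd c ` (\<Union>\<K> \<inter> fst c))" by auto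
  qed
  then show ?thesis
    by (simp add: atlas_topology_def topology_inverse')
qed

lemma topspace_atlas_topology: "topspace (atlas_topology A) = points A"
proof -
  have "openin (atlas_topology A) (points A)"
    unfolding openin_atlas_topology
  proof (intro conjI ballI)
    fix c assume c: "c \<in> A"
    then have "points A \<inter> fst c = fst c" by (auto simp: points_def)
    then show "open (snd c ` (points A \<inter> fst c))"
      using open_chart_image[OF c] by (simp add: chart_image_def)
  qed simp
  then show ?thesis
    using openin_atlas_topology openin_subset openin_topspace by blast
qed

lemma openin_chart_preimage:
  assumes "c \<in> A" "open V"
  shows "openin (atlas_topology A) {p \<in> fst c. snd c p \<in> V}"
  unfolding openin_atlas_topology
proof (intro conjI ballI)
  show "{p \<in> fst c. snd c p \<in> V} \<subseteq> points A" using assms by (auto simp: points_def)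
  fix d assume d: "d \<in> A"
  have "snd d ` ({p \<in> fst c. snd c p \<in> V} \<inter> fst d) = overlap d c \<inter> (snd c \<circ> chart_inv d) -` V"
    using chart_inv_chart[OF d] by (auto simp: image_iff)
  also have "open \<dots>"
    using smooth_on_continuous_on[OF smooth_transition[OF d assms(1)]] open_overlap[OF d assms(1)] assms(2)
    by (rule continuous_open_preimage)
  finally show "open (snd d ` ({p \<in> fst c. snd c p \<in> V} \<inter> fst d))" .
qed

text \<open>A criterion that passes to the tangent bundle simply by lifting the charts. One
  direction is the Lindelof property; for the other, the preimages under the countably many charts
  of a countable basis of the model space form a basis.\<close>

lemma second_countable_iff_countable_cover:
  "second_countable (atlas_topology A) \<longleftrightarrow>
    (\<exists>C. countable C \<and> C \<subseteq> A \<and> points A \<subseteq> (\<Union>c\<in>C. fst c))"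
proof
  assume "second_countable (atlas_topology A)"
  then have L: "Lindelof_space (atlas_topology A)" by (rule second_countable_imp_Lindelof_space)
  have op: "openin (atlas_topology A) U" if "U \<in> fst ` A" for U
    using that openin_chart_preimage[of _ UNIV] by auto
  have un: "\<Union> (fst ` A) = topspace (atlas_topology A)"
    by (simp add: topspace_atlas_topology points_def)
  obtain \<V> where V: "countable \<V>" "\<V> \<subseteq> fst ` A" "\<Union>\<V> = topspace (atlas_topology A)"
    using Lindelof_spaceD[OF L _ un] op by auto
  then obtain C where "countable C" "C \<subseteq> A" "\<V> = fst ` C"
    using countable_subset_image[of \<V> fst A] by metis
  with V(3) show "\<exists>C. countable C \<and> C \<subseteq> A \<and> points A \<subseteq> (\<Union>c\<in>C. fst c)"
    by (auto simp: topspace_atlas_topology)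
next
  assume "\<exists>C. countable C \<and> C \<subseteq> A \<and> points A \<subseteq> (\<Union>c\<in>C. fst c)"
  then obtain C where C: "countable C" "C \<subseteq> A" "points A \<subseteq> (\<Union>c\<in>C. fst c)" by blast
  obtain B :: "'e set set" where B: "countable B" "topological_basis B"
    using ex_countable_basis by blast
  define \<B> where "\<B> = (\<lambda>(c, V). {p \<in> fst c. snd c p \<in> V}) ` (C \<times> B)"
  show "second_countable (atlas_topology A)"
    unfolding second_countable_def
  proof (intro exI[of _ \<B>] conjI allI impI ballI)
    show "countable \<B>" using B C by (simp add: \<B>_def)
    fix W assume "W \<in> \<B>"
    then obtain c V where W: "W = {p \<in> fst c. snd c p \<in> V}" "c \<in> C" "V \<in> B" by (auto simp: \<B>_def)
    then show "openin (atlas_topology A) W"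
      using C(2) topological_basis_open[OF B(2)] openin_chart_preimage by blast
  next
    fix U p assume U: "openin (atlas_topology A) U \<and> p \<in> U"
    then obtain c where c: "c \<in> C" "p \<in> fst c"
      using C(3) openin_subset[of "atlas_topology A" U] unfolding topspace_atlas_topology by blast
    with C have cA: "c \<in> A" by blast
    have "open (snd c ` (U \<inter> fst c))" "snd c p \<in> snd c ` (U \<inter> fst c)"
      using U cA c openin_atlas_topology by auto
    then obtain V where V: "V \<in> B" "snd c p \<in> V" "V \<subseteq> snd c ` (U \<inter> fst c)"
      by (rule topological_basisE[OF B(2)])
    have inj: "inj_on (snd c) (fst c)" using smooth_atlas cA by (auto simp: smooth_atlas_def)
    have "q \<in> U" if q: "q \<in> fst c" "snd c q \<in> V" for q
    proof -
      obtain q' where "q' \<in> U \<inter> fst c" "snd c q = snd c q'"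
        using V(3) q by blast
      then show ?thesis using inj_onD[OF inj _ q(1)] by auto
    qed
    then have "{q \<in> fst c. snd c q \<in> V} \<subseteq> U" by blast
    moreover have "{q \<in> fst c. snd c q \<in> V} \<in> \<B>"
      unfolding \<B>_def by (rule image_eqI[of _ _ "(c, V)"]) (use V(1) c in simp_all)
    ultimately show "\<exists>V\<in>\<B>. p \<in> V \<and> V \<subseteq> U"
      using c V(2) by (intro bexI[of _ "{q \<in> fst c. snd c q \<in> V}"] conjI) simp_all
  qed
qed

section \<open>The tangent bundle\<close>

lemma fst_tangent_chart: "fst (tangent_chart A c) = Sigma (fst c) (tangent_space A)"
  by (simp add: tangent_chart_def)

lemma snd_tangent_chart: "snd (tangent_chart A c) a = (snd c (fst a), snd a c)"
  by (simp add: tangent_chart_def split_beta)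

lemma tangent_chart_in: "c \<in> A \<Longrightarrow> tangent_chart A c \<in> tangent_bundle A"
  by (simp add: tangent_bundle_def)

lemma points_tangent_bundle: "points (tangent_bundle A) = Sigma (points A) (tangent_space A)"
  by (auto simp: points_def tangent_bundle_def fst_tangent_chart)

lemma chart_image_tangent_chart:
  assumes "c \<in> A"
  shows "chart_image (tangent_chart A c) = chart_image c \<times> UNIV"
proof -
  have "(x, y) \<in> snd (tangent_chart A c) ` Sigma (fst c) (tangent_space A)"
    if "x \<in> chart_image c" for x y
  proof (rule image_eqI)
    show "(x, y) = snd (tangent_chart A c) (chart_inv c x, coord_vec A c (chart_inv c x) y)"
      using that assms by (simp add: snd_tangent_chart chart_chart_inv coord_vec_same chart_inv_in)
    show "(chart_inv c x, coord_vec A c (chart_inv c x) y) \<in> Sigma (fst c) (tangent_space A)"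
      using that assms by (simp add: chart_inv_in coord_vec_tangent)
  qed
  then show ?thesis
    by (auto simp: chart_image_def fst_tangent_chart snd_tangent_chart)
qed

lemma inj_on_tangent_chart:
  assumes "c \<in> A"
  shows "inj_on (snd (tangent_chart A c)) (fst (tangent_chart A c))"
proof (rule inj_onI)
  fix a b assume a: "a \<in> fst (tangent_chart A c)" and b: "b \<in> fst (tangent_chart A c)"
    and eq: "snd (tangent_chart A c) a = snd (tangent_chart A c) b"
  have "fst a = fst b"
    using a b eq chart_inv_chart[OF assms] unfolding fst_tangent_chart snd_tangent_chart
    by (metis Pair_inject mem_Sigma_iff prod.collapse)
  moreover from this have "snd a = snd b"
    using a b eq tangent_eqI[OF assms, of "fst a" "snd a" "snd b"]
    unfolding fst_tangent_chart snd_tangent_chart by auto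
  ultimately show "a = b" by (simp add: prod_eq_iff)
qed

lemma chart_inv_tangent_chart:
  assumes "c \<in> A" "x \<in> chart_image c"
  shows "chart_inv (tangent_chart A c) (x, y) = (chart_inv c x, coord_vec A c (chart_inv c x) y)"
  unfolding chart_inv_def[of "tangent_chart A c"]
proof (rule inv_into_f_eq[OF inj_on_tangent_chart[OF assms(1)]])
  show "(chart_inv c x, coord_vec A c (chart_inv c x) y) \<in> fst (tangent_chart A c)"
    using assms by (simp add: fst_tangent_chart chart_inv_in coord_vec_tangent)
  show "snd (tangent_chart A c) (chart_inv c x, coord_vec A c (chart_inv c x) y) = (x, y)"
    using assms by (simp add: snd_tangent_chart chart_chart_inv coord_vec_same chart_inv_in)
qed

lemma overlap_tangent_chart:
  assumes "c \<in> A"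
  shows "snd (tangent_chart A c) ` (fst (tangent_chart A c) \<inter> fst (tangent_chart A d)) = overlap c d \<times> UNIV"
proof -
  have "(snd c p, y) \<in> snd (tangent_chart A c) ` Sigma (fst c \<inter> fst d) (tangent_space A)"
    if "p \<in> fst c" "p \<in> fst d" for p y
  proof (rule image_eqI)
    show "(snd c p, y) = snd (tangent_chart A c) (p, coord_vec A c p y)"
      using that assms by (simp add: snd_tangent_chart coord_vec_same)
  qed (use that assms in \<open>simp add: coord_vec_tangent\<close>)
  moreover have "fst (tangent_chart A c) \<inter> fst (tangent_chart A d) = Sigma (fst c \<inter> fst d) (tangent_space A)"
    by (auto simp: fst_tangent_chart)
  ultimately show ?thesis
    by (auto simp: snd_tangent_chart)
qed

lemma tangent_transition:
  assumes "c \<in> A" "d \<in> A" "x \<in> overlap c d"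
  shows "(snd (tangent_chart A d) \<circ> chart_inv (tangent_chart A c)) (x, y) =
    ((snd d \<circ> chart_inv c) x, frechet_derivative (snd d \<circ> chart_inv c) (at x) y)"
proof -
  have x: "x \<in> chart_image c" "chart_inv c x \<in> fst d"
    using assms overlap_iff by auto
  then show ?thesis
    using assms by (simp add: chart_inv_tangent_chart snd_tangent_chart coord_vec_def chart_chart_inv)
qed

text \<open>The fibre part is the derivative of the transition map, linear in the fibre coordinate
  and smooth in the base coordinate for each fixed direction.\<close>

lemma smooth_tangent_transition:
  assumes "c \<in> A" "d \<in> A"
  shows "smooth_on (overlap c d \<times> UNIV) (snd (tangent_chart A d) \<circ> chart_inv (tangent_chart A c))"
proof (rule smooth_on_cong)
  let ?\<phi> = "snd d \<circ> chart_inv c"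
  have op: "open (overlap c d)" by (rule open_overlap[OF assms])
  show op': "open (overlap c d \<times> (UNIV :: 'e set))" using op by (simp add: open_Times)
  have sm: "smooth_on (overlap c d) ?\<phi>" by (rule smooth_transition[OF assms])
  have im: "fst ` (overlap c d \<times> (UNIV :: 'e set)) \<subseteq> overlap c d" by auto
  show "smooth_on (overlap c d \<times> UNIV) (\<lambda>z. (?\<phi> (fst z), frechet_derivative ?\<phi> (at (fst z)) (snd z)))"
  proof (rule smooth_on_Pair[OF op'])
    show "smooth_on (overlap c d \<times> (UNIV :: 'e set)) (\<lambda>z. ?\<phi> (fst z))"
      by (rule smooth_on_compose[OF op' op im smooth_on_linear[OF bounded_linear_fst] sm])
    show "smooth_on (overlap c d \<times> UNIV) (\<lambda>z. frechet_derivative ?\<phi> (at (fst z)) (snd z))"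
    proof (rule smooth_on_linear_family[OF op' op im, where h = snd and
          L = "\<lambda>x. frechet_derivative ?\<phi> (at x)"])
      fix x assume "x \<in> overlap c d"
      then show "linear (frechet_derivative ?\<phi> (at x))"
        using has_derivative_linear[OF smooth_on_has_derivative[OF sm]] by blast
    qed (intro smooth_on_linear bounded_linear_fst bounded_linear_snd smooth_on_frechet_derivative sm)+
  qed
  show "(snd (tangent_chart A d) \<circ> chart_inv (tangent_chart A c)) z =
      (?\<phi> (fst z), frechet_derivative ?\<phi> (at (fst z)) (snd z))" if "z \<in> overlap c d \<times> UNIV" for z
    using tangent_transition[OF assms, of "fst z" "snd z"] that by (cases z) simp
qed

lemma smooth_atlas_tangent_bundle: "smooth_atlas (tangent_bundle A)"
  unfolding smooth_atlas_def
proof (intro conjI ballI)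
  fix c' assume "c' \<in> tangent_bundle A"
  then obtain c where c: "c' = tangent_chart A c" "c \<in> A" by (auto simp: tangent_bundle_def)
  show "inj_on (snd c') (fst c')" using c inj_on_tangent_chart by simp
  show "open (chart_image c')"
    using c chart_image_tangent_chart open_chart_image by (simp add: open_Times)
  fix d' assume "d' \<in> tangent_bundle A"
  then obtain d where d: "d' = tangent_chart A d" "d \<in> A" by (auto simp: tangent_bundle_def)
  show "open (snd c' ` (fst c' \<inter> fst d'))"
    using c d overlap_tangent_chart open_overlap by (simp add: open_Times)
  show "smooth_on (snd c' ` (fst c' \<inter> fst d')) (snd d' \<circ> chart_inv c')"
    using c d smooth_tangent_transition overlap_tangent_chart by simp
qed

text \<open>The Jacobian of the transition \<open>(x, y) \<mapsto> (\<phi> x, \<phi>' y)\<close> is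
  block triangular with both diagonal blocks equal to \<open>\<phi>'\<close>. The remaining block,
  with second derivatives of \<phi>, is never computed. The two facts make the projection and the
  vertical lift independent of charts.\<close>

lemma tangent_transition_derivative:
  assumes "c \<in> A" "d \<in> A" "p \<in> fst c" "p \<in> fst d" "u \<in> tangent_space A p"
  defines "\<Phi>' \<equiv> frechet_derivative (snd (tangent_chart A d) \<circ> chart_inv (tangent_chart A c))
    (at (snd (tangent_chart A c) (p, u)))"
    and "\<phi>' \<equiv> frechet_derivative (snd d \<circ> chart_inv c) (at (snd c p))"
  shows "fst (\<Phi>' z) = \<phi>' (fst z)" and "\<Phi>' (0, \<eta>) = (0, \<phi>' \<eta>)"
proof -
  let ?\<Phi> = "snd (tangent_chart A d) \<circ> chart_inv (tangent_chart A c)"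
  let ?\<phi> = "snd d \<circ> chart_inv c"
  have x: "snd c p \<in> overlap c d" using assms by auto
  have op: "open (overlap c d \<times> (UNIV :: 'e set))" using open_overlap[OF assms(1,2)] by (simp add: open_Times)
  have a: "snd (tangent_chart A c) (p, u) = (snd c p, u c)" by (simp add: snd_tangent_chart)
  have \<Phi>: "(?\<Phi> has_derivative \<Phi>') (at (snd c p, u c))"
    unfolding \<Phi>'_def a by (rule smooth_on_has_derivative[OF smooth_tangent_transition[OF assms(1,2)]]) (use x in auto)
  have \<phi>: "(?\<phi> has_derivative \<phi>') (at (snd c p))"
    unfolding \<phi>'_def by (rule transition_has_derivative[OF assms(1-4)])
  have "((\<lambda>z. fst (?\<Phi> z)) has_derivative (\<lambda>z. fst (\<Phi>' z))) (at (snd c p, u c))"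
    by (rule has_derivative_fst[OF \<Phi>])
  moreover have "((\<lambda>z. fst (?\<Phi> z)) has_derivative (\<lambda>z. \<phi>' (fst z))) (at (snd c p, u c))"
  proof (rule has_derivative_transform_within_open[OF _ op])
    show "((\<lambda>z. ?\<phi> (fst z)) has_derivative (\<lambda>z. \<phi>' (fst z))) (at (snd c p, u c))"
      using has_derivative_compose[OF has_derivative_fst[OF has_derivative_ident[of "at (snd c p, u c)"]],
          of ?\<phi> \<phi>'] \<phi> by simp
    show "?\<phi> (fst z) = fst (?\<Phi> z)" if "z \<in> overlap c d \<times> UNIV" for z
      using tangent_transition[OF assms(1,2), of "fst z" "snd z"] that by (cases z) simp
  qed (use x in simp)
  ultimately show "fst (\<Phi>' z) = \<phi>' (fst z)"
    using has_derivative_unique by metis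
  \<comment> \<open>With the base coordinate frozen the transition is linear in the fibre
    coordinate, hence its own derivative there.\<close>
  have "((\<lambda>y. ?\<Phi> (snd c p, y)) has_derivative (\<lambda>y. \<Phi>' (0, y))) (at (u c))"
    by (rule has_derivative_compose[OF has_derivative_Pair[OF has_derivative_const has_derivative_ident] \<Phi>])
  moreover have "((\<lambda>y. ?\<Phi> (snd c p, y)) has_derivative (\<lambda>y. (0, \<phi>' y))) (at (u c))"
  proof -
    have "((\<lambda>y. (?\<phi> (snd c p), \<phi>' y)) has_derivative (\<lambda>y. (0, \<phi>' y))) (at (u c))"
      by (intro has_derivative_Pair has_derivative_const bounded_linear_imp_has_derivative
          has_derivative_bounded_linear[OF \<phi>])
    moreover have "(\<lambda>y. ?\<Phi> (snd c p, y)) = (\<lambda>y. (?\<phi> (snd c p), \<phi>' y))"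
      by (rule ext) (simp only: tangent_transition[OF assms(1,2) x] \<phi>'_def)
    ultimately show ?thesis by (simp only:)
  qed
  ultimately show "\<Phi>' (0, \<eta>) = (0, \<phi>' \<eta>)"
    using has_derivative_unique by metis
qed

end

text \<open>Vectors at different base points are separated by the sets over disjoint neighbourhoods
  of these; vectors in one fibre lie in a common chart and are separated in its Euclidean
  image.\<close>

lemma smooth_manifold_tangent_bundle:
  assumes "smooth_manifold A"
  shows "smooth_manifold (tangent_bundle A)"
proof -
  interpret smooth_structure A
    using assms by unfold_locales (simp add: smooth_manifold_def)
  interpret T: smooth_structure "tangent_bundle A"
    by unfold_locales (rule smooth_atlas_tangent_bundle)
  have lift: "openin (atlas_topology (tangent_bundle A)) (Sigma W (tangent_space A))"
    if "openin (atlas_topology A) W" for W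
    unfolding T.openin_atlas_topology
  proof (intro conjI ballI)
    show "Sigma W (tangent_space A) \<subseteq> points (tangent_bundle A)"
      using that by (auto simp: openin_atlas_topology points_tangent_bundle)
    fix c' assume "c' \<in> tangent_bundle A"
    then obtain c where c: "c' = tangent_chart A c" "c \<in> A" by (auto simp: tangent_bundle_def)
    have "snd c' ` (Sigma W (tangent_space A) \<inter> fst c') = snd c ` (W \<inter> fst c) \<times> UNIV"
    proof -
      have "(snd c p, y) \<in> snd c' ` (Sigma W (tangent_space A) \<inter> fst c')"
        if "p \<in> W" "p \<in> fst c" for p y
      proof (rule image_eqI)
        show "(snd c p, y) = snd c' (p, coord_vec A c p y)"
          using that c by (simp add: snd_tangent_chart coord_vec_same)
      qed (use that c in \<open>simp add: coord_vec_tangent fst_tangent_chart\<close>)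
      then show ?thesis by (auto simp: c snd_tangent_chart fst_tangent_chart)
    qed
    then show "open (snd c' ` (Sigma W (tangent_space A) \<inter> fst c'))"
      using that c openin_atlas_topology by (simp add: open_Times)
  qed
  have "Hausdorff_space (atlas_topology (tangent_bundle A))"
    unfolding Hausdorff_space_def T.topspace_atlas_topology
  proof (intro allI impI, elim conjE)
    fix a b assume a: "a \<in> points (tangent_bundle A)" and b: "b \<in> points (tangent_bundle A)" and "a \<noteq> b"
    have pa: "fst a \<in> points A" "snd a \<in> tangent_space A (fst a)"
      "fst b \<in> points A" "snd b \<in> tangent_space A (fst b)"
      using a b by (auto simp: points_tangent_bundle)
    show "\<exists>U V. openin (atlas_topology (tangent_bundle A)) U \<and>
        openin (atlas_topology (tangent_bundle A)) V \<and> a \<in> U \<and> b \<in> V \<and> disjnt U V"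
    proof (cases "fst a = fst b")
      case False
      have "Hausdorff_space (atlas_topology A)"
        using assms by (simp add: smooth_manifold_def)
      then obtain U V where UV: "openin (atlas_topology A) U" "openin (atlas_topology A) V"
        "fst a \<in> U" "fst b \<in> V" "disjnt U V"
        using False pa unfolding Hausdorff_space_def topspace_atlas_topology by blast
      have "a \<in> Sigma U (tangent_space A)" "b \<in> Sigma V (tangent_space A)"
        using UV(3,4) pa by (cases a; cases b; simp)+
      moreover have "disjnt (Sigma U (tangent_space A)) (Sigma V (tangent_space A))"
        using UV(5) by (auto simp: disjnt_def)
      ultimately show ?thesis
        using lift[OF UV(1)] lift[OF UV(2)] by blast
    next
      case True
      then have "snd a \<noteq> snd b" using \<open>a \<noteq> b\<close> by (simp add: prod_eq_iff)
      obtain c where c: "c \<in> A" "fst a \<in> fst c" using pa by (auto simp: points_def)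
      let ?c = "tangent_chart A c"
      have "snd ?c a \<noteq> snd ?c b"
        using tangent_eqI[OF c, of "snd a" "snd b"] True pa \<open>snd a \<noteq> snd b\<close> by (auto simp: snd_tangent_chart)
      then obtain U V where UV: "open U" "open V" "snd ?c a \<in> U" "snd ?c b \<in> V" "U \<inter> V = {}"
        using hausdorff[of "snd ?c a" "snd ?c b"] by blast
      have ab: "a \<in> fst ?c" "b \<in> fst ?c"
        using c True pa by (cases a; cases b; simp add: fst_tangent_chart)+
      show ?thesis
        using T.openin_chart_preimage[OF tangent_chart_in[OF c(1)] UV(1)]
          T.openin_chart_preimage[OF tangent_chart_in[OF c(1)] UV(2)] UV ab
        by (intro exI[of _ "{p \<in> fst ?c. snd ?c p \<in> U}"] exI[of _ "{p \<in> fst ?c. snd ?c p \<in> V}"] conjI)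
          (auto simp: disjnt_iff)
    qed
  qed
  moreover have "second_countable (atlas_topology (tangent_bundle A))"
  proof -
    have "second_countable (atlas_topology A)" using assms by (simp add: smooth_manifold_def)
    then obtain C where C: "countable C" "C \<subseteq> A" "points A \<subseteq> (\<Union>c\<in>C. fst c)"
      using second_countable_iff_countable_cover by blast
    show ?thesis
      unfolding T.second_countable_iff_countable_cover
    proof (intro exI conjI)
      show "countable (tangent_chart A ` C)" using C by simp
      show "tangent_chart A ` C \<subseteq> tangent_bundle A" using C by (auto simp: tangent_bundle_def)
      show "points (tangent_bundle A) \<subseteq> (\<Union>c\<in>tangent_chart A ` C. fst c)"
        using C(3) by (auto simp: points_tangent_bundle fst_tangent_chart)
    qed
  qed
  ultimately show ?thesis
    by (simp add: smooth_manifold_def smooth_atlas_tangent_bundle)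
qed

section \<open>Vectors tangent to the tangent bundle\<close>

context smooth_structure
begin

interpretation T: smooth_structure "tangent_bundle A"
  by unfold_locales (rule smooth_atlas_tangent_bundle)

abbreviation bundle_tangent :: "('p, 'e) tpoint \<Rightarrow> (('p, 'e) tpoint, 'e \<times> 'e) tvec set" where
  "bundle_tangent a \<equiv> tangent_space (tangent_bundle A) a"

abbreviation tchart :: "('p, 'e) chart \<Rightarrow> (('p, 'e) tpoint, 'e \<times> 'e) chart" where
  "tchart \<equiv> tangent_chart A"

abbreviation bundle_vec ::
  "('p, 'e) chart \<Rightarrow> ('p, 'e) tpoint \<Rightarrow> 'e \<times> 'e \<Rightarrow> (('p, 'e) tpoint, 'e \<times> 'e) tvec" where
  "bundle_vec c \<equiv> coord_vec (tangent_bundle A) (tchart c)"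

lemma mem_tangent_chart: "(p, u) \<in> fst (tchart c) \<longleftrightarrow> p \<in> fst c \<and> u \<in> tangent_space A p"
  by (simp add: fst_tangent_chart)

lemma tangent_bundle_chart_cases:
  assumes "c' \<in> tangent_bundle A" "(p, u) \<in> fst c'"
  obtains c where "c \<in> A" "c' = tchart c" "p \<in> fst c" "u \<in> tangent_space A p"
  using assms by (auto simp: tangent_bundle_def mem_tangent_chart)

lemma tangent_bundle_tangentI:
  assumes "\<And>c'. \<not> (c' \<in> tangent_bundle A \<and> (p, u) \<in> fst c') \<Longrightarrow> Z c' = 0"
    and c: "c \<in> A" "p \<in> fst c" and u: "u \<in> tangent_space A p"
    and "\<And>d. d \<in> A \<Longrightarrow> p \<in> fst d \<Longrightarrow> Z (tchart d) = frechet_derivative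
      (snd (tchart d) \<circ> chart_inv (tchart c)) (at (snd (tchart c) (p, u)))
      (Z (tchart c))"
  shows "Z \<in> bundle_tangent (p, u)"
proof (rule T.tangent_spaceI)
  show "tchart c \<in> tangent_bundle A" "(p, u) \<in> fst (tchart c)"
    using c u by (simp_all add: tangent_chart_in mem_tangent_chart)
  fix d' assume d': "d' \<in> tangent_bundle A" "(p, u) \<in> fst d'"
  obtain d where d: "d \<in> A" "d' = tchart d" "p \<in> fst d"
    using tangent_bundle_chart_cases[OF d'] by blast
  show "Z d' = frechet_derivative (snd d' \<circ> chart_inv (tchart c))
      (at (snd (tchart c) (p, u))) (Z (tchart c))"
    unfolding d(2) by (rule assms(5)[OF d(1,3)])
qed (rule assms(1))

lemma tangent_bundle_component:
  assumes "Z \<in> bundle_tangent (p, u)"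
    and "c \<in> A" "d \<in> A" "p \<in> fst c" "p \<in> fst d" "u \<in> tangent_space A p"
  shows "Z (tchart d) = frechet_derivative
      (snd (tchart d) \<circ> chart_inv (tchart c)) (at (snd (tchart c) (p, u)))
      (Z (tchart c))"
  by (rule T.tangent_component[OF assms(1)])
    (use assms in \<open>simp_all add: tangent_chart_in mem_tangent_chart\<close>)

text \<open>\<open>tangent_map\<close> is evaluated in the chart picked at \<open>(p, u)\<close>.
  Composing with the transition to the chart over \<open>d\<close> removes the dependence on that
  choice.\<close>

lemma bundle_proj_component:
  assumes Z: "Z \<in> bundle_tangent (p, u)"
    and d: "d \<in> A" "p \<in> fst d" and u: "u \<in> tangent_space A p"
  shows "bundle_proj A (p, u) Z d = fst (Z (tchart d))"
proof -
  have "p \<in> points A" using d by (auto simp: points_def)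
  then have "(p, u) \<in> points (tangent_bundle A)"
    using u by (simp add: points_tangent_bundle)
  from T.chart_at[OF this] obtain c where
    c: "c \<in> A" "chart_at (tangent_bundle A) (p, u) = tchart c" "p \<in> fst c"
    by (elim tangent_bundle_chart_cases)
  let ?\<Phi> = "snd (tchart d) \<circ> chart_inv (tchart c)"
  have "snd d \<circ> fst \<circ> chart_inv (tchart c) = (\<lambda>z. fst (?\<Phi> z))"
    by (rule ext) (simp add: snd_tangent_chart)
  moreover have "((\<lambda>z. fst (?\<Phi> z)) has_derivative (\<lambda>z. fst (frechet_derivative ?\<Phi> (at (snd (tchart c) (p, u))) z)))
      (at (snd (tchart c) (p, u)))"
    by (rule has_derivative_fst, rule T.transition_has_derivative)
      (use c d u in \<open>simp_all add: tangent_chart_in mem_tangent_chart\<close>)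
  ultimately have "frechet_derivative (snd d \<circ> fst \<circ> chart_inv (tchart c))
      (at (snd (tchart c) (p, u))) (Z (tchart c)) =
    fst (frechet_derivative ?\<Phi> (at (snd (tchart c) (p, u))) (Z (tchart c)))"
    by (simp only: frechet_derivative_eqI)
  also have "\<dots> = fst (Z (tchart d))"
    by (simp only: tangent_bundle_component[OF Z c(1) d(1) c(3) d(2) u, symmetric])
  finally show ?thesis
    using d by (simp add: bundle_proj_def tangent_map_def c(2) Let_def)
qed

lemma bundle_proj_tangent:
  assumes Z: "Z \<in> bundle_tangent (p, u)"
    and p: "p \<in> points A" and u: "u \<in> tangent_space A p"
  shows "bundle_proj A (p, u) Z \<in> tangent_space A p"
proof -
  obtain c where c: "c \<in> A" "p \<in> fst c" using p by (auto simp: points_def)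
  show ?thesis
  proof (rule tangent_spaceI[OF _ c])
    show "bundle_proj A (p, u) Z d = 0" if "\<not> (d \<in> A \<and> p \<in> fst d)" for d
      using that by (auto simp: bundle_proj_def tangent_map_def Let_def)
    fix d assume d: "d \<in> A" "p \<in> fst d"
    show "bundle_proj A (p, u) Z d =
        frechet_derivative (snd d \<circ> chart_inv c) (at (snd c p)) (bundle_proj A (p, u) Z c)"
      unfolding bundle_proj_component[OF Z d u] bundle_proj_component[OF Z c u]
        tangent_bundle_component[OF Z c(1) d(1) c(2) d(2) u]
      by (rule tangent_transition_derivative(1)[OF c(1) d(1) c(2) d(2) u])
  qed
qed

lemma vertical_lift_component:
  assumes d: "d \<in> A" "p \<in> fst d" and u: "u \<in> tangent_space A p"
  shows "vertical_lift A (p, u) w (tchart d) = (0, w d)"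
proof -
  have "((\<lambda>t. (snd d p, u d + t *\<^sub>R w d)) has_vector_derivative (0, w d)) (at 0)"
    unfolding has_vector_derivative_def by (auto intro!: derivative_eq_intros)
  moreover have "snd (tchart d) \<circ> (\<lambda>t. (p, u + t *\<^sub>R w)) = (\<lambda>t. (snd d p, u d + t *\<^sub>R w d))"
    by (rule ext) (simp add: snd_tangent_chart)
  ultimately show ?thesis
    using d u by (simp add: vertical_lift_def curve_velocity_def tangent_chart_in mem_tangent_chart
        vector_derivative_at)
qed

lemma vertical_lift_tangent:
  assumes p: "p \<in> points A" and u: "u \<in> tangent_space A p" and w: "w \<in> tangent_space A p"
  shows "vertical_lift A (p, u) w \<in> bundle_tangent (p, u)"
proof -
  obtain c where c: "c \<in> A" "p \<in> fst c" using p by (auto simp: points_def)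
  show ?thesis
  proof (rule tangent_bundle_tangentI[OF _ c u])
    show "vertical_lift A (p, u) w c' = 0" if "\<not> (c' \<in> tangent_bundle A \<and> (p, u) \<in> fst c')" for c'
      using that by (auto simp: vertical_lift_def curve_velocity_def)
    fix d assume d: "d \<in> A" "p \<in> fst d"
    show "vertical_lift A (p, u) w (tchart d) = frechet_derivative
      (snd (tchart d) \<circ> chart_inv (tchart c)) (at (snd (tchart c) (p, u)))
      (vertical_lift A (p, u) w (tchart c))"
      unfolding vertical_lift_component[OF d u] vertical_lift_component[OF c u]
        tangent_transition_derivative(2)[OF c(1) d(1) c(2) d(2) u]
        tangent_component[OF w c(1) d(1) c(2) d(2)] ..
  qed
qed

text \<open>Inverse of the vertical lift: on vectors without base part the Jacobian of the
  transition reduces to its lower diagonal block, so the fibre components transform like a vector on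
  the base. The value 0 is the convention for pairs that are not charts around
  \<open>p\<close>.\<close>

lemma vertical_part_tangent:
  assumes Z: "Z \<in> bundle_tangent (p, u)"
    and c: "c \<in> A" "p \<in> fst c" and u: "u \<in> tangent_space A p"
    and zero: "fst (Z (tchart c)) = 0"
  shows "(\<lambda>d. if d \<in> A \<and> p \<in> fst d then snd (Z (tchart d)) else 0) \<in> tangent_space A p"
    (is "?w \<in> _")
proof (rule tangent_spaceI[OF _ c])
  fix d assume d: "d \<in> A" "p \<in> fst d"
  have Zc: "Z (tchart c) = (0, snd (Z (tchart c)))"
    using zero by (simp add: prod_eq_iff)
  have "Z (tchart d) = frechet_derivative
      (snd (tchart d) \<circ> chart_inv (tchart c)) (at (snd (tchart c) (p, u)))
      (0, snd (Z (tchart c)))"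
    using tangent_bundle_component[OF Z c(1) d(1) c(2) d(2) u] Zc by simp
  also have "\<dots> = (0, frechet_derivative (snd d \<circ> chart_inv c) (at (snd c p)) (snd (Z (tchart c))))"
    by (rule tangent_transition_derivative(2)[OF c(1) d(1) c(2) d(2) u])
  finally show "?w d = frechet_derivative (snd d \<circ> chart_inv c) (at (snd c p)) (?w c)"
    using c d by simp
qed auto

section \<open>Vector fields as maps into the tangent bundle\<close>

abbreviation local_rep :: "('p, 'e) chart \<Rightarrow> ('p, 'e) vfield \<Rightarrow> 'e \<Rightarrow> 'e" where
  "local_rep c Y \<equiv> \<lambda>x. Y (chart_inv c x) c"

lemma vector_field_tangent: "Y \<in> vector_fields A \<Longrightarrow> Y p \<in> tangent_space A p"
  by (simp add: vector_fields_def)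

lemma smooth_local_rep: "Y \<in> vector_fields A \<Longrightarrow> c \<in> A \<Longrightarrow> smooth_on (chart_image c) (local_rep c Y)"
  by (simp add: vector_fields_def smooth_components_def)

lemma local_rep_has_derivative:
  assumes "Y \<in> vector_fields A" "c \<in> A" "p \<in> fst c"
  shows "(local_rep c Y has_derivative frechet_derivative (local_rep c Y) (at (snd c p))) (at (snd c p))"
  by (rule smooth_on_has_derivative[OF smooth_local_rep[OF assms(1,2)] chart_in_image[OF assms(3)]])

text \<open>The section \<open>q \<mapsto> (q, Y q)\<close> with base points read in
  \<open>c\<close> and values read in \<open>d\<close>, which is the form in which
  \<open>tangent_map\<close> meets it. The derivative passes through the transition from
  \<open>c\<close> to \<open>d\<close>.\<close>

lemma field_transition_has_derivative:
  assumes Y: "Y \<in> vector_fields A" and c: "c \<in> A" "p \<in> fst c" and d: "d \<in> A" "p \<in> fst d"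
    and u: "u \<in> tangent_space A p"
  shows "\<exists>F'. ((\<lambda>x. (snd d (chart_inv c x), Y (chart_inv c x) d)) has_derivative F') (at (snd c p)) \<and>
    F' (u c) = (u d, frechet_derivative (local_rep d Y) (at (snd d p)) (u d))"
proof (intro exI conjI)
  let ?\<phi> = "snd d \<circ> chart_inv c"
  let ?\<phi>' = "frechet_derivative ?\<phi> (at (snd c p))"
  let ?Y' = "frechet_derivative (local_rep d Y) (at (snd d p))"
  have eq: "?\<phi> (snd c p) = snd d p" using c by (simp add: chart_inv_chart)
  have \<phi>: "(?\<phi> has_derivative ?\<phi>') (at (snd c p))"
    by (rule transition_has_derivative[OF c(1) d(1) c(2) d(2)])
  have "((\<lambda>x. local_rep d Y (?\<phi> x)) has_derivative (\<lambda>\<xi>. ?Y' (?\<phi>' \<xi>))) (at (snd c p))"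
    by (rule has_derivative_compose[OF \<phi>], unfold eq, rule local_rep_has_derivative[OF Y d])
  then have "((\<lambda>x. (?\<phi> x, local_rep d Y (?\<phi> x))) has_derivative (\<lambda>\<xi>. (?\<phi>' \<xi>, ?Y' (?\<phi>' \<xi>)))) (at (snd c p))"
    by (rule has_derivative_Pair[OF \<phi>])
  then show "((\<lambda>x. (snd d (chart_inv c x), Y (chart_inv c x) d)) has_derivative
      (\<lambda>\<xi>. (?\<phi>' \<xi>, ?Y' (?\<phi>' \<xi>)))) (at (snd c p))"
  proof (rule has_derivative_transform_within_open)
    show "open (overlap c d)" "snd c p \<in> overlap c d" using c d by (auto intro: open_overlap)
    fix x assume "x \<in> overlap c d"
    then show "(?\<phi> x, local_rep d Y (?\<phi> x)) = (snd d (chart_inv c x), Y (chart_inv c x) d)"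
      using c d overlap_iff[of c x d] by (simp add: chart_inv_chart)
  qed
  show "(?\<phi>' (u c), ?Y' (?\<phi>' (u c))) = (u d, ?Y' (u d))"
    by (simp only: tangent_component[OF u c(1) d(1) c(2) d(2), symmetric])
qed

lemma field_lift_component:
  assumes Y: "Y \<in> vector_fields A" and d: "d \<in> A" "p \<in> fst d" and u: "u \<in> tangent_space A p"
  shows "tangent_map A (tangent_bundle A) (\<lambda>q. (q, Y q)) p u (tchart d) =
    (u d, frechet_derivative (local_rep d Y) (at (snd d p)) (u d))"
proof -
  have p: "p \<in> points A" using d by (auto simp: points_def)
  define c where "c = chart_at A p"
  have c: "c \<in> A" "p \<in> fst c" using chart_at[OF p] by (simp_all add: c_def)
  obtain F' where F': "((\<lambda>x. (snd d (chart_inv c x), Y (chart_inv c x) d)) has_derivative F') (at (snd c p))"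
    "F' (u c) = (u d, frechet_derivative (local_rep d Y) (at (snd d p)) (u d))"
    using field_transition_has_derivative[OF Y c d u] by blast
  have "snd (tchart d) \<circ> (\<lambda>q. (q, Y q)) \<circ> chart_inv c = (\<lambda>x. (snd d (chart_inv c x), Y (chart_inv c x) d))"
    by (rule ext) (simp add: snd_tangent_chart)
  with F' show ?thesis
    using d vector_field_tangent[OF Y]
    by (simp add: tangent_map_def c_def[symmetric] Let_def tangent_chart_in mem_tangent_chart frechet_derivative_eqI)
qed

text \<open>The section in mixed coordinates is differentiated in two ways, directly and through the
  transition of the tangent bundle. Uniqueness of the derivative yields the transformation law,
  including the block that was left uncomputed.\<close>

lemma field_lift_tangent:
  assumes Y: "Y \<in> vector_fields A" and p: "p \<in> points A" and u: "u \<in> tangent_space A p"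
  shows "tangent_map A (tangent_bundle A) (\<lambda>q. (q, Y q)) p u \<in> bundle_tangent (p, Y p)"
proof -
  obtain c where c: "c \<in> A" "p \<in> fst c" using p by (auto simp: points_def)
  show ?thesis
  proof (rule tangent_bundle_tangentI[OF _ c vector_field_tangent[OF Y]])
    show "tangent_map A (tangent_bundle A) (\<lambda>q. (q, Y q)) p u c' = 0"
      if "\<not> (c' \<in> tangent_bundle A \<and> (p, Y p) \<in> fst c')" for c'
      using that by (auto simp: tangent_map_def Let_def)
    fix d assume d: "d \<in> A" "p \<in> fst d"
    let ?\<Phi> = "snd (tchart d) \<circ> chart_inv (tchart c)"
    let ?a = "snd (tchart c) (p, Y p)"
    let ?Y' = "frechet_derivative (local_rep c Y) (at (snd c p))"
    obtain F' where F': "((\<lambda>x. (snd d (chart_inv c x), Y (chart_inv c x) d)) has_derivative F') (at (snd c p))"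
      "F' (u c) = (u d, frechet_derivative (local_rep d Y) (at (snd d p)) (u d))"
      using field_transition_has_derivative[OF Y c d u] by blast
    have a: "(snd c p, local_rep c Y (snd c p)) = ?a"
      using c by (simp add: snd_tangent_chart chart_inv_chart)
    have "(?\<Phi> has_derivative frechet_derivative ?\<Phi> (at ?a)) (at ?a)"
      by (rule T.transition_has_derivative)
        (use c d vector_field_tangent[OF Y] in \<open>simp_all add: tangent_chart_in mem_tangent_chart\<close>)
    then have "((\<lambda>x. ?\<Phi> (x, local_rep c Y x)) has_derivative
        (\<lambda>\<xi>. frechet_derivative ?\<Phi> (at ?a) (\<xi>, ?Y' \<xi>))) (at (snd c p))"
      unfolding a[symmetric]
      by (rule has_derivative_compose[OF has_derivative_Pair[OF has_derivative_ident local_rep_has_derivative[OF Y c]]])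
    then have "((\<lambda>x. (snd d (chart_inv c x), Y (chart_inv c x) d)) has_derivative
        (\<lambda>\<xi>. frechet_derivative ?\<Phi> (at ?a) (\<xi>, ?Y' \<xi>))) (at (snd c p))"
    proof (rule has_derivative_transform_within_open)
      show "open (chart_image c)" "snd c p \<in> chart_image c" using c by (auto intro: open_chart_image chart_in_image)
      fix x assume x: "x \<in> chart_image c"
      show "?\<Phi> (x, local_rep c Y x) = (snd d (chart_inv c x), Y (chart_inv c x) d)"
        using c x by (simp add: chart_inv_tangent_chart snd_tangent_chart coord_vec_component
            chart_inv_in vector_field_tangent[OF Y])
    qed
    from fun_cong[OF has_derivative_unique[OF this F'(1)], of "u c"]
    show "tangent_map A (tangent_bundle A) (\<lambda>q. (q, Y q)) p u (tchart d) =
        frechet_derivative ?\<Phi> (at ?a) (tangent_map A (tangent_bundle A) (\<lambda>q. (q, Y q)) p u (tchart c))"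
      unfolding field_lift_component[OF Y d u] field_lift_component[OF Y c u] F'(2) by (rule sym)
  qed
qed

end

section \<open>Connections on framed manifolds\<close>

lemma sum_fun_apply: "(\<Sum>i\<in>J. f i) x = (\<Sum>i\<in>J. f i x)"
  by (induction J rule: infinite_finite_induct) auto

lemma linear_map_on_zero: "linear_map_on S f \<Longrightarrow> subspace S \<Longrightarrow> f 0 = 0"
  using subspace_linear_map_on_sum[of S f "{}"] by simp

context smooth_structure
begin

lemma vector_fieldI:
  "(\<And>p. Y p \<in> tangent_space A p) \<Longrightarrow> (\<And>c. c \<in> A \<Longrightarrow> smooth_on (chart_image c) (local_rep c Y)) \<Longrightarrow>
    Y \<in> vector_fields A"
  by (simp add: vector_fields_def smooth_components_def)

lemma vector_field_scale:
  assumes "smooth_function A f" "Y \<in> vector_fields A"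
  shows "(\<lambda>q. f q *\<^sub>R Y q) \<in> vector_fields A"
proof (rule vector_fieldI)
  show "f p *\<^sub>R Y p \<in> tangent_space A p" for p
    by (rule subspace_scale[OF subspace_tangent_space vector_field_tangent[OF assms(2)]])
  fix c assume c: "c \<in> A"
  have "smooth_on (chart_image c) (f \<circ> chart_inv c)"
    using assms(1) c by (simp add: smooth_function_def)
  then have "smooth_on (chart_image c) (\<lambda>x. (f \<circ> chart_inv c) x *\<^sub>R local_rep c Y x)"
    by (rule smooth_on_scaleR[OF open_chart_image[OF c] _ smooth_local_rep[OF assms(2) c]])
  then show "smooth_on (chart_image c) (local_rep c (\<lambda>q. f q *\<^sub>R Y q))"
    by simp
qed

lemma vector_field_sum:
  assumes "\<And>i. i \<in> J \<Longrightarrow> Y i \<in> vector_fields A"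
  shows "(\<Sum>i\<in>J. Y i) \<in> vector_fields A"
proof (rule vector_fieldI)
  show "(\<Sum>i\<in>J. Y i) p \<in> tangent_space A p" for p
    by (simp only: sum_fun_apply) (rule subspace_sum[OF subspace_tangent_space vector_field_tangent[OF assms]])
  fix c assume c: "c \<in> A"
  show "smooth_on (chart_image c) (local_rep c (\<Sum>i\<in>J. Y i))"
    by (simp only: sum_fun_apply) (rule smooth_on_sum[OF open_chart_image[OF c] smooth_local_rep[OF assms c]])
qed

lemma connection_sum:
  assumes D: "affine_connection A D" and "p \<in> points A" "u \<in> tangent_space A p"
    and "finite J" "\<And>i. i \<in> J \<Longrightarrow> Y i \<in> vector_fields A"
  shows "D p u (\<Sum>i\<in>J. Y i) = (\<Sum>i\<in>J. D p u (Y i))"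
  using assms(4,5)
proof (induction J)
  case empty
  \<comment> \<open>The value at the zero field has to come from additivity: it equals its own
    double.\<close>
  have "0 \<in> vector_fields A" using vector_field_sum[of "{}"] by simp
  then have "D p u (0 + 0) = D p u 0 + D p u 0"
    using D assms(2,3) unfolding affine_connection_def by blast
  then have "D p u 0 = 0" by simp
  then show ?case by (simp add: zero_fun_def)
next
  case (insert i J)
  have "(\<Sum>i\<in>J. Y i) \<in> vector_fields A" "Y i \<in> vector_fields A"
    using insert.prems by (auto intro: vector_field_sum)
  then have "D p u (Y i + (\<Sum>i\<in>J. Y i)) = D p u (Y i) + D p u (\<Sum>i\<in>J. Y i)"
    using D assms(2,3) unfolding affine_connection_def by blast
  moreover have "D p u (\<Sum>i\<in>J. Y i) = (\<Sum>i\<in>J. D p u (Y i))"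
    using insert by blast
  ultimately show ?case
    by (simp only: sum.insert[OF insert.hyps])
qed

end

locale framed_manifold = smooth_structure A
  for A :: "('p, 'e::euclidean_space) atlas" +
  fixes I :: "'i set" and e :: "'i \<Rightarrow> ('p, 'e) vfield" and \<theta> :: "'i \<Rightarrow> 'p \<Rightarrow> ('p, 'e) tvec \<Rightarrow> real"
  assumes finite_frame: "finite I"
    and frame: "global_frame A I e"
    and coframe: "dual_coframe A I e \<theta>"
begin

interpretation T: smooth_structure "tangent_bundle A"
  by unfold_locales (rule smooth_atlas_tangent_bundle)

lemma frame_field: "i \<in> I \<Longrightarrow> e i \<in> vector_fields A"
  using frame by (simp add: global_frame_def)

lemma coframe_linear: "p \<in> points A \<Longrightarrow> i \<in> I \<Longrightarrow> linear_map_on (tangent_space A p) (\<theta> i p)"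
  using coframe by (simp add: dual_coframe_def)

lemma coframe_frame: "p \<in> points A \<Longrightarrow> i \<in> I \<Longrightarrow> j \<in> I \<Longrightarrow> \<theta> i p (e j p) = (if i = j then 1 else 0)"
  using coframe by (simp add: dual_coframe_def)

text \<open>The vectors that satisfy the expansion form a subspace, and duality puts the frame into
  it; the frame spans the tangent space.\<close>

lemma frame_expand:
  assumes p: "p \<in> points A" and u: "u \<in> tangent_space A p"
  shows "(\<Sum>i\<in>I. \<theta> i p u *\<^sub>R e i p) = u"
proof -
  let ?S = "{u \<in> tangent_space A p. (\<Sum>i\<in>I. \<theta> i p u *\<^sub>R e i p) = u}"
  have lin: "\<theta> i p (u + v) = \<theta> i p u + \<theta> i p v"
    if "i \<in> I" "u \<in> tangent_space A p" "v \<in> tangent_space A p" for i u v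
    using coframe_linear[OF p that(1)] that(2,3) unfolding linear_map_on_def by blast
  have lin_scale: "\<theta> i p (r *\<^sub>R u) = r * \<theta> i p u" if "i \<in> I" "u \<in> tangent_space A p" for i u r
    using coframe_linear[OF p that(1)] that(2) unfolding linear_map_on_def by simp
  have "subspace ?S"
  proof (rule subspaceI)
    have "\<theta> i p 0 = 0" if "i \<in> I" for i
      by (rule linear_map_on_zero[OF coframe_linear[OF p that] subspace_tangent_space])
    then show "0 \<in> ?S"
      using subspace_0[OF subspace_tangent_space] by simp
    show "u + v \<in> ?S" if "u \<in> ?S" "v \<in> ?S" for u v
      using that subspace_add[OF subspace_tangent_space, of u p v]
      by (simp add: lin scaleR_add_left sum.distrib)
    show "r *\<^sub>R u \<in> ?S" if "u \<in> ?S" for r u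
    proof -
      have "(\<Sum>i\<in>I. \<theta> i p (r *\<^sub>R u) *\<^sub>R e i p) = r *\<^sub>R (\<Sum>i\<in>I. \<theta> i p u *\<^sub>R e i p)"
        using that(1) lin_scale[of _ u r] unfolding scaleR_sum_right by (intro sum.cong) auto
      then show ?thesis using that subspace_scale[OF subspace_tangent_space, of u p r] by simp
    qed
  qed
  moreover have "(\<lambda>i. e i p) ` I \<subseteq> ?S"
  proof clarify
    fix j assume j: "j \<in> I"
    have "(\<Sum>i\<in>I. \<theta> i p (e j p) *\<^sub>R e i p) = (\<Sum>i\<in>I. if i = j then e i p else 0)"
      by (rule sum.cong) (auto simp: coframe_frame[OF p _ j])
    also have "\<dots> = e j p" using j finite_frame by simp
    finally show "e j p \<in> tangent_space A p \<and> (\<Sum>i\<in>I. \<theta> i p (e j p) *\<^sub>R e i p) = e j p"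
      using vector_field_tangent[OF frame_field[OF j]] by simp
  qed
  ultimately have "span ((\<lambda>i. e i p) ` I) \<subseteq> ?S" by (rule span_minimal[rotated])
  moreover have "span ((\<lambda>i. e i p) ` I) = tangent_space A p"
    using frame p by (simp add: global_frame_def)
  ultimately show ?thesis using u by blast
qed

definition coframe_rep :: "('p, 'e) chart \<Rightarrow> 'i \<Rightarrow> 'e \<Rightarrow> 'e \<Rightarrow> real" where
  "coframe_rep c i x \<xi> = \<theta> i (chart_inv c x) (coord_vec A c (chart_inv c x) \<xi>)"

lemma chart_inv_points: "c \<in> A \<Longrightarrow> x \<in> chart_image c \<Longrightarrow> chart_inv c x \<in> points A"
  using chart_inv_in[of x c] by (auto simp: points_def)

lemma coframe_rep_linear:
  assumes "c \<in> A" "x \<in> chart_image c" "i \<in> I"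
  shows "linear (coframe_rep c i x)"
proof -
  have l: "linear (coord_vec A c (chart_inv c x))"
    by (rule coord_vec_linear[OF assms(1) chart_inv_in[OF assms(2)]])
  have t: "coord_vec A c (chart_inv c x) \<xi> \<in> tangent_space A (chart_inv c x)" for \<xi>
    by (rule coord_vec_tangent[OF assms(1) chart_inv_in[OF assms(2)]])
  show ?thesis
    using coframe_linear[OF chart_inv_points[OF assms(1,2)] assms(3)] t
    by (intro linearI) (simp_all add: coframe_rep_def linear_add[OF l] linear_scale[OF l] linear_map_on_def)
qed

lemma coframe_rep_component:
  assumes "c \<in> A" "p \<in> fst c" "u \<in> tangent_space A p"
  shows "coframe_rep c i (snd c p) (u c) = \<theta> i p u"
  using assms by (simp add: coframe_rep_def chart_inv_chart coord_vec_component)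

text \<open>\<open>dual_coframe\<close> is a condition at each point separately. Smoothness is
  inherited from the frame, whose coordinate expressions form a frame of the model space with
  \<open>coframe_rep\<close> as its dual.\<close>

lemma smooth_coframe_rep:
  assumes c: "c \<in> A" and i: "i \<in> I"
  shows "smooth_on (chart_image c) (\<lambda>x. coframe_rep c i x \<xi>)"
proof (rule smooth_on_dual_frame[OF open_chart_image[OF c] finite_frame, where E = "\<lambda>i. local_rep c (e i)"])
  fix x assume x: "x \<in> chart_image c"
  have q: "chart_inv c x \<in> fst c" "chart_inv c x \<in> points A"
    using x c by (simp_all add: chart_inv_in chart_inv_points)
  show "coframe_rep c i x (e j (chart_inv c x) c) = (if i = j then 1 else 0)" if "i \<in> I" "j \<in> I" for i j
    using coframe_rep_component[OF c q(1) vector_field_tangent[OF frame_field[OF that(2)]], of i]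
      coframe_frame[OF q(2) that] chart_chart_inv[OF x] by simp
  fix \<xi>
  have "(\<Sum>i\<in>I. coframe_rep c i x \<xi> *\<^sub>R e i (chart_inv c x)) = coord_vec A c (chart_inv c x) \<xi>"
    unfolding coframe_rep_def by (rule frame_expand[OF q(2) coord_vec_tangent[OF c q(1)]])
  from fun_cong[OF this, of c]
  show "(\<Sum>i\<in>I. coframe_rep c i x \<xi> *\<^sub>R e i (chart_inv c x) c) = \<xi>"
    by (simp add: sum_fun_apply coord_vec_same[OF c q(1)])
qed (use i c in \<open>auto intro: smooth_local_rep frame_field coframe_rep_linear\<close>)

lemma smooth_coframe_field:
  assumes "Y \<in> vector_fields A" "i \<in> I"
  shows "smooth_function A (\<lambda>q. \<theta> i q (Y q))"
  unfolding smooth_function_def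
proof
  fix c assume c: "c \<in> A"
  have op: "open (chart_image c)" by (rule open_chart_image[OF c])
  have "smooth_on (chart_image c) (\<lambda>x. coframe_rep c i x (local_rep c Y x))"
    by (rule smooth_on_linear_family[OF op op, where f = "\<lambda>x. x" and L = "coframe_rep c i" and h = "local_rep c Y"])
      (use smooth_local_rep[OF assms(1) c] coframe_rep_linear[OF c _ assms(2)] smooth_coframe_rep[OF c assms(2)]
        smooth_on_ident in auto)
  then show "smooth_on (chart_image c) ((\<lambda>q. \<theta> i q (Y q)) \<circ> chart_inv c)"
    by (rule smooth_on_cong[OF op])
      (use c in \<open>simp add: coframe_rep_def coord_vec_component chart_inv_in vector_field_tangent[OF assms(1)]\<close>)
qed

lemma field_expand:
  assumes "Y \<in> vector_fields A"
  shows "Y = (\<Sum>i\<in>I. (\<lambda>q. \<theta> i q (Y q) *\<^sub>R e i q))"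
proof
  fix q
  show "Y q = (\<Sum>i\<in>I. (\<lambda>q. \<theta> i q (Y q) *\<^sub>R e i q)) q"
  proof (cases "q \<in> points A")
    case True
    then show ?thesis
      using frame_expand[OF True vector_field_tangent[OF assms]] by (simp add: sum_fun_apply)
  next
    \<comment> \<open>Off the manifold all fields vanish, by the convention on tangent spaces at
      non-points. So the expansion is an equality of functions and can be substituted inside
      \<open>D\<close>.\<close>
    case False
    then have "Y q = 0" "\<And>i. i \<in> I \<Longrightarrow> e i q = 0"
      using tangent_space_nonpoint vector_field_tangent assms frame_field by blast+
    then show ?thesis by (simp add: sum_fun_apply)
  qed
qed

text \<open>The bilinear Christoffel term in
  \<open>D_\<xi> Y = dY(\<xi>) + \<Gamma>(\<xi>, Y)\<close>. Applying \<open>D\<close> to coordinate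
  fields is impossible, as they are not global; the formula is what the Leibniz rule leaves for a
  combination of frame fields.\<close>

definition christoffel :: "('p, 'e) connection \<Rightarrow> ('p, 'e) chart \<Rightarrow> 'e \<Rightarrow> 'e \<Rightarrow> 'e \<Rightarrow> 'e" where
  "christoffel D c x \<xi> y = (\<Sum>i\<in>I. coframe_rep c i x y *\<^sub>R
    (D (chart_inv c x) (coord_vec A c (chart_inv c x) \<xi>) (e i) c - frechet_derivative (local_rep c (e i)) (at x) \<xi>))"

text \<open>Expand \<open>Y\<close> in the frame and apply the Leibniz rule. The derivatives of the
  coefficients are completed by those of the frame to the derivative of the local representation of
  \<open>Y\<close>, and the correction is \<open>christoffel\<close>. In particular only the value
  and the derivative of \<open>Y\<close> at \<open>p\<close> enter.\<close>

lemma connection_local: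
  assumes D: "affine_connection A D" and Y: "Y \<in> vector_fields A"
    and c: "c \<in> A" "p \<in> fst c" and u: "u \<in> tangent_space A p"
  shows "D p u Y c = frechet_derivative (local_rep c Y) (at (snd c p)) (u c)
    + christoffel D c (snd c p) (u c) (Y p c)"
proof -
  have p: "p \<in> points A" using c by (auto simp: points_def)
  define f where "f = (\<lambda>i q. \<theta> i q (Y q))"
  define f' where "f' = (\<lambda>i. frechet_derivative (f i \<circ> chart_inv c) (at (snd c p)))"
  define E' where "E' = (\<lambda>i. frechet_derivative (local_rep c (e i)) (at (snd c p)))"
  have sf: "smooth_function A (f i)" if "i \<in> I" for i
    unfolding f_def by (rule smooth_coframe_field[OF Y that])
  have Yeq: "Y = (\<Sum>i\<in>I. (\<lambda>q. f i q *\<^sub>R e i q))"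
    unfolding f_def by (rule field_expand[OF Y])
  have "D p u Y = D p u (\<Sum>i\<in>I. (\<lambda>q. f i q *\<^sub>R e i q))"
    using Yeq by simp
  also have "\<dots> = (\<Sum>i\<in>I. D p u (\<lambda>q. f i q *\<^sub>R e i q))"
    by (rule connection_sum[OF D p u finite_frame vector_field_scale[OF sf frame_field]])
  also have "\<dots> = (\<Sum>i\<in>I. dir_deriv A p u (f i) *\<^sub>R e i p + f i p *\<^sub>R D p u (e i))"
  proof (rule sum.cong[OF refl])
    fix i assume "i \<in> I"
    then show "D p u (\<lambda>q. f i q *\<^sub>R e i q) = dir_deriv A p u (f i) *\<^sub>R e i p + f i p *\<^sub>R D p u (e i)"
      using D p u sf frame_field unfolding affine_connection_def by blast
  qed
  also have "\<dots> = (\<Sum>i\<in>I. f' i (u c) *\<^sub>R e i p + f i p *\<^sub>R D p u (e i))"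
    by (rule sum.cong[OF refl]) (simp add: dir_deriv_chart[OF c u sf] f'_def)
  finally have 1: "D p u Y c = (\<Sum>i\<in>I. f' i (u c) *\<^sub>R e i p c + f i p *\<^sub>R D p u (e i) c)"
    by (simp add: sum_fun_apply)
  have "((\<lambda>x. \<Sum>i\<in>I. (f i \<circ> chart_inv c) x *\<^sub>R local_rep c (e i) x) has_derivative
      (\<lambda>\<xi>. \<Sum>i\<in>I. (f i \<circ> chart_inv c) (snd c p) *\<^sub>R E' i \<xi> + f' i \<xi> *\<^sub>R local_rep c (e i) (snd c p))) (at (snd c p))"
  proof (intro has_derivative_sum has_derivative_scaleR)
    fix i assume i: "i \<in> I"
    have "smooth_on (chart_image c) (f i \<circ> chart_inv c)"
      using sf[OF i] c by (simp add: smooth_function_def)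
    then show "(f i \<circ> chart_inv c has_derivative f' i) (at (snd c p))"
      unfolding f'_def by (rule smooth_on_has_derivative[OF _ chart_in_image[OF c(2)]])
    show "(local_rep c (e i) has_derivative E' i) (at (snd c p))"
      unfolding E'_def by (rule local_rep_has_derivative[OF frame_field[OF i] c])
  qed
  moreover have "local_rep c Y = (\<lambda>x. \<Sum>i\<in>I. (f i \<circ> chart_inv c) x *\<^sub>R local_rep c (e i) x)"
    by (subst Yeq) (simp add: sum_fun_apply)
  ultimately have "frechet_derivative (local_rep c Y) (at (snd c p)) (u c) =
      (\<Sum>i\<in>I. f i p *\<^sub>R E' i (u c) + f' i (u c) *\<^sub>R e i p c)"
    by (simp only: frechet_derivative_eqI) (simp add: chart_inv_chart c)
  moreover have "christoffel D c (snd c p) (u c) (Y p c) = (\<Sum>i\<in>I. f i p *\<^sub>R (D p u (e i) c - E' i (u c)))"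
    by (simp add: christoffel_def E'_def f_def coframe_rep_component[OF c vector_field_tangent[OF Y]]
        chart_inv_chart[OF c] coord_vec_component[OF c u])
  ultimately show ?thesis
    unfolding 1 by (simp add: sum.distrib[symmetric] scaleR_diff_right add_ac)
qed

lemma connection_linear:
  "affine_connection A D \<Longrightarrow> p \<in> points A \<Longrightarrow> Y \<in> vector_fields A \<Longrightarrow>
    linear_map_on (tangent_space A p) (\<lambda>u. D p u Y)"
  by (simp add: affine_connection_def)

lemma connection_tangent:
  "affine_connection A D \<Longrightarrow> p \<in> points A \<Longrightarrow> u \<in> tangent_space A p \<Longrightarrow> Y \<in> vector_fields A \<Longrightarrow>
    D p u Y \<in> tangent_space A p"
  by (simp add: affine_connection_def)

lemma christoffel_linear2:
  assumes "c \<in> A" "x \<in> chart_image c"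
  shows "linear (christoffel D c x \<xi>)"
  unfolding christoffel_def
  by (rule linearI)
    (simp_all add: linear_add[OF coframe_rep_linear[OF assms]] linear_scale[OF coframe_rep_linear[OF assms]]
      scaleR_add_left sum.distrib scaleR_sum_right)

lemma christoffel_linear1:
  assumes D: "affine_connection A D" and c: "c \<in> A" "x \<in> chart_image c"
  shows "linear (\<lambda>\<xi>. christoffel D c x \<xi> y)"
proof -
  let ?q = "chart_inv c x"
  have q: "?q \<in> fst c" "?q \<in> points A" using c by (simp_all add: chart_inv_in chart_inv_points)
  have l: "linear (coord_vec A c ?q)" by (rule coord_vec_linear[OF c(1) q(1)])
  have "linear (\<lambda>\<xi>. D ?q (coord_vec A c ?q \<xi>) (e i) c - frechet_derivative (local_rep c (e i)) (at x) \<xi>)"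
    if i: "i \<in> I" for i
  proof -
    have "linear (frechet_derivative (local_rep c (e i)) (at x))"
      using has_derivative_linear[OF smooth_on_has_derivative[OF smooth_local_rep[OF frame_field[OF i] c(1)] c(2)]] .
    moreover have "linear (\<lambda>\<xi>. D ?q (coord_vec A c ?q \<xi>) (e i) c)"
      using connection_linear[OF D q(2) frame_field[OF i]] coord_vec_tangent[OF c(1) q(1)]
      by (intro linearI) (simp_all add: linear_add[OF l] linear_scale[OF l] linear_map_on_def)
    ultimately show ?thesis by (rule linear_compose_sub[rotated])
  qed
  then show ?thesis
    unfolding christoffel_def by (intro linear_compose_sum ballI linear_compose_scale_right)
qed

text \<open>A connection is known to be smooth along global fields only, so the coordinate vector
  \<xi> is expanded in the frame.\<close>

lemma smooth_christoffel:
  assumes D: "affine_connection A D" and c: "c \<in> A"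
  shows "smooth_on (chart_image c) (\<lambda>x. christoffel D c x \<xi> y)"
proof -
  have op: "open (chart_image c)" by (rule open_chart_image[OF c])
  have "smooth_on (chart_image c) (\<lambda>x. D (chart_inv c x) (coord_vec A c (chart_inv c x) \<xi>) (e i) c)"
    if i: "i \<in> I" for i
  proof (rule smooth_on_cong[OF op])
    have "smooth_on (chart_image c) (\<lambda>x. D (chart_inv c x) (e j (chart_inv c x)) (e i) c)" if "j \<in> I" for j
      using D frame_field[OF that] frame_field[OF i] c
      unfolding affine_connection_def smooth_components_def by blast
    then show "smooth_on (chart_image c) (\<lambda>x. \<Sum>j\<in>I. coframe_rep c j x \<xi> *\<^sub>R D (chart_inv c x) (e j (chart_inv c x)) (e i) c)"
      by (intro smooth_on_sum[OF op] smooth_on_scaleR[OF op] smooth_coframe_rep[OF c])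
    fix x assume x: "x \<in> chart_image c"
    let ?q = "chart_inv c x"
    have q: "?q \<in> fst c" "?q \<in> points A" using c x by (simp_all add: chart_inv_in chart_inv_points)
    have "coord_vec A c ?q \<xi> = (\<Sum>j\<in>I. coframe_rep c j x \<xi> *\<^sub>R e j ?q)"
      unfolding coframe_rep_def by (rule frame_expand[OF q(2) coord_vec_tangent[OF c q(1)], symmetric])
    then have "D ?q (coord_vec A c ?q \<xi>) (e i) = D ?q (\<Sum>j\<in>I. coframe_rep c j x \<xi> *\<^sub>R e j ?q) (e i)"
      by simp
    also have "\<dots> = (\<Sum>j\<in>I. coframe_rep c j x \<xi> *\<^sub>R D ?q (e j ?q) (e i))"
      by (rule subspace_linear_map_on_sum[OF subspace_tangent_space connection_linear[OF D q(2) frame_field[OF i]]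
            finite_frame vector_field_tangent[OF frame_field]])
    finally show "D ?q (coord_vec A c ?q \<xi>) (e i) c = (\<Sum>j\<in>I. coframe_rep c j x \<xi> *\<^sub>R D ?q (e j ?q) (e i) c)"
      by (simp add: sum_fun_apply)
  qed
  then show ?thesis
    unfolding christoffel_def
    by (intro smooth_on_sum[OF op] smooth_on_scaleR[OF op] smooth_on_diff[OF op] smooth_coframe_rep[OF c]
        smooth_on_frechet_derivative[OF smooth_local_rep[OF frame_field c]])
qed

section \<open>Existence and uniqueness of the connection map\<close>

lemma field_through:
  assumes p: "p \<in> points A" and u: "u \<in> tangent_space A p"
  obtains Y where "Y \<in> vector_fields A" "Y p = u"
proof
  have const: "smooth_function A (\<lambda>q. r)" for r
    by (simp add: smooth_function_def comp_def smooth_on_const)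
  show "(\<Sum>i\<in>I. (\<lambda>q. \<theta> i p u *\<^sub>R e i q)) \<in> vector_fields A"
    by (rule vector_field_sum[OF vector_field_scale[OF const frame_field]])
  show "(\<Sum>i\<in>I. (\<lambda>q. \<theta> i p u *\<^sub>R e i q)) p = u"
    using frame_expand[OF p u] by (simp add: sum_fun_apply)
qed

text \<open>Subtracting the image of the projection of \<open>Z\<close> under the differential of
  \<open>Y\<close> leaves a vector without base part. The complement to the vertical vectors is thus
  the image of a field, not the horizontal space of a connection; these are exactly the two kinds of
  vectors on which a connection map is prescribed.\<close>

lemma horizontal_vertical_split:
  assumes Y: "Y \<in> vector_fields A" and p: "p \<in> points A"
    and Z: "Z \<in> bundle_tangent (p, Y p)"
  obtains w where "w \<in> tangent_space A p"
    "Z = tangent_map A (tangent_bundle A) (\<lambda>q. (q, Y q)) p (bundle_proj A (p, Y p) Z) + vertical_lift A (p, Y p) w"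
    "\<And>c. c \<in> A \<Longrightarrow> p \<in> fst c \<Longrightarrow> w c = snd (Z (tchart c))
      - frechet_derivative (local_rep c Y) (at (snd c p)) (fst (Z (tchart c)))"
proof
  obtain c where c: "c \<in> A" "p \<in> fst c" using p by (auto simp: points_def)
  let ?L = "tangent_map A (tangent_bundle A) (\<lambda>q. (q, Y q)) p (bundle_proj A (p, Y p) Z)"
  have Yp: "Y p \<in> tangent_space A p" by (rule vector_field_tangent[OF Y])
  have pr: "bundle_proj A (p, Y p) Z \<in> tangent_space A p" by (rule bundle_proj_tangent[OF Z p Yp])
  have L: "?L \<in> bundle_tangent (p, Y p)"
    by (rule field_lift_tangent[OF Y p pr])
  have Ld: "?L (tchart d) = (fst (Z (tchart d)),
      frechet_derivative (local_rep d Y) (at (snd d p)) (fst (Z (tchart d))))"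
    if "d \<in> A" "p \<in> fst d" for d
    unfolding field_lift_component[OF Y that pr] bundle_proj_component[OF Z that Yp] ..
  let ?V = "Z - ?L"
  have V: "?V \<in> bundle_tangent (p, Y p)"
    by (rule subspace_diff[OF T.subspace_tangent_space Z L])
  let ?w = "\<lambda>d. if d \<in> A \<and> p \<in> fst d then snd (?V (tchart d)) else 0"
  show w: "?w \<in> tangent_space A p"
    by (rule vertical_part_tangent[OF V c Yp]) (simp add: Ld[OF c])
  show "?w d = snd (Z (tchart d))
      - frechet_derivative (local_rep d Y) (at (snd d p)) (fst (Z (tchart d)))"
    if "d \<in> A" "p \<in> fst d" for d
    using that by (simp add: Ld)
  show "Z = ?L + vertical_lift A (p, Y p) ?w"
  proof (rule T.tangent_eqI)
    show "tchart c \<in> tangent_bundle A" "(p, Y p) \<in> fst (tchart c)"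
      using c Yp by (simp_all add: tangent_chart_in mem_tangent_chart)
    show "?L + vertical_lift A (p, Y p) ?w \<in> bundle_tangent (p, Y p)"
      by (rule subspace_add[OF T.subspace_tangent_space L vertical_lift_tangent[OF p Yp w]])
    show "Z (tchart c) = (?L + vertical_lift A (p, Y p) ?w) (tchart c)"
      unfolding plus_fun_apply vertical_lift_component[OF c Yp]
      using c by (simp add: Ld prod_eq_iff)
  qed (rule Z)
qed

text \<open>On the two parts of the splitting, \<open>K\<close> is the covariant derivative of
  \<open>Y\<close> and the identity. The derivatives of \<open>Y\<close> cancel in the sum, and what
  remains involves neither \<open>K\<close> nor the choice of \<open>Y\<close> beyond its value at
  \<open>p\<close>.\<close>

lemma connection_map_unique:
  assumes K: "is_connection_map A D K" and Y: "Y \<in> vector_fields A" and p: "p \<in> points A"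
    and Z: "Z \<in> bundle_tangent (p, Y p)"
    and D: "affine_connection A D"
    and c: "c \<in> A" "p \<in> fst c"
  shows "K (p, Y p) Z c = snd (Z (tchart c))
    + christoffel D c (snd c p) (fst (Z (tchart c))) (Y p c)"
proof -
  let ?a = "(p, Y p)"
  let ?pr = "bundle_proj A ?a Z"
  let ?L = "tangent_map A (tangent_bundle A) (\<lambda>q. (q, Y q)) p ?pr"
  have Yp: "Y p \<in> tangent_space A p" by (rule vector_field_tangent[OF Y])
  have a: "?a \<in> points (tangent_bundle A)" using p Yp by (simp add: points_tangent_bundle)
  have pr: "?pr \<in> tangent_space A p" by (rule bundle_proj_tangent[OF Z p Yp])
  obtain w where w: "w \<in> tangent_space A p" "Z = ?L + vertical_lift A ?a w"
    "\<And>c. c \<in> A \<Longrightarrow> p \<in> fst c \<Longrightarrow> w c = snd (Z (tchart c))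
      - frechet_derivative (local_rep c Y) (at (snd c p)) (fst (Z (tchart c)))"
    using horizontal_vertical_split[OF Y p Z] by blast
  have "K ?a Z = K ?a (?L + vertical_lift A ?a w)" using w(2) by simp
  also have "\<dots> = K ?a ?L + K ?a (vertical_lift A ?a w)"
    using K a field_lift_tangent[OF Y p pr] vertical_lift_tangent[OF p Yp w(1)]
    unfolding is_connection_map_def linear_map_on_def by blast
  also have "K ?a ?L = D p ?pr Y"
    using K Y p pr unfolding is_connection_map_def by blast
  also have "K ?a (vertical_lift A ?a w) = w"
    using K a w(1) unfolding is_connection_map_def by fastforce
  finally show ?thesis
    by (simp add: connection_local[OF D Y c pr] w(3)[OF c] bundle_proj_component[OF Z c Yp])
qed

text \<open>The formula forced by uniqueness is taken as the definition.\<close>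

lemma connection_map_exists:
  assumes D: "affine_connection A D"
  shows "\<exists>K. is_connection_map A D K"
proof
  define K where "K = (\<lambda>(p, u) Z c. if c \<in> A \<and> p \<in> fst c then snd (Z (tchart c))
    + christoffel D c (snd c p) (fst (Z (tchart c))) (u c) else 0)"
  have K: "K (p, u) Z c = (if c \<in> A \<and> p \<in> fst c then snd (Z (tchart c))
    + christoffel D c (snd c p) (fst (Z (tchart c))) (u c) else 0)" for p u Z c
    by (simp add: K_def)
  have lin: "linear (\<lambda>\<xi>. christoffel D c (snd c p) \<xi> y)" if "c \<in> A" "p \<in> fst c" for c p y
    by (rule christoffel_linear1[OF D that(1) chart_in_image[OF that(2)]])
  show "is_connection_map A D K"
    unfolding is_connection_map_def
  proof (intro conjI ballI)
    fix a assume "a \<in> points (tangent_bundle A)"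
    then obtain p u where a: "a = (p, u)" and p: "p \<in> points A" and u: "u \<in> tangent_space A p"
      by (auto simp: points_tangent_bundle)
    show "linear_map_on (bundle_tangent a) (K a)"
      unfolding linear_map_on_def a
    proof (intro conjI ballI allI)
      show "K (p, u) (Z + Z') = K (p, u) Z + K (p, u) Z'" for Z Z'
        by (rule ext) (simp add: K linear_add[OF lin])
      show "K (p, u) (r *\<^sub>R Z) = r *\<^sub>R K (p, u) Z" for r Z
        by (rule ext) (simp add: K linear_scale[OF lin] scaleR_add_right)
    qed
    fix Z assume Z: "Z \<in> bundle_tangent a"
    \<comment> \<open>That \<open>K a Z\<close> is tangent would amount to the transformation law of
      Christoffel symbols. Instead it is recognised as the covariant derivative of a field through
      \<open>u\<close> plus the vertical part of \<open>Z\<close>, both of which are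
      tangent.\<close>
    obtain Y where Y: "Y \<in> vector_fields A" "Y p = u" by (rule field_through[OF p u])
    have ZY: "Z \<in> bundle_tangent (p, Y p)" using Z a Y(2) by simp
    have pr: "bundle_proj A (p, Y p) Z \<in> tangent_space A p"
      by (rule bundle_proj_tangent[OF ZY p vector_field_tangent[OF Y(1)]])
    obtain w where w: "w \<in> tangent_space A p"
      "\<And>c. c \<in> A \<Longrightarrow> p \<in> fst c \<Longrightarrow> w c = snd (Z (tchart c))
        - frechet_derivative (local_rep c Y) (at (snd c p)) (fst (Z (tchart c)))"
      using horizontal_vertical_split[OF Y(1) p ZY] by blast
    have DY: "D p (bundle_proj A (p, Y p) Z) Y \<in> tangent_space A p"
      by (rule connection_tangent[OF D p pr Y(1)])
    have "K a Z = D p (bundle_proj A (p, Y p) Z) Y + w"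
    proof
      fix c
      show "K a Z c = (D p (bundle_proj A (p, Y p) Z) Y + w) c"
      proof (cases "c \<in> A \<and> p \<in> fst c")
        case True
        then show ?thesis
          unfolding a Y(2)[symmetric] K plus_fun_apply
          by (simp add: connection_local[OF D Y(1) _ _ pr] w(2)
              bundle_proj_component[OF ZY _ _ vector_field_tangent[OF Y(1)]])
      next
        case False
        then show ?thesis
          using tangent_component_zero[OF DY False] tangent_component_zero[OF w(1) False]
          by (auto simp: K a)
      qed
    qed
    then show "K a Z \<in> tangent_space A (fst a)"
      using subspace_add[OF subspace_tangent_space DY w(1)] by (simp add: a)
  next
    fix a w assume "a \<in> points (tangent_bundle A)" and w': "w \<in> tangent_space A (fst a)"
    then obtain p u where a: "a = (p, u)" and p: "p \<in> points A" and u: "u \<in> tangent_space A p"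
      by (auto simp: points_tangent_bundle)
    have w: "w \<in> tangent_space A p" using w' a by simp
    show "K a (vertical_lift A a w) = w"
    proof
      fix c
      show "K a (vertical_lift A a w) c = w c"
        using tangent_component_zero[OF w, of c]
        by (auto simp: K a vertical_lift_component[OF _ _ u] linear_0[OF lin])
    qed
  next
    fix Y p u assume Y: "Y \<in> vector_fields A" and p: "p \<in> points A" and u: "u \<in> tangent_space A p"
    show "K (p, Y p) (tangent_map A (tangent_bundle A) (\<lambda>q. (q, Y q)) p u) = D p u Y"
    proof
      fix c
      show "K (p, Y p) (tangent_map A (tangent_bundle A) (\<lambda>q. (q, Y q)) p u) c = D p u Y c"
        using tangent_component_zero[OF connection_tangent[OF D p u Y], of c]
        by (auto simp: K field_lift_component[OF Y _ _ u] connection_local[OF D Y _ _ u])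
    qed
  qed
qed

lemma is_connection_map_connection_map:
  "affine_connection A D \<Longrightarrow> is_connection_map A D (connection_map A D)"
  unfolding connection_map_def by (rule someI_ex[OF connection_map_exists])

lemma connection_map_component:
  assumes D: "affine_connection A D" and Z: "Z \<in> bundle_tangent (p, u)"
    and c: "c \<in> A" "p \<in> fst c" and u: "u \<in> tangent_space A p"
  shows "connection_map A D (p, u) Z c = snd (Z (tchart c))
    + christoffel D c (snd c p) (fst (Z (tchart c))) (u c)"
proof -
  have p: "p \<in> points A" using c by (auto simp: points_def)
  obtain Y where Y: "Y \<in> vector_fields A" "Y p = u" by (rule field_through[OF p u])
  show ?thesis
    using connection_map_unique[OF is_connection_map_connection_map[OF D] Y(1) p _ D c] Z Y(2) by simp
qed

lemma connection_map_tangent: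
  assumes "affine_connection A D" "p \<in> points A" "u \<in> tangent_space A p"
    "Z \<in> bundle_tangent (p, u)"
  shows "connection_map A D (p, u) Z \<in> tangent_space A p"
  using is_connection_map_connection_map[OF assms(1)] assms(2-4)
  unfolding is_connection_map_def points_tangent_bundle by fastforce

end

section \<open>The Sasaki metric is almost Hermitian\<close>

text \<open>\<open>smooth_on_linear_family\<close> is used once for each argument; in the outer use
  the inner argument has already been inserted.\<close>

lemma smooth_on_bilinear_family:
  fixes h :: "'a::euclidean_space \<Rightarrow> 'b::euclidean_space" and f :: "'a \<Rightarrow> 'c::euclidean_space"
    and k :: "'a \<Rightarrow> 'd::euclidean_space"
  assumes "open S" "open U" "f ` S \<subseteq> U" "smooth_on S f" "smooth_on S h" "smooth_on S k"
    and lin1: "\<And>x y. x \<in> U \<Longrightarrow> linear (\<lambda>b. B x b y)" and lin2: "\<And>x b. x \<in> U \<Longrightarrow> linear (B x b)"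
    and sm: "\<And>b b'. smooth_on U (\<lambda>x. B x b b')"
  shows "smooth_on S (\<lambda>s. B (f s) (h s) (k s))"
proof (rule smooth_on_linear_family[OF assms(1,1), where f = "\<lambda>s. s" and L = "\<lambda>s b. B (f s) b (k s)" and h = h])
  show "smooth_on S (\<lambda>s. B (f s) b (k s))" for b
    by (rule smooth_on_linear_family[OF assms(1-4) assms(6) lin2 sm])
  show "linear (\<lambda>b. B (f s) b (k s))" if "s \<in> S" for s
    using that assms(3) by (intro lin1) auto
qed (use assms smooth_on_ident in auto)

definition metric_rep :: "('p, 'e::euclidean_space) atlas \<Rightarrow>
    ('p \<Rightarrow> ('p, 'e) tvec \<Rightarrow> ('p, 'e) tvec \<Rightarrow> real) \<Rightarrow> ('p, 'e) chart \<Rightarrow> 'e \<Rightarrow> 'e \<Rightarrow> 'e \<Rightarrow> real" where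
  "metric_rep A g c x \<xi> \<eta> =
    g (chart_inv c x) (coord_vec A c (chart_inv c x) \<xi>) (coord_vec A c (chart_inv c x) \<eta>)"

context smooth_structure
begin

lemma metric_linear:
  assumes "pseudo_riemannian_metric A g" "p \<in> points A" "u \<in> tangent_space A p"
  shows "linear_map_on (tangent_space A p) (g p u)"
  using assms by (simp add: pseudo_riemannian_metric_def)

lemma metric_sym:
  assumes "pseudo_riemannian_metric A g" "p \<in> points A" "u \<in> tangent_space A p" "v \<in> tangent_space A p"
  shows "g p u v = g p v u"
  using assms by (simp add: pseudo_riemannian_metric_def)

text \<open>The definition of a metric gives linearity in the second argument; symmetry carries it
  over to the first.\<close>

lemma metric_add:
  assumes "pseudo_riemannian_metric A g" "p \<in> points A" "u \<in> tangent_space A p"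
    "v \<in> tangent_space A p" "w \<in> tangent_space A p"
  shows "g p u (v + w) = g p u v + g p u w" "g p (v + w) u = g p v u + g p w u"
proof -
  show 1: "g p u (v + w) = g p u v + g p u w"
    using metric_linear[OF assms(1-3)] assms(4,5) by (simp add: linear_map_on_def)
  show "g p (v + w) u = g p v u + g p w u"
    using 1 metric_sym[OF assms(1,2)] assms(3-5) subspace_add[OF subspace_tangent_space assms(4,5)] by simp
qed

lemma metric_scale:
  assumes "pseudo_riemannian_metric A g" "p \<in> points A" "u \<in> tangent_space A p" "v \<in> tangent_space A p"
  shows "g p u (r *\<^sub>R v) = r * g p u v" "g p (r *\<^sub>R v) u = r * g p v u"
proof -
  show 1: "g p u (r *\<^sub>R v) = r * g p u v"
    using metric_linear[OF assms(1-3)] assms(4) by (simp add: linear_map_on_def)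
  show "g p (r *\<^sub>R v) u = r * g p v u"
    using 1 metric_sym[OF assms(1,2)] assms(3,4) subspace_scale[OF subspace_tangent_space assms(4)] by simp
qed

lemma metric_minus:
  assumes "pseudo_riemannian_metric A g" "p \<in> points A" "u \<in> tangent_space A p" "v \<in> tangent_space A p"
  shows "g p u (- v) = - g p u v" "g p (- v) u = - g p v u"
  using metric_scale[OF assms, of "-1"] by simp_all

lemma metric_rep_sym:
  assumes "pseudo_riemannian_metric A g" "c \<in> A" "x \<in> chart_image c"
  shows "metric_rep A g c x \<xi> \<eta> = metric_rep A g c x \<eta> \<xi>"
proof -
  have q: "chart_inv c x \<in> fst c" "chart_inv c x \<in> points A"
    using assms chart_inv_in[of x c] by (auto simp: points_def)
  show ?thesis
    unfolding metric_rep_def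
    by (rule metric_sym[OF assms(1) q(2) coord_vec_tangent[OF assms(2) q(1)] coord_vec_tangent[OF assms(2) q(1)]])
qed

lemma metric_rep_linear2:
  assumes "pseudo_riemannian_metric A g" "c \<in> A" "x \<in> chart_image c"
  shows "linear (metric_rep A g c x \<xi>)"
proof -
  have q: "chart_inv c x \<in> fst c" "chart_inv c x \<in> points A"
    using assms chart_inv_in[of x c] by (auto simp: points_def)
  have l: "linear (coord_vec A c (chart_inv c x))" by (rule coord_vec_linear[OF assms(2) q(1)])
  have t: "coord_vec A c (chart_inv c x) \<eta> \<in> tangent_space A (chart_inv c x)" for \<eta>
    by (rule coord_vec_tangent[OF assms(2) q(1)])
  show ?thesis
    by (rule linearI) (simp_all add: metric_rep_def linear_add[OF l] linear_scale[OF l]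
        metric_add[OF assms(1) q(2) t t t] metric_scale[OF assms(1) q(2) t t])
qed

lemma metric_rep_linear1:
  assumes "pseudo_riemannian_metric A g" "c \<in> A" "x \<in> chart_image c"
  shows "linear (\<lambda>\<xi>. metric_rep A g c x \<xi> \<eta>)"
  using metric_rep_linear2[OF assms, of \<eta>] by (simp add: metric_rep_sym[OF assms, of _ \<eta>])

lemma smooth_metric_rep:
  assumes "pseudo_riemannian_metric A g" "c \<in> A"
  shows "smooth_on (chart_image c) (\<lambda>x. metric_rep A g c x \<xi> \<eta>)"
proof -
  have "\<forall>c\<in>A. \<forall>\<xi> \<eta>. smooth_on (chart_image c) (\<lambda>x. metric_rep A g c x \<xi> \<eta>)"
    using assms(1) unfolding pseudo_riemannian_metric_def metric_rep_def by (rule conjunct2)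
  with assms(2) show ?thesis by simp
qed

lemma metric_rep_component:
  assumes "c \<in> A" "p \<in> fst c" "u \<in> tangent_space A p" "v \<in> tangent_space A p"
  shows "metric_rep A g c (snd c p) (u c) (v c) = g p u v"
  using assms by (simp add: metric_rep_def chart_inv_chart coord_vec_component)

end

section \<open>The isomorphism given by \<open>bundle_proj\<close> and
  \<open>connection_map\<close>\<close>

context framed_manifold
begin

interpretation T: smooth_structure "tangent_bundle A"
  by unfold_locales (rule smooth_atlas_tangent_bundle)

lemma bundle_proj_linear:
  assumes p: "p \<in> points A" and u: "u \<in> tangent_space A p"
  shows "linear_map_on (bundle_tangent (p, u)) (bundle_proj A (p, u))"
proof -
  obtain c where c: "c \<in> A" "p \<in> fst c" using p by (auto simp: points_def)
  note sub = subspace_tangent_space[of p] T.subspace_tangent_space[of "(p, u)"]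
  show ?thesis
    unfolding linear_map_on_def
  proof (intro conjI ballI allI)
    fix Z W assume ZW: "Z \<in> bundle_tangent (p, u)" "W \<in> bundle_tangent (p, u)"
    have s: "Z + W \<in> bundle_tangent (p, u)" by (rule subspace_add[OF sub(2) ZW])
    show "bundle_proj A (p, u) (Z + W) = bundle_proj A (p, u) Z + bundle_proj A (p, u) W"
      by (rule tangent_eqI[OF c bundle_proj_tangent[OF s p u]
            subspace_add[OF sub(1) bundle_proj_tangent[OF ZW(1) p u] bundle_proj_tangent[OF ZW(2) p u]]])
        (simp add: bundle_proj_component[OF _ c u] ZW s)
  next
    fix r Z assume Z: "Z \<in> bundle_tangent (p, u)"
    have s: "r *\<^sub>R Z \<in> bundle_tangent (p, u)" by (rule subspace_scale[OF sub(2) Z])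
    show "bundle_proj A (p, u) (r *\<^sub>R Z) = r *\<^sub>R bundle_proj A (p, u) Z"
      by (rule tangent_eqI[OF c bundle_proj_tangent[OF s p u]
            subspace_scale[OF sub(1) bundle_proj_tangent[OF Z p u]]])
        (simp add: bundle_proj_component[OF _ c u] Z s)
  qed
qed

lemma connection_map_linear:
  assumes "affine_connection A D" "p \<in> points A" "u \<in> tangent_space A p"
  shows "linear_map_on (bundle_tangent (p, u)) (connection_map A D (p, u))"
  using is_connection_map_connection_map[OF assms(1)] assms(2,3)
  unfolding is_connection_map_def points_tangent_bundle by fastforce

text \<open>In a chart the projection is the first component, and for a fixed first component the
  connection map is a translation of the second.\<close>

lemma bundle_tangent_eqI:
  assumes D: "affine_connection A D" and p: "p \<in> points A" and u: "u \<in> tangent_space A p"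
    and Z: "Z \<in> bundle_tangent (p, u)" and W: "W \<in> bundle_tangent (p, u)"
    and eq: "bundle_proj A (p, u) Z = bundle_proj A (p, u) W"
      "connection_map A D (p, u) Z = connection_map A D (p, u) W"
  shows "Z = W"
proof -
  obtain c where c: "c \<in> A" "p \<in> fst c" using p by (auto simp: points_def)
  have f: "fst (Z (tchart c)) = fst (W (tchart c))"
    using fun_cong[OF eq(1), of c] by (simp add: bundle_proj_component[OF _ c u] Z W)
  moreover have "snd (Z (tchart c)) = snd (W (tchart c))"
    using fun_cong[OF eq(2), of c] f by (simp add: connection_map_component[OF D _ c u] Z W)
  ultimately have "Z (tchart c) = W (tchart c)" by (simp add: prod_eq_iff)
  then show ?thesis
    by (intro T.tangent_eqI[OF _ _ Z W])
      (use c u in \<open>auto simp: tangent_chart_in mem_tangent_chart\<close>)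
qed

lemma bundle_tangent_exists:
  assumes D: "affine_connection A D" and p: "p \<in> points A" and u: "u \<in> tangent_space A p"
    and v: "v \<in> tangent_space A p" and w: "w \<in> tangent_space A p"
  shows "\<exists>Z\<in>bundle_tangent (p, u).
    bundle_proj A (p, u) Z = v \<and> connection_map A D (p, u) Z = w"
proof -
  obtain c where c: "c \<in> A" "p \<in> fst c" using p by (auto simp: points_def)
  have c': "tchart c \<in> tangent_bundle A" "(p, u) \<in> fst (tchart c)"
    using c u by (simp_all add: tangent_chart_in mem_tangent_chart)
  \<comment> \<open>The subtracted Christoffel term is the one that \<open>connection_map\<close>
    adds.\<close>
  let ?Z = "bundle_vec c (p, u)
    (v c, w c - christoffel D c (snd c p) (v c) (u c))"
  have Z: "?Z \<in> bundle_tangent (p, u)" by (rule T.coord_vec_tangent[OF c'])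
  have "bundle_proj A (p, u) ?Z = v"
    by (rule tangent_eqI[OF c bundle_proj_tangent[OF Z p u] v])
      (simp add: bundle_proj_component[OF Z c u] T.coord_vec_same[OF c'])
  moreover have "connection_map A D (p, u) ?Z = w"
    by (rule tangent_eqI[OF c connection_map_tangent[OF D p u Z] w])
      (simp add: connection_map_component[OF D Z c u] T.coord_vec_same[OF c'])
  ultimately show ?thesis using Z by blast
qed

text \<open>The definite description in \<open>bundle_J\<close> is justified by the isomorphism:
  surjectivity provides a vector and injectivity makes it unique.\<close>

lemma bundle_J:
  assumes D: "affine_connection A D" and p: "p \<in> points A" and u: "u \<in> tangent_space A p"
    and Z: "Z \<in> bundle_tangent (p, u)"
  shows "bundle_J A D (p, u) Z \<in> bundle_tangent (p, u)"
    and "bundle_proj A (p, u) (bundle_J A D (p, u) Z) = - connection_map A D (p, u) Z"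
    and "connection_map A D (p, u) (bundle_J A D (p, u) Z) = bundle_proj A (p, u) Z"
proof -
  have "- connection_map A D (p, u) Z \<in> tangent_space A p"
    by (rule subspace_neg[OF subspace_tangent_space connection_map_tangent[OF D p u Z]])
  from bundle_tangent_exists[OF D p u this bundle_proj_tangent[OF Z p u]]
  obtain W where W: "W \<in> bundle_tangent (p, u)"
    "bundle_proj A (p, u) W = - connection_map A D (p, u) Z"
    "connection_map A D (p, u) W = bundle_proj A (p, u) Z" by blast
  have "\<exists>!W. W \<in> bundle_tangent (p, u) \<and>
     bundle_proj A (p, u) W = - connection_map A D (p, u) Z \<and>
     connection_map A D (p, u) W = bundle_proj A (p, u) Z"
  proof (rule ex1I[of _ W])
    fix V assume V: "V \<in> bundle_tangent (p, u) \<and>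
     bundle_proj A (p, u) V = - connection_map A D (p, u) Z \<and>
     connection_map A D (p, u) V = bundle_proj A (p, u) Z"
    show "V = W"
      by (rule bundle_tangent_eqI[OF D p u _ W(1)]) (use V W in simp_all)
  qed (use W in blast)
  from theI'[OF this]
  show "bundle_J A D (p, u) Z \<in> bundle_tangent (p, u)"
    "bundle_proj A (p, u) (bundle_J A D (p, u) Z) = - connection_map A D (p, u) Z"
    "connection_map A D (p, u) (bundle_J A D (p, u) Z) = bundle_proj A (p, u) Z"
    unfolding bundle_J_def by blast+
qed

text \<open>The defining equations are solved for the two components; the sign of the Christoffel
  term comes from its linearity in the first argument.\<close>

lemma bundle_J_component:
  assumes D: "affine_connection A D" and c: "c \<in> A" "p \<in> fst c" and u: "u \<in> tangent_space A p"
    and Z: "Z \<in> bundle_tangent (p, u)"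
  shows "bundle_J A D (p, u) Z (tchart c) =
    (- connection_map A D (p, u) Z c, fst (Z (tchart c))
      + christoffel D c (snd c p) (connection_map A D (p, u) Z c) (u c))"
proof -
  have p: "p \<in> points A" using c by (auto simp: points_def)
  note J = bundle_J[OF D p u Z]
  have f: "fst (bundle_J A D (p, u) Z (tchart c)) = - connection_map A D (p, u) Z c"
    using fun_cong[OF J(2), of c] by (simp add: bundle_proj_component[OF J(1) c u])
  have "snd (bundle_J A D (p, u) Z (tchart c)) + christoffel D c (snd c p)
      (- connection_map A D (p, u) Z c) (u c) = fst (Z (tchart c))"
    using fun_cong[OF J(3), of c]
    by (simp only: connection_map_component[OF D J(1) c u] f bundle_proj_component[OF Z c u])
  moreover have "christoffel D c (snd c p) (- connection_map A D (p, u) Z c) (u c) =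
      - christoffel D c (snd c p) (connection_map A D (p, u) Z c) (u c)"
    by (rule linear_neg[OF christoffel_linear1[OF D c(1) chart_in_image[OF c(2)]]])
  ultimately have "snd (bundle_J A D (p, u) Z (tchart c)) = fst (Z (tchart c))
      + christoffel D c (snd c p) (connection_map A D (p, u) Z c) (u c)"
    by (simp add: add_eq_0_iff2 eq_diff_eq[symmetric] diff_eq_eq)
  with f show ?thesis by (simp add: prod_eq_iff)
qed

lemma open_bundle_chart_image: "c \<in> A \<Longrightarrow> open (chart_image c \<times> (UNIV :: 'e set))"
  by (simp add: open_Times open_chart_image)

section \<open>Coordinate expressions of the almost complex structure and the Sasaki metric\<close>

context
  fixes D :: "('p, 'e) connection" and c :: "('p, 'e) chart"
  assumes D: "affine_connection A D" and c: "c \<in> A"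
begin

text \<open>The connection map in coordinates, at the point with coordinates \<open>z\<close> on the
  vector with components \<zeta>.\<close>

abbreviation vertical_rep :: "'e \<times> 'e \<Rightarrow> 'e \<times> 'e \<Rightarrow> 'e" where
  "vertical_rep \<zeta> z \<equiv> snd \<zeta> + christoffel D c (fst z) (fst \<zeta>) (snd z)"

text \<open>A dictionary between coordinates \<open>(x, y)\<close> and points and vectors of the
  tangent bundle, through which smoothness statements become statements about
  \<open>christoffel\<close> and \<open>metric_rep\<close>.\<close>

lemma bundle_chart_point:
  fixes x y :: 'e and \<zeta> :: "'e \<times> 'e"
  assumes x: "x \<in> chart_image c"
  defines "q \<equiv> chart_inv c x"
  defines "a \<equiv> (q, coord_vec A c q y)"
  defines "Z \<equiv> bundle_vec c a \<zeta>"
  shows "chart_inv (tchart c) (x, y) = a"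
    and "q \<in> fst c" "q \<in> points A" "coord_vec A c q y \<in> tangent_space A q"
    and "Z \<in> bundle_tangent a" "Z (tchart c) = \<zeta>"
    and "bundle_proj A a Z = coord_vec A c q (fst \<zeta>)"
    and "connection_map A D a Z = coord_vec A c q (vertical_rep \<zeta> (x, y))"
proof -
  show "chart_inv (tchart c) (x, y) = a"
    unfolding a_def q_def by (rule chart_inv_tangent_chart[OF c x])
  show q: "q \<in> fst c" unfolding q_def by (rule chart_inv_in[OF x])
  then show p: "q \<in> points A" using c by (auto simp: points_def)
  show u: "coord_vec A c q y \<in> tangent_space A q" by (rule coord_vec_tangent[OF c q])
  have c': "tchart c \<in> tangent_bundle A" "a \<in> fst (tchart c)"
    using c q u by (simp_all add: tangent_chart_in mem_tangent_chart a_def)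
  show Z: "Z \<in> bundle_tangent a"
    unfolding Z_def by (rule T.coord_vec_tangent[OF c'])
  show Zc: "Z (tchart c) = \<zeta>"
    unfolding Z_def by (rule T.coord_vec_same[OF c'])
  have xq: "snd c q = x" unfolding q_def by (rule chart_chart_inv[OF x])
  note Z' = Z[unfolded a_def]
  show "bundle_proj A a Z = coord_vec A c q (fst \<zeta>)"
    unfolding a_def
    by (rule tangent_eqI[OF c q bundle_proj_tangent[OF Z' p u] coord_vec_tangent[OF c q]])
      (simp only: bundle_proj_component[OF Z' c q u] Zc coord_vec_same[OF c q])
  show "connection_map A D a Z = coord_vec A c q (vertical_rep \<zeta> (x, y))"
    unfolding a_def
    by (rule tangent_eqI[OF c q connection_map_tangent[OF D p u Z'] coord_vec_tangent[OF c q]])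
      (simp only: connection_map_component[OF D Z' c q u] Zc coord_vec_same[OF c q] xq fst_conv snd_conv)
qed

lemma smooth_vertical_rep: "smooth_on (chart_image c \<times> UNIV) (vertical_rep \<zeta>)"
proof -
  have im: "fst ` (chart_image c \<times> (UNIV :: 'e set)) \<subseteq> chart_image c" by auto
  have "smooth_on (chart_image c \<times> UNIV) (\<lambda>z. christoffel D c (fst z) (fst \<zeta>) (snd z))"
    by (rule smooth_on_linear_family[OF open_bundle_chart_image[OF c] open_chart_image[OF c] im
          smooth_on_linear[OF bounded_linear_fst] smooth_on_linear[OF bounded_linear_snd]
          christoffel_linear2[OF c] smooth_christoffel[OF D c]])
  then show ?thesis
    by (rule smooth_on_add[OF open_bundle_chart_image[OF c] smooth_on_const])
qed

lemma smooth_bundle_J: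
  "smooth_on (chart_image (tchart c)) (\<lambda>z. bundle_J A D (chart_inv (tchart c) z)
    (bundle_vec c (chart_inv (tchart c) z) \<zeta>) (tchart c))"
  unfolding chart_image_tangent_chart[OF c]
proof (rule smooth_on_cong[OF open_bundle_chart_image[OF c]])
  have im: "fst ` (chart_image c \<times> (UNIV :: 'e set)) \<subseteq> chart_image c" by auto
  have "smooth_on (chart_image c \<times> UNIV) (\<lambda>z. christoffel D c (fst z) (vertical_rep \<zeta> z) (snd z))"
    by (rule smooth_on_bilinear_family[OF open_bundle_chart_image[OF c] open_chart_image[OF c] im
          smooth_on_linear[OF bounded_linear_fst] smooth_vertical_rep smooth_on_linear[OF bounded_linear_snd]
          christoffel_linear1[OF D c] christoffel_linear2[OF c] smooth_christoffel[OF D c]])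
  then show "smooth_on (chart_image c \<times> UNIV) (\<lambda>z. (- vertical_rep \<zeta> z,
      fst \<zeta> + christoffel D c (fst z) (vertical_rep \<zeta> z) (snd z)))"
    by (rule smooth_on_Pair[OF open_bundle_chart_image[OF c]
          smooth_on_minus[OF open_bundle_chart_image[OF c] smooth_vertical_rep]
          smooth_on_add[OF open_bundle_chart_image[OF c] smooth_on_const]])
  fix z assume "z \<in> chart_image c \<times> (UNIV :: 'e set)"
  then obtain x y where z: "z = (x, y)" and x: "x \<in> chart_image c" by (cases z) auto
  note P = bundle_chart_point[OF x]
  show "bundle_J A D (chart_inv (tchart c) z)
    (bundle_vec c (chart_inv (tchart c) z) \<zeta>) (tchart c) =
    (- vertical_rep \<zeta> z, fst \<zeta> + christoffel D c (fst z) (vertical_rep \<zeta> z) (snd z))"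
    by (simp only: z P(1) bundle_J_component[OF D c P(2,4,5)] P(6,8)
        coord_vec_same[OF c P(2)] chart_chart_inv[OF x] fst_conv snd_conv)
qed

lemma sasaki_metric_chart:
  assumes x: "x \<in> chart_image c"
  shows "sasaki_metric A g D (chart_inv (tchart c) (x, y))
      (bundle_vec c (chart_inv (tchart c) (x, y)) \<zeta>)
      (bundle_vec c (chart_inv (tchart c) (x, y)) \<zeta>') =
    metric_rep A g c x (fst \<zeta>) (fst \<zeta>') + metric_rep A g c x (vertical_rep \<zeta> (x, y)) (vertical_rep \<zeta>' (x, y))"
  by (simp only: sasaki_metric_def bundle_chart_point(1,7,8)[OF x] metric_rep_def fst_conv)

lemma smooth_metric_rep_bundle:
  fixes h k :: "'e \<times> 'e \<Rightarrow> 'e"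
  assumes g: "pseudo_riemannian_metric A g"
    and "smooth_on (chart_image c \<times> UNIV) h" "smooth_on (chart_image c \<times> UNIV) k"
  shows "smooth_on (chart_image c \<times> UNIV) (\<lambda>z. metric_rep A g c (fst z) (h z) (k z))"
proof -
  have im: "fst ` (chart_image c \<times> (UNIV :: 'e set)) \<subseteq> chart_image c" by auto
  show ?thesis
    by (rule smooth_on_bilinear_family[OF open_bundle_chart_image[OF c] open_chart_image[OF c] im
          smooth_on_linear[OF bounded_linear_fst] assms(2,3)
          metric_rep_linear1[OF g c] metric_rep_linear2[OF g c] smooth_metric_rep[OF g c]])
qed

lemma smooth_sasaki_metric:
  assumes g: "pseudo_riemannian_metric A g"
  shows "smooth_on (chart_image (tchart c)) (\<lambda>z. sasaki_metric A g D (chart_inv (tchart c) z)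
      (bundle_vec c (chart_inv (tchart c) z) \<zeta>)
      (bundle_vec c (chart_inv (tchart c) z) \<zeta>'))"
  unfolding chart_image_tangent_chart[OF c]
proof (rule smooth_on_cong[OF open_bundle_chart_image[OF c]])
  show "smooth_on (chart_image c \<times> UNIV) (\<lambda>z. metric_rep A g c (fst z) (fst \<zeta>) (fst \<zeta>')
      + metric_rep A g c (fst z) (vertical_rep \<zeta> z) (vertical_rep \<zeta>' z))"
    by (rule smooth_on_add[OF open_bundle_chart_image[OF c]
          smooth_metric_rep_bundle[OF g smooth_on_const smooth_on_const]
          smooth_metric_rep_bundle[OF g smooth_vertical_rep smooth_vertical_rep]])
  fix z assume "z \<in> chart_image c \<times> (UNIV :: 'e set)"
  then obtain x y where z: "z = (x, y)" and x: "x \<in> chart_image c" by (cases z) auto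
  show "sasaki_metric A g D (chart_inv (tchart c) z)
      (bundle_vec c (chart_inv (tchart c) z) \<zeta>)
      (bundle_vec c (chart_inv (tchart c) z) \<zeta>') =
    metric_rep A g c (fst z) (fst \<zeta>) (fst \<zeta>') + metric_rep A g c (fst z) (vertical_rep \<zeta> z) (vertical_rep \<zeta>' z)"
    by (simp only: z sasaki_metric_chart[OF x] fst_conv snd_conv)
qed

end

text \<open>Linearity and \<open>J J = - 1\<close> are compared under \<open>bundle_proj\<close> and
  \<open>connection_map\<close>, where \<open>bundle_J\<close> acts as
  \<open>(h, k) \<mapsto> (- k, h)\<close>.\<close>

lemma almost_complex_structure_bundle_J:
  assumes D: "affine_connection A D"
  shows "almost_complex_structure (tangent_bundle A) (bundle_J A D)"
  unfolding almost_complex_structure_def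
proof (intro conjI ballI allI)
  fix a assume "a \<in> points (tangent_bundle A)"
  then obtain p u where a: "a = (p, u)" and p: "p \<in> points A" and u: "u \<in> tangent_space A p"
    by (auto simp: points_tangent_bundle)
  note sub = T.subspace_tangent_space[of "(p, u)"]
  note Kl = connection_map_linear[OF D p u] and pl = bundle_proj_linear[OF p u]
  note J = bundle_J[OF D p u]
  have Kadd: "connection_map A D (p, u) (Z + W) = connection_map A D (p, u) Z + connection_map A D (p, u) W"
    "bundle_proj A (p, u) (Z + W) = bundle_proj A (p, u) Z + bundle_proj A (p, u) W"
    if "Z \<in> bundle_tangent (p, u)" "W \<in> bundle_tangent (p, u)" for Z W
    using Kl pl that unfolding linear_map_on_def by blast+
  have Kscale: "connection_map A D (p, u) (r *\<^sub>R Z) = r *\<^sub>R connection_map A D (p, u) Z"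
    "bundle_proj A (p, u) (r *\<^sub>R Z) = r *\<^sub>R bundle_proj A (p, u) Z"
    if "Z \<in> bundle_tangent (p, u)" for r Z
    using Kl pl that unfolding linear_map_on_def by blast+
  show "linear_map_on (bundle_tangent a) (bundle_J A D a)"
    unfolding linear_map_on_def a
  proof (intro conjI ballI allI)
    fix Z W assume ZW: "Z \<in> bundle_tangent (p, u)" "W \<in> bundle_tangent (p, u)"
    note s = subspace_add[OF sub ZW] and t = subspace_add[OF sub J(1)[OF ZW(1)] J(1)[OF ZW(2)]]
    show "bundle_J A D (p, u) (Z + W) = bundle_J A D (p, u) Z + bundle_J A D (p, u) W"
      by (rule bundle_tangent_eqI[OF D p u J(1)[OF s] t])
        (simp_all only: J(2,3)[OF s] J(2,3)[OF ZW(1)] J(2,3)[OF ZW(2)] Kadd[OF ZW]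
          Kadd[OF J(1)[OF ZW(1)] J(1)[OF ZW(2)]] minus_add_distrib)
  next
    fix r Z assume Z: "Z \<in> bundle_tangent (p, u)"
    note s = subspace_scale[OF sub Z, of r] and t = subspace_scale[OF sub J(1)[OF Z], of r]
    show "bundle_J A D (p, u) (r *\<^sub>R Z) = r *\<^sub>R bundle_J A D (p, u) Z"
      by (rule bundle_tangent_eqI[OF D p u J(1)[OF s] t])
        (simp_all only: J(2,3)[OF s] J(2,3)[OF Z] Kscale[OF Z] Kscale[OF J(1)[OF Z]] scaleR_minus_right)
  qed
  fix Z assume "Z \<in> bundle_tangent a"
  then have Z: "Z \<in> bundle_tangent (p, u)" by (simp only: a)
  note JZ = J(1)[OF Z]
  show "bundle_J A D a Z \<in> bundle_tangent a" using JZ by (simp only: a)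
  show "bundle_J A D a (bundle_J A D a Z) = - Z"
    unfolding a
    by (rule bundle_tangent_eqI[OF D p u J(1)[OF JZ] subspace_neg[OF sub Z]])
      (simp_all only: J(2,3)[OF JZ] J(2,3)[OF Z] Kscale[OF Z, of "-1", unfolded scaleR_minus1_left])
next
  fix c' \<zeta> assume "c' \<in> tangent_bundle A"
  then obtain c where c: "c' = tchart c" "c \<in> A" by (auto simp: tangent_bundle_def)
  show "smooth_on (chart_image c') (\<lambda>x. bundle_J A D (chart_inv c' x)
      (coord_vec (tangent_bundle A) c' (chart_inv c' x) \<zeta>) c')"
    unfolding c(1) by (rule smooth_bundle_J[OF D c(2)])
qed

text \<open>For nondegeneracy, vectors with one of projection and connection map zero and the other
  arbitrary isolate the two summands, which reduces the claim to the nondegeneracy of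
  \<open>g\<close>.\<close>

lemma pseudo_riemannian_sasaki_metric:
  assumes D: "affine_connection A D" and g: "pseudo_riemannian_metric A g"
  shows "pseudo_riemannian_metric (tangent_bundle A) (sasaki_metric A g D)"
  unfolding pseudo_riemannian_metric_def
proof (intro conjI ballI allI impI)
  fix a Z assume "a \<in> points (tangent_bundle A)" and Z': "Z \<in> bundle_tangent a"
  then obtain p u where a: "a = (p, u)" and p: "p \<in> points A" and u: "u \<in> tangent_space A p"
    by (auto simp: points_tangent_bundle)
  have Z: "Z \<in> bundle_tangent (p, u)" using Z' by (simp only: a)
  note Kl = connection_map_linear[OF D p u] and pl = bundle_proj_linear[OF p u]
  note Kt = connection_map_tangent[OF D p u] and pt = bundle_proj_tangent[OF _ p u]
  have S: "sasaki_metric A g D a V W = g p (bundle_proj A (p, u) V) (bundle_proj A (p, u) W)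
      + g p (connection_map A D (p, u) V) (connection_map A D (p, u) W)" for V W
    by (simp only: sasaki_metric_def a fst_conv)
  show "linear_map_on (bundle_tangent a) (sasaki_metric A g D a Z)"
    unfolding linear_map_on_def
  proof (intro conjI ballI allI)
    fix V W assume VW': "V \<in> bundle_tangent a" "W \<in> bundle_tangent a"
    note VW = VW'[unfolded a]
    have "connection_map A D (p, u) (V + W) = connection_map A D (p, u) V + connection_map A D (p, u) W"
      "bundle_proj A (p, u) (V + W) = bundle_proj A (p, u) V + bundle_proj A (p, u) W"
      using Kl pl VW unfolding linear_map_on_def by blast+
    then show "sasaki_metric A g D a Z (V + W) = sasaki_metric A g D a Z V + sasaki_metric A g D a Z W"
      by (simp only: S metric_add(1)[OF g p pt[OF Z] pt[OF VW(1)] pt[OF VW(2)]]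
          metric_add(1)[OF g p Kt[OF Z] Kt[OF VW(1)] Kt[OF VW(2)]] add_ac)
  next
    fix r V assume V': "V \<in> bundle_tangent a"
    note V = V'[unfolded a]
    have "connection_map A D (p, u) (r *\<^sub>R V) = r *\<^sub>R connection_map A D (p, u) V"
      "bundle_proj A (p, u) (r *\<^sub>R V) = r *\<^sub>R bundle_proj A (p, u) V"
      using Kl pl V unfolding linear_map_on_def by blast+
    then show "sasaki_metric A g D a Z (r *\<^sub>R V) = r *\<^sub>R sasaki_metric A g D a Z V"
      by (simp only: S metric_scale(1)[OF g p pt[OF Z] pt[OF V]] metric_scale(1)[OF g p Kt[OF Z] Kt[OF V]]
          real_scaleR_def distrib_left)
  qed
  show "sasaki_metric A g D a Z W = sasaki_metric A g D a W Z" if "W \<in> bundle_tangent a" for W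
    using metric_sym[OF g p pt[OF Z] pt[OF that[unfolded a]]] metric_sym[OF g p Kt[OF Z] Kt[OF that[unfolded a]]]
    by (simp only: S)
  assume 0: "\<forall>W\<in>bundle_tangent a. sasaki_metric A g D a Z W = 0"
  have z: "0 \<in> tangent_space A p" by (rule subspace_0[OF subspace_tangent_space])
  have g0: "g p v 0 = 0" if "v \<in> tangent_space A p" for v
    by (rule linear_map_on_zero[OF metric_linear[OF g p that] subspace_tangent_space])
  have nondeg: "v = 0" if "v \<in> tangent_space A p" "\<And>w. w \<in> tangent_space A p \<Longrightarrow> g p v w = 0" for v
    using g p that unfolding pseudo_riemannian_metric_def by blast
  have "bundle_proj A (p, u) Z = 0"
  proof (rule nondeg[OF pt[OF Z]])
    fix v assume v: "v \<in> tangent_space A p"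
    obtain W where W: "W \<in> bundle_tangent (p, u)"
      "bundle_proj A (p, u) W = v" "connection_map A D (p, u) W = 0"
      using bundle_tangent_exists[OF D p u v z] by blast
    have "sasaki_metric A g D a Z W = 0" using 0 W(1) unfolding a by blast
    then show "g p (bundle_proj A (p, u) Z) v = 0"
      by (simp only: S W(2,3) g0[OF Kt[OF Z]] add_0_right)
  qed
  moreover have "connection_map A D (p, u) Z = 0"
  proof (rule nondeg[OF Kt[OF Z]])
    fix v assume v: "v \<in> tangent_space A p"
    obtain W where W: "W \<in> bundle_tangent (p, u)"
      "bundle_proj A (p, u) W = 0" "connection_map A D (p, u) W = v"
      using bundle_tangent_exists[OF D p u z v] by blast
    have "sasaki_metric A g D a Z W = 0" using 0 W(1) unfolding a by blast
    then show "g p (connection_map A D (p, u) Z) v = 0"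
      by (simp only: S W(2,3) g0[OF pt[OF Z]] add_0_left)
  qed
  moreover have "bundle_proj A (p, u) 0 = 0" "connection_map A D (p, u) 0 = 0"
    by (rule linear_map_on_zero[OF pl T.subspace_tangent_space], rule linear_map_on_zero[OF Kl T.subspace_tangent_space])
  ultimately show "Z = 0"
    by (intro bundle_tangent_eqI[OF D p u Z subspace_0[OF T.subspace_tangent_space]]) (simp_all only:)
next
  fix c' \<zeta> \<zeta>' assume "c' \<in> tangent_bundle A"
  then obtain c where c: "c' = tchart c" "c \<in> A" by (auto simp: tangent_bundle_def)
  show "smooth_on (chart_image c') (\<lambda>x. sasaki_metric A g D (chart_inv c' x)
      (coord_vec (tangent_bundle A) c' (chart_inv c' x) \<zeta>) (coord_vec (tangent_bundle A) c' (chart_inv c' x) \<zeta>'))"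
    unfolding c(1) by (rule smooth_sasaki_metric[OF D c(2) g])
qed

text \<open>\<open>bundle_J\<close> exchanges the two summands of the metric; its sign occurs twice
  in one of them and cancels.\<close>

lemma almost_hermitian_sasaki:
  assumes A: "smooth_manifold A" and D: "affine_connection A D" and g: "pseudo_riemannian_metric A g"
  shows "almost_hermitian (tangent_bundle A) (sasaki_metric A g D) (bundle_J A D)"
  unfolding almost_hermitian_def
proof (intro conjI ballI)
  fix a Z W assume "a \<in> points (tangent_bundle A)"
    and ZW': "Z \<in> bundle_tangent a" "W \<in> bundle_tangent a"
  then obtain p u where a: "a = (p, u)" and p: "p \<in> points A" and u: "u \<in> tangent_space A p"
    by (auto simp: points_tangent_bundle)
  note Z = ZW'(1)[unfolded a] and W = ZW'(2)[unfolded a]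
  note Kt = connection_map_tangent[OF D p u Z] connection_map_tangent[OF D p u W]
  show "sasaki_metric A g D a (bundle_J A D a Z) (bundle_J A D a W) = sasaki_metric A g D a Z W"
    by (simp only: a sasaki_metric_def fst_conv bundle_J(2,3)[OF D p u Z] bundle_J(2,3)[OF D p u W]
        metric_minus(1)[OF g p subspace_neg[OF subspace_tangent_space Kt(1)] Kt(2)]
        metric_minus(2)[OF g p Kt(2,1)] minus_minus add.commute)
qed (intro smooth_manifold_tangent_bundle[OF A] pseudo_riemannian_sasaki_metric[OF D g]
    almost_complex_structure_bundle_J[OF D])+

end

section \<open>The fundamental form is closed\<close>

text \<open>A product rule for evaluating a moving linear map at a moving vector. Only the
  derivatives of \<open>L\<close> at fixed vectors are available, so both factors are expanded in a
  basis and the sum is collected again.\<close>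

lemma has_derivative_linear_family:
  fixes L :: "'a::real_normed_vector \<Rightarrow> 'b::euclidean_space \<Rightarrow> 'c::real_normed_vector"
  assumes "open U" "x \<in> U" and lin: "\<And>z. z \<in> U \<Longrightarrow> linear (L z)"
    and L: "\<And>b. (\<lambda>z. L z b) differentiable at x" and h: "(h has_derivative h') (at x)"
  shows "((\<lambda>z. L z (h z)) has_derivative
    (\<lambda>v. frechet_derivative (\<lambda>z. L z (h x)) (at x) v + L x (h' v))) (at x)"
proof -
  define L' where "L' = (\<lambda>b. frechet_derivative (\<lambda>z. L z b) (at x))"
  have L': "((\<lambda>z. L z b) has_derivative L' b) (at x)" for b
    unfolding L'_def using L frechet_derivative_works by blast
  have exp: "L z y = (\<Sum>b\<in>Basis. (y \<bullet> b) *\<^sub>R L z b)" if "z \<in> U" for z y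
    by (rule linear_sum_Basis[OF lin[OF that]])
  have "((\<lambda>z. \<Sum>b\<in>Basis. (h x \<bullet> b) *\<^sub>R L z b) has_derivative
      (\<lambda>v. \<Sum>b\<in>Basis. (h x \<bullet> b) *\<^sub>R L' b v)) (at x)"
    by (intro has_derivative_sum has_derivative_scaleR_right L')
  then have "((\<lambda>z. L z (h x)) has_derivative (\<lambda>v. \<Sum>b\<in>Basis. (h x \<bullet> b) *\<^sub>R L' b v)) (at x)"
    by (rule has_derivative_transform_within_open[OF _ assms(1,2)]) (rule exp[symmetric])
  then have eq: "frechet_derivative (\<lambda>z. L z (h x)) (at x) v = (\<Sum>b\<in>Basis. (h x \<bullet> b) *\<^sub>R L' b v)" for v
    by (simp add: frechet_derivative_eqI)
  have "((\<lambda>z. \<Sum>b\<in>Basis. (h z \<bullet> b) *\<^sub>R L z b) has_derivative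
      (\<lambda>v. \<Sum>b\<in>Basis. (h x \<bullet> b) *\<^sub>R L' b v + (h' v \<bullet> b) *\<^sub>R L x b)) (at x)"
    by (intro has_derivative_sum has_derivative_scaleR has_derivative_inner_left h L')
  then have "((\<lambda>z. L z (h z)) has_derivative
      (\<lambda>v. \<Sum>b\<in>Basis. (h x \<bullet> b) *\<^sub>R L' b v + (h' v \<bullet> b) *\<^sub>R L x b)) (at x)"
    by (rule has_derivative_transform_within_open[OF _ assms(1,2)]) (rule exp[symmetric])
  moreover have "(\<Sum>b\<in>Basis. (h x \<bullet> b) *\<^sub>R L' b v + (h' v \<bullet> b) *\<^sub>R L x b) =
      frechet_derivative (\<lambda>z. L z (h x)) (at x) v + L x (h' v)" for v
    unfolding eq sum.distrib exp[OF assms(2), of "h' v", symmetric] ..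
  ultimately show ?thesis by (simp only:)
qed

definition metric_deriv :: "('p, 'e::euclidean_space) atlas \<Rightarrow>
    ('p \<Rightarrow> ('p, 'e) tvec \<Rightarrow> ('p, 'e) tvec \<Rightarrow> real) \<Rightarrow> ('p, 'e) chart \<Rightarrow> 'e \<Rightarrow> 'e \<Rightarrow> 'e \<Rightarrow> 'e \<Rightarrow> real" where
  "metric_deriv A g c x \<zeta> \<xi> \<eta> = frechet_derivative (\<lambda>x. metric_rep A g c x \<xi> \<eta>) (at x) \<zeta>"

context smooth_structure
begin

lemma metric_rep_has_derivative:
  assumes "pseudo_riemannian_metric A g" "c \<in> A" "x \<in> chart_image c"
  shows "((\<lambda>x. metric_rep A g c x \<xi> \<eta>) has_derivative (\<lambda>\<zeta>. metric_deriv A g c x \<zeta> \<xi> \<eta>)) (at x)"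
  unfolding metric_deriv_def by (rule smooth_on_has_derivative[OF smooth_metric_rep[OF assms(1,2)] assms(3)])

lemma smooth_metric_deriv:
  assumes "pseudo_riemannian_metric A g" "c \<in> A"
  shows "smooth_on (chart_image c) (\<lambda>x. metric_deriv A g c x \<zeta> \<xi> \<eta>)"
  unfolding metric_deriv_def by (rule smooth_on_frechet_derivative[OF smooth_metric_rep[OF assms]])

lemma metric_deriv_sym:
  assumes "pseudo_riemannian_metric A g" "c \<in> A" "x \<in> chart_image c"
  shows "metric_deriv A g c x \<zeta> \<xi> \<eta> = metric_deriv A g c x \<zeta> \<eta> \<xi>"
  unfolding metric_deriv_def
  by (rule fun_cong[OF frechet_derivative_cong_open[OF open_chart_image[OF assms(2)] assms(3)]])
    (rule metric_rep_sym[OF assms(1,2)])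

lemma metric_deriv_linear:
  assumes g: "pseudo_riemannian_metric A g" and c: "c \<in> A" and x: "x \<in> chart_image c"
  shows "linear (metric_deriv A g c x \<zeta> \<xi>)"
proof (rule linearI)
  note d = metric_rep_has_derivative[OF g c x] and op = open_chart_image[OF c]
  note lin = metric_rep_linear2[OF g c]
  fix \<eta> \<eta>' r
  have "((\<lambda>x. metric_rep A g c x \<xi> (\<eta> + \<eta>')) has_derivative
      (\<lambda>\<zeta>. metric_deriv A g c x \<zeta> \<xi> \<eta> + metric_deriv A g c x \<zeta> \<xi> \<eta>')) (at x)"
    by (rule has_derivative_transform_within_open[OF has_derivative_add[OF d d] op x])
      (simp only: linear_add[OF lin])
  from fun_cong[OF has_derivative_unique[OF d this], of \<zeta>]
  show "metric_deriv A g c x \<zeta> \<xi> (\<eta> + \<eta>') = metric_deriv A g c x \<zeta> \<xi> \<eta> + metric_deriv A g c x \<zeta> \<xi> \<eta>'" .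
  have "((\<lambda>x. metric_rep A g c x \<xi> (r *\<^sub>R \<eta>)) has_derivative
      (\<lambda>\<zeta>. r *\<^sub>R metric_deriv A g c x \<zeta> \<xi> \<eta>)) (at x)"
    by (rule has_derivative_transform_within_open[OF has_derivative_scaleR_right[OF d] op x])
      (simp only: linear_scale[OF lin])
  from fun_cong[OF has_derivative_unique[OF d this], of \<zeta>]
  show "metric_deriv A g c x \<zeta> \<xi> (r *\<^sub>R \<eta>) = r *\<^sub>R metric_deriv A g c x \<zeta> \<xi> \<eta>" .
qed

lemma metric_field_chart:
  assumes Y: "Y \<in> vector_fields A" and Z: "Z \<in> vector_fields A" and c: "c \<in> A" "x \<in> chart_image c"
  shows "((\<lambda>q. g q (Y q) (Z q)) \<circ> chart_inv c) x = metric_rep A g c x (local_rep c Y x) (local_rep c Z x)"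
  using coord_vec_component[OF c(1) chart_inv_in[OF c(2)] vector_field_tangent[OF Y]]
    coord_vec_component[OF c(1) chart_inv_in[OF c(2)] vector_field_tangent[OF Z]]
  by (simp add: metric_rep_def)

lemma smooth_metric_field:
  assumes g: "pseudo_riemannian_metric A g" and Y: "Y \<in> vector_fields A" and Z: "Z \<in> vector_fields A"
  shows "smooth_function A (\<lambda>q. g q (Y q) (Z q))"
  unfolding smooth_function_def
proof
  fix c assume c: "c \<in> A"
  note op = open_chart_image[OF c]
  have id: "(\<lambda>x. x) ` chart_image c \<subseteq> chart_image c" by simp
  show "smooth_on (chart_image c) ((\<lambda>q. g q (Y q) (Z q)) \<circ> chart_inv c)"
    by (rule smooth_on_cong[OF op smooth_on_bilinear_family[OF op op id smooth_on_ident
            smooth_local_rep[OF Y c] smooth_local_rep[OF Z c]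
            metric_rep_linear1[OF g c] metric_rep_linear2[OF g c] smooth_metric_rep[OF g c]]])
      (assumption | rule metric_field_chart[OF Y Z c])+
qed

text \<open>The product rule for a bilinear form with both arguments moving, by
  \<open>has_derivative_linear_family\<close> for one argument after the other.\<close>

lemma metric_field_derivative:
  assumes g: "pseudo_riemannian_metric A g" and Y: "Y \<in> vector_fields A" and Z: "Z \<in> vector_fields A"
    and c: "c \<in> A" "p \<in> fst c" and u: "u \<in> tangent_space A p"
  shows "dir_deriv A p u (\<lambda>q. g q (Y q) (Z q)) =
    metric_deriv A g c (snd c p) (u c) (Y p c) (Z p c)
    + metric_rep A g c (snd c p) (Y p c) (frechet_derivative (local_rep c Z) (at (snd c p)) (u c))
    + metric_rep A g c (snd c p) (frechet_derivative (local_rep c Y) (at (snd c p)) (u c)) (Z p c)"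
proof -
  let ?x = "snd c p"
  let ?G = "metric_rep A g c"
  let ?Y' = "frechet_derivative (local_rep c Y) (at ?x)" and ?Z' = "frechet_derivative (local_rep c Z) (at ?x)"
  note op = open_chart_image[OF c(1)] and x = chart_in_image[OF c(2)]
  have rep: "local_rep c Y ?x = Y p c" "local_rep c Z ?x = Z p c"
    by (simp_all add: chart_inv_chart[OF c])
  have d1: "((\<lambda>x. ?G x b (local_rep c Z x)) has_derivative
      (\<lambda>v. metric_deriv A g c ?x v b (Z p c) + ?G ?x b (?Z' v))) (at ?x)" for b
  proof -
    have "((\<lambda>x. ?G x b (local_rep c Z x)) has_derivative
        (\<lambda>v. frechet_derivative (\<lambda>x. ?G x b (local_rep c Z ?x)) (at ?x) v + ?G ?x b (?Z' v))) (at ?x)"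
    proof (rule has_derivative_linear_family[OF op x, where L = "\<lambda>x. ?G x b"])
      show "linear (?G z b)" if "z \<in> chart_image c" for z
        by (rule metric_rep_linear2[OF g c(1) that])
      show "(\<lambda>x. ?G x b b') differentiable at ?x" for b'
        using metric_rep_has_derivative[OF g c(1) x] unfolding differentiable_def by blast
    qed (rule local_rep_has_derivative[OF Z c])
    then show ?thesis unfolding rep metric_deriv_def .
  qed
  have "((\<lambda>x. ?G x (local_rep c Y x) (local_rep c Z x)) has_derivative
      (\<lambda>v. frechet_derivative (\<lambda>x. ?G x (local_rep c Y ?x) (local_rep c Z x)) (at ?x) v
        + ?G ?x (?Y' v) (local_rep c Z ?x))) (at ?x)"
  proof (rule has_derivative_linear_family[OF op x, where L = "\<lambda>x b. ?G x b (local_rep c Z x)"])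
    show "linear (\<lambda>b. ?G z b (local_rep c Z z))" if "z \<in> chart_image c" for z
      by (rule metric_rep_linear1[OF g c(1) that])
    show "(\<lambda>x. ?G x b (local_rep c Z x)) differentiable at ?x" for b
      using d1 unfolding differentiable_def by blast
  qed (rule local_rep_has_derivative[OF Y c])
  then have d2: "((\<lambda>x. ?G x (local_rep c Y x) (local_rep c Z x)) has_derivative
      (\<lambda>v. (metric_deriv A g c ?x v (Y p c) (Z p c) + ?G ?x (Y p c) (?Z' v)) + ?G ?x (?Y' v) (Z p c))) (at ?x)"
    unfolding rep frechet_derivative_eqI[OF d1] .
  have "dir_deriv A p u (\<lambda>q. g q (Y q) (Z q)) =
      frechet_derivative ((\<lambda>q. g q (Y q) (Z q)) \<circ> chart_inv c) (at ?x) (u c)"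
    by (rule dir_deriv_chart[OF c u smooth_metric_field[OF g Y Z]])
  also have "\<dots> = frechet_derivative (\<lambda>x. ?G x (local_rep c Y x) (local_rep c Z x)) (at ?x) (u c)"
    by (rule fun_cong[OF frechet_derivative_cong_open[OF op x]]) (rule metric_field_chart[OF Y Z c(1)])
  finally show ?thesis
    unfolding frechet_derivative_eqI[OF d2] .
qed

end

section \<open>Levi-Civita connection and Kaehler form in coordinates\<close>

context framed_manifold
begin

interpretation T: smooth_structure "tangent_bundle A"
  by unfold_locales (rule smooth_atlas_tangent_bundle)

text \<open>Connection axioms, torsion and bracket speak of global fields; this supplies one with
  prescribed coordinates at a single point.\<close>

lemma field_through_chart:
  assumes c: "c \<in> A" and x: "x \<in> chart_image c"
  obtains Y where "Y \<in> vector_fields A" "Y (chart_inv c x) = coord_vec A c (chart_inv c x) \<xi>"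
    "Y (chart_inv c x) c = \<xi>"
proof -
  note q = chart_inv_in[OF x]
  obtain Y where Y: "Y \<in> vector_fields A" "Y (chart_inv c x) = coord_vec A c (chart_inv c x) \<xi>"
    by (rule field_through[OF chart_inv_points[OF c x] coord_vec_tangent[OF c q]])
  show ?thesis
    by (rule that[OF Y]) (simp only: Y(2) coord_vec_same[OF c q])
qed

text \<open>Vanishing torsion for two fields with the given values at one point. Their derivative
  terms are precisely the Lie bracket, so only the Christoffel terms remain.\<close>

lemma christoffel_sym:
  assumes LC: "levi_civita_connection A g D" and c: "c \<in> A" and x: "x \<in> chart_image c"
  shows "christoffel D c x \<xi> \<eta> = christoffel D c x \<eta> \<xi>"
proof -
  let ?q = "chart_inv c x"
  note q = chart_inv_in[OF x] and p = chart_inv_points[OF c x]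
  have D: "affine_connection A D" using LC by (simp add: levi_civita_connection_def)
  obtain X where X: "X \<in> vector_fields A" "X ?q = coord_vec A c ?q \<xi>" "X ?q c = \<xi>"
    by (rule field_through_chart[OF c x])
  obtain Y where Y: "Y \<in> vector_fields A" "Y ?q = coord_vec A c ?q \<eta>" "Y ?q c = \<eta>"
    by (rule field_through_chart[OF c x])
  have "D ?q (X ?q) Y - D ?q (Y ?q) X = lie_bracket A X Y ?q"
    using LC X(1) Y(1) p unfolding levi_civita_connection_def by blast
  then have "D ?q (X ?q) Y c - D ?q (Y ?q) X c = lie_bracket A X Y ?q c"
    by (metis fun_diff_def)
  then show ?thesis
    using connection_local[OF D Y(1) c q vector_field_tangent[OF X(1)]]
      connection_local[OF D X(1) c q vector_field_tangent[OF Y(1)]] q c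
    by (simp add: lie_bracket_def X(3) Y(3) chart_chart_inv[OF x])
qed

text \<open>Metric compatibility for two fields with the given values. The derivatives of the fields
  occur on both sides and cancel.\<close>

lemma metric_deriv_levi_civita:
  assumes g: "pseudo_riemannian_metric A g" and LC: "levi_civita_connection A g D"
    and c: "c \<in> A" and x: "x \<in> chart_image c"
  shows "metric_deriv A g c x \<zeta> \<xi> \<eta> = metric_rep A g c x (christoffel D c x \<zeta> \<xi>) \<eta>
    + metric_rep A g c x \<xi> (christoffel D c x \<zeta> \<eta>)"
proof -
  let ?q = "chart_inv c x"
  let ?u = "coord_vec A c ?q \<zeta>"
  note q = chart_inv_in[OF x] and p = chart_inv_points[OF c x] and xq = chart_chart_inv[OF x]
  note u = coord_vec_tangent[OF c q, of \<zeta>] and uc = coord_vec_same[OF c q, of \<zeta>]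
  have D: "affine_connection A D" using LC by (simp add: levi_civita_connection_def)
  obtain Y where Y: "Y \<in> vector_fields A" "Y ?q = coord_vec A c ?q \<xi>" "Y ?q c = \<xi>"
    by (rule field_through_chart[OF c x])
  obtain Z where Z: "Z \<in> vector_fields A" "Z ?q = coord_vec A c ?q \<eta>" "Z ?q c = \<eta>"
    by (rule field_through_chart[OF c x])
  have "dir_deriv A ?q ?u (\<lambda>q. g q (Y q) (Z q)) = g ?q (D ?q ?u Y) (Z ?q) + g ?q (Y ?q) (D ?q ?u Z)"
    using LC Y(1) Z(1) p u unfolding levi_civita_connection_def by blast
  also have "\<dots> = metric_rep A g c x (D ?q ?u Y c) \<eta> + metric_rep A g c x \<xi> (D ?q ?u Z c)"
    using metric_rep_component[OF c q connection_tangent[OF D p u Y(1)] vector_field_tangent[OF Z(1)], of g]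
      metric_rep_component[OF c q vector_field_tangent[OF Y(1)] connection_tangent[OF D p u Z(1)], of g]
    by (simp only: xq Y(3) Z(3))
  also have "D ?q ?u Y c = frechet_derivative (local_rep c Y) (at x) \<zeta> + christoffel D c x \<zeta> \<xi>"
    using connection_local[OF D Y(1) c q u] by (simp only: xq uc Y(3))
  also have "D ?q ?u Z c = frechet_derivative (local_rep c Z) (at x) \<zeta> + christoffel D c x \<zeta> \<eta>"
    using connection_local[OF D Z(1) c q u] by (simp only: xq uc Z(3))
  finally show ?thesis
    using metric_field_derivative[OF g Y(1) Z(1) c q u]
    by (simp only: xq uc Y(3) Z(3) linear_add[OF metric_rep_linear1[OF g c x]] linear_add[OF metric_rep_linear2[OF g c x]])
qed

lemma kaehler_form_chart:
  assumes D: "affine_connection A D" and g: "pseudo_riemannian_metric A g"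
    and c: "c \<in> A" and x: "x \<in> chart_image c"
  shows "kaehler_form (sasaki_metric A g D) (bundle_J A D) (chart_inv (tchart c) (x, y))
      (bundle_vec c (chart_inv (tchart c) (x, y)) \<zeta>)
      (bundle_vec c (chart_inv (tchart c) (x, y)) \<zeta>') =
    metric_rep A g c x (fst \<zeta>) (snd \<zeta>' + christoffel D c x (fst \<zeta>') y)
    - metric_rep A g c x (snd \<zeta> + christoffel D c x (fst \<zeta>) y) (fst \<zeta>')"
proof -
  note P = bundle_chart_point[OF D c x]
  have J: "bundle_proj A (chart_inv c x, coord_vec A c (chart_inv c x) y)
      (bundle_J A D (chart_inv c x, coord_vec A c (chart_inv c x) y)
       (bundle_vec c (chart_inv c x, coord_vec A c (chart_inv c x) y) \<zeta>)) =
      - coord_vec A c (chart_inv c x) (snd \<zeta> + christoffel D c x (fst \<zeta>) y)"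
    "connection_map A D (chart_inv c x, coord_vec A c (chart_inv c x) y)
      (bundle_J A D (chart_inv c x, coord_vec A c (chart_inv c x) y)
       (bundle_vec c (chart_inv c x, coord_vec A c (chart_inv c x) y) \<zeta>)) =
      coord_vec A c (chart_inv c x) (fst \<zeta>)"
    by (simp_all only: bundle_J(2,3)[OF D P(3,4,5)] P(7,8) fst_conv snd_conv)
  note t = coord_vec_tangent[OF c P(2)]
  show ?thesis
    by (simp only: kaehler_form_def sasaki_metric_def P(1) J P(7,8) fst_conv snd_conv
        metric_minus(2)[OF g P(3) t t] metric_rep_def)
qed

text \<open>Both connections differentiate the same field, so the derivative term drops out of the
  comparison and the difference tensor is all that is left.\<close>

lemma christoffel_difference:
  assumes D: "affine_connection A D" and D': "affine_connection A D'"
    and S: "\<And>p u Y. p \<in> points A \<Longrightarrow> u \<in> tangent_space A p \<Longrightarrow> Y \<in> vector_fields A \<Longrightarrow>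
      D' p u Y = D p u Y + S p u (Y p)"
    and c: "c \<in> A" and x: "x \<in> chart_image c"
  shows "christoffel D' c x \<xi> y = christoffel D c x \<xi> y
    + S (chart_inv c x) (coord_vec A c (chart_inv c x) \<xi>) (coord_vec A c (chart_inv c x) y) c"
proof -
  let ?q = "chart_inv c x"
  note q = chart_inv_in[OF x] and p = chart_inv_points[OF c x] and xq = chart_chart_inv[OF x]
  note u = coord_vec_tangent[OF c q, of \<xi>] and uc = coord_vec_same[OF c q, of \<xi>]
  obtain Y where Y: "Y \<in> vector_fields A" "Y ?q = coord_vec A c ?q y" "Y ?q c = y"
    by (rule field_through_chart[OF c x])
  have "D' ?q (coord_vec A c ?q \<xi>) Y c = D ?q (coord_vec A c ?q \<xi>) Y c + S ?q (coord_vec A c ?q \<xi>) (Y ?q) c"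
    by (simp only: S[OF p u Y(1)] plus_fun_apply)
  then show ?thesis
    using connection_local[OF D Y(1) c q u] connection_local[OF D' Y(1) c q u]
    by (simp add: xq uc Y(3)) (simp add: Y(2))
qed

text \<open>The difference tensor does not contribute because of \<open>S_sym\<close>, and by metric compatibility and
  vanishing torsion the Christoffel symbols combine to minus the differential of the 1-form
  \<open>g(y, \<xi>)\<close> in the coordinates \<open>(x, y)\<close> of the tangent bundle.\<close>

lemma kaehler_form_exact:
  assumes g: "pseudo_riemannian_metric A g" and LC: "levi_civita_connection A g D"
    and D': "affine_connection A D'"
    and S: "\<And>p u Y. p \<in> points A \<Longrightarrow> u \<in> tangent_space A p \<Longrightarrow> Y \<in> vector_fields A \<Longrightarrow>
      D' p u Y = D p u Y + S p u (Y p)"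
    and S_tangent: "\<And>p u y. p \<in> points A \<Longrightarrow> u \<in> tangent_space A p \<Longrightarrow> y \<in> tangent_space A p \<Longrightarrow>
      S p u y \<in> tangent_space A p"
    and S_sym: "\<And>p u v y. p \<in> points A \<Longrightarrow> u \<in> tangent_space A p \<Longrightarrow> v \<in> tangent_space A p \<Longrightarrow>
      y \<in> tangent_space A p \<Longrightarrow> g p (S p u y) v = g p u (S p v y)"
    and c: "c \<in> A" and x: "x \<in> chart_image c"
  shows "kaehler_form (sasaki_metric A g D') (bundle_J A D') (chart_inv (tchart c) (x, y))
      (bundle_vec c (chart_inv (tchart c) (x, y)) \<zeta>)
      (bundle_vec c (chart_inv (tchart c) (x, y)) \<zeta>') =
    metric_rep A g c x (fst \<zeta>) (snd \<zeta>') - metric_rep A g c x (snd \<zeta>) (fst \<zeta>')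
    + metric_deriv A g c x (fst \<zeta>') (fst \<zeta>) y - metric_deriv A g c x (fst \<zeta>) (fst \<zeta>') y"
proof -
  let ?q = "chart_inv c x" and ?G = "metric_rep A g c x" and ?\<Gamma> = "christoffel D c x"
  note q = chart_inv_in[OF x] and p = chart_inv_points[OF c x] and xq = chart_chart_inv[OF x]
  note t = coord_vec_tangent[OF c q] and same = coord_vec_same[OF c q]
  have D: "affine_connection A D" using LC by (simp add: levi_civita_connection_def)
  define s where "s = (\<lambda>\<xi>. S ?q (coord_vec A c ?q \<xi>) (coord_vec A c ?q y) c)"
  have \<Gamma>': "christoffel D' c x \<xi> y = ?\<Gamma> \<xi> y + s \<xi>" for \<xi>
    unfolding s_def by (rule christoffel_difference[OF D D' S c x])
  have s: "?G (s \<xi>) \<eta> = ?G \<xi> (s \<eta>)" for \<xi> \<eta>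
    using S_sym[OF p t[of \<xi>] t[of \<eta>] t[of y]]
      metric_rep_component[OF c q S_tangent[OF p t[of \<xi>] t[of y]] t[of \<eta>], of g]
      metric_rep_component[OF c q t[of \<xi>] S_tangent[OF p t[of \<eta>] t[of y]], of g]
    by (simp only: s_def xq same)
  \<comment> \<open>Each metric derivative is a sum of two terms by compatibility. The terms in
    which \<Gamma> is paired with \<open>y\<close> agree because \<Gamma> is symmetric; the other
    two form the left-hand side.\<close>
  have "?G (fst \<zeta>) (?\<Gamma> (fst \<zeta>') y) - ?G (?\<Gamma> (fst \<zeta>) y) (fst \<zeta>') =
      metric_deriv A g c x (fst \<zeta>') (fst \<zeta>) y - metric_deriv A g c x (fst \<zeta>) (fst \<zeta>') y"
    unfolding metric_deriv_levi_civita[OF g LC c x] christoffel_sym[OF LC c x, of "fst \<zeta>'" "fst \<zeta>"]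
      metric_rep_sym[OF g c x, of "?\<Gamma> (fst \<zeta>) y"] by simp
  then show ?thesis
    unfolding kaehler_form_chart[OF D' g c x] \<Gamma>'
      linear_add[OF metric_rep_linear1[OF g c x]] linear_add[OF metric_rep_linear2[OF g c x]] s
    by simp
qed

text \<open>Derivative of the expression found in \<open>kaehler_form_exact\<close>. It is linear in
  the fibre coordinate, so moving \<open>y\<close> only replaces it by its increment;
  \<open>ddG\<close> collects second derivatives of the metric with the last argument frozen at
  \<open>y\<^sub>0\<close>.\<close>

lemma exact_form_derivative:
  fixes x\<^sub>0 y\<^sub>0 :: 'e
  assumes g: "pseudo_riemannian_metric A g" and c: "c \<in> A" and x: "x\<^sub>0 \<in> chart_image c"
  defines "dG \<equiv> metric_deriv A g c"
  defines "ddG \<equiv> \<lambda>\<zeta> \<xi>. frechet_derivative (\<lambda>x. dG x \<zeta> \<xi> y\<^sub>0) (at x\<^sub>0)"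
  shows "((\<lambda>z. metric_rep A g c (fst z) \<xi>\<^sub>1 \<eta>\<^sub>2 - metric_rep A g c (fst z) \<eta>\<^sub>1 \<xi>\<^sub>2
      + dG (fst z) \<xi>\<^sub>2 \<xi>\<^sub>1 (snd z) - dG (fst z) \<xi>\<^sub>1 \<xi>\<^sub>2 (snd z)) has_derivative
    (\<lambda>v. dG x\<^sub>0 (fst v) \<xi>\<^sub>1 \<eta>\<^sub>2 - dG x\<^sub>0 (fst v) \<eta>\<^sub>1 \<xi>\<^sub>2
      + (ddG \<xi>\<^sub>2 \<xi>\<^sub>1 (fst v) + dG x\<^sub>0 \<xi>\<^sub>2 \<xi>\<^sub>1 (snd v))
      - (ddG \<xi>\<^sub>1 \<xi>\<^sub>2 (fst v) + dG x\<^sub>0 \<xi>\<^sub>1 \<xi>\<^sub>2 (snd v)))) (at (x\<^sub>0, y\<^sub>0))"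
proof -
  have comp: "((\<lambda>z. f (fst z)) has_derivative (\<lambda>v. f' (fst v))) (at (x\<^sub>0, y\<^sub>0))"
    if "(f has_derivative f') (at x\<^sub>0)" for f :: "'e \<Rightarrow> real" and f'
    by (rule has_derivative_compose[OF has_derivative_fst[OF has_derivative_ident]]) (simp add: that)
  have d1: "((\<lambda>z. metric_rep A g c (fst z) \<xi> \<eta>) has_derivative (\<lambda>v. dG x\<^sub>0 (fst v) \<xi> \<eta>)) (at (x\<^sub>0, y\<^sub>0))" for \<xi> \<eta>
    unfolding dG_def by (rule comp[OF metric_rep_has_derivative[OF g c x]])
  have dd: "((\<lambda>z. dG (fst z) \<zeta> \<xi> \<eta>) has_derivative
      (\<lambda>v. frechet_derivative (\<lambda>x. dG x \<zeta> \<xi> \<eta>) (at x\<^sub>0) (fst v))) (at (x\<^sub>0, y\<^sub>0))" for \<zeta> \<xi> \<eta>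
    unfolding dG_def by (rule comp[OF smooth_on_has_derivative[OF smooth_metric_deriv[OF g c] x]])
  have d2: "((\<lambda>z. dG (fst z) \<zeta> \<xi> (snd z)) has_derivative
      (\<lambda>v. ddG \<zeta> \<xi> (fst v) + dG x\<^sub>0 \<zeta> \<xi> (snd v))) (at (x\<^sub>0, y\<^sub>0))" for \<zeta> \<xi>
  proof -
    have "((\<lambda>z. dG (fst z) \<zeta> \<xi> (snd z)) has_derivative
        (\<lambda>v. frechet_derivative (\<lambda>z. dG (fst z) \<zeta> \<xi> (snd (x\<^sub>0, y\<^sub>0))) (at (x\<^sub>0, y\<^sub>0)) v
          + dG (fst (x\<^sub>0, y\<^sub>0)) \<zeta> \<xi> (snd v))) (at (x\<^sub>0, y\<^sub>0))"
    proof (rule has_derivative_linear_family[OF open_bundle_chart_image[OF c],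
          where L = "\<lambda>z. dG (fst z) \<zeta> \<xi>" and h = snd])
      show "linear (dG (fst z) \<zeta> \<xi>)" if "z \<in> chart_image c \<times> UNIV" for z
        unfolding dG_def by (rule metric_deriv_linear[OF g c]) (use that in auto)
      show "(\<lambda>z. dG (fst z) \<zeta> \<xi> b) differentiable at (x\<^sub>0, y\<^sub>0)" for b
        using dd unfolding differentiable_def by blast
    qed (use x in \<open>auto intro: has_derivative_snd[OF has_derivative_ident]\<close>)
    then show ?thesis
      by (simp only: fst_conv snd_conv frechet_derivative_eqI[OF dd] ddG_def)
  qed
  show ?thesis
    by (intro has_derivative_diff has_derivative_add d1 d2)
qed

text \<open>Stated for a general difference tensor \<open>S\<close> with
  \<open>S p \<cdot> y\<close> self-adjoint for \<open>g\<close>. This treats all the connections of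
  the theorem at once, and with \<open>S = 0\<close> the Levi-Civita connection.\<close>

lemma almost_kaehler_sasaki:
  assumes A: "smooth_manifold A" and g: "pseudo_riemannian_metric A g" and LC: "levi_civita_connection A g D"
    and D': "affine_connection A D'"
    and S: "\<And>p u Y. p \<in> points A \<Longrightarrow> u \<in> tangent_space A p \<Longrightarrow> Y \<in> vector_fields A \<Longrightarrow>
      D' p u Y = D p u Y + S p u (Y p)"
    and S_tangent: "\<And>p u y. p \<in> points A \<Longrightarrow> u \<in> tangent_space A p \<Longrightarrow> y \<in> tangent_space A p \<Longrightarrow>
      S p u y \<in> tangent_space A p"
    and S_sym: "\<And>p u v y. p \<in> points A \<Longrightarrow> u \<in> tangent_space A p \<Longrightarrow> v \<in> tangent_space A p \<Longrightarrow>
      y \<in> tangent_space A p \<Longrightarrow> g p (S p u y) v = g p u (S p v y)"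
  shows "almost_kaehler (tangent_bundle A) (sasaki_metric A g D') (bundle_J A D')"
  unfolding almost_kaehler_def
proof (intro conjI ballI almost_hermitian_sasaki[OF A D' g])
  fix a U V W assume a: "a \<in> points (tangent_bundle A)"
  obtain p u where pu: "a = (p, u)" by (cases a)
  obtain c where c: "c \<in> A" "chart_at (tangent_bundle A) a = tchart c" "p \<in> fst c"
    using T.chart_at[OF a] unfolding pu by (elim tangent_bundle_chart_cases)
  let ?c = "tchart c"
  define x\<^sub>0 y\<^sub>0 where "x\<^sub>0 = snd c p" and "y\<^sub>0 = u c"
  have z: "snd ?c a = (x\<^sub>0, y\<^sub>0)" by (simp add: snd_tangent_chart pu x\<^sub>0_def y\<^sub>0_def)
  have x: "x\<^sub>0 \<in> chart_image c" unfolding x\<^sub>0_def by (rule chart_in_image[OF c(3)])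
  define dG where "dG = metric_deriv A g c"
  define ddG where "ddG = (\<lambda>\<zeta> \<xi>. frechet_derivative (\<lambda>x. dG x \<zeta> \<xi> y\<^sub>0) (at x\<^sub>0))"
  define \<omega> where "\<omega> = (\<lambda>\<zeta> \<zeta>' z. kaehler_form (sasaki_metric A g D') (bundle_J A D') (chart_inv ?c z)
      (coord_vec (tangent_bundle A) ?c (chart_inv ?c z) \<zeta>) (coord_vec (tangent_bundle A) ?c (chart_inv ?c z) \<zeta>'))"
  have \<omega>': "frechet_derivative (\<omega> \<zeta> \<zeta>') (at (x\<^sub>0, y\<^sub>0)) v =
      dG x\<^sub>0 (fst v) (fst \<zeta>) (snd \<zeta>') - dG x\<^sub>0 (fst v) (snd \<zeta>) (fst \<zeta>')
      + (ddG (fst \<zeta>') (fst \<zeta>) (fst v) + dG x\<^sub>0 (fst \<zeta>') (fst \<zeta>) (snd v))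
      - (ddG (fst \<zeta>) (fst \<zeta>') (fst v) + dG x\<^sub>0 (fst \<zeta>) (fst \<zeta>') (snd v))" for \<zeta> \<zeta>' v
  proof -
    have "(\<omega> \<zeta> \<zeta>' has_derivative (\<lambda>v.
      dG x\<^sub>0 (fst v) (fst \<zeta>) (snd \<zeta>') - dG x\<^sub>0 (fst v) (snd \<zeta>) (fst \<zeta>')
      + (ddG (fst \<zeta>') (fst \<zeta>) (fst v) + dG x\<^sub>0 (fst \<zeta>') (fst \<zeta>) (snd v))
      - (ddG (fst \<zeta>) (fst \<zeta>') (fst v) + dG x\<^sub>0 (fst \<zeta>) (fst \<zeta>') (snd v)))) (at (x\<^sub>0, y\<^sub>0))"
    proof (rule has_derivative_transform_within_open[OF _ open_bundle_chart_image[OF c(1)]])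
      show "((\<lambda>z. metric_rep A g c (fst z) (fst \<zeta>) (snd \<zeta>') - metric_rep A g c (fst z) (snd \<zeta>) (fst \<zeta>')
        + dG (fst z) (fst \<zeta>') (fst \<zeta>) (snd z) - dG (fst z) (fst \<zeta>) (fst \<zeta>') (snd z)) has_derivative (\<lambda>v.
        dG x\<^sub>0 (fst v) (fst \<zeta>) (snd \<zeta>') - dG x\<^sub>0 (fst v) (snd \<zeta>) (fst \<zeta>')
        + (ddG (fst \<zeta>') (fst \<zeta>) (fst v) + dG x\<^sub>0 (fst \<zeta>') (fst \<zeta>) (snd v))
        - (ddG (fst \<zeta>) (fst \<zeta>') (fst v) + dG x\<^sub>0 (fst \<zeta>) (fst \<zeta>') (snd v)))) (at (x\<^sub>0, y\<^sub>0))"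
        unfolding dG_def ddG_def by (rule exact_form_derivative[OF g c(1) x])
      show "(x\<^sub>0, y\<^sub>0) \<in> chart_image c \<times> UNIV" using x by simp
      fix z assume "z \<in> chart_image c \<times> (UNIV :: 'e set)"
      then have z: "fst z \<in> chart_image c" by auto
      show "metric_rep A g c (fst z) (fst \<zeta>) (snd \<zeta>') - metric_rep A g c (fst z) (snd \<zeta>) (fst \<zeta>')
        + dG (fst z) (fst \<zeta>') (fst \<zeta>) (snd z) - dG (fst z) (fst \<zeta>) (fst \<zeta>') (snd z) = \<omega> \<zeta> \<zeta>' z"
        using kaehler_form_exact[where S = S, OF g LC D' S S_tangent S_sym c(1) z,
            where y = "snd z" and \<zeta> = \<zeta> and \<zeta>' = \<zeta>']
        unfolding \<omega>_def dG_def prod.collapse by (rule sym)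
    qed
    then show ?thesis by (simp only: frechet_derivative_eqI)
  qed
  \<comment> \<open>The two symmetries behind the cancellation: first derivatives of the metric are
    symmetric in the vectors, second derivatives in the directions.\<close>
  have dG_sym: "dG x\<^sub>0 \<zeta> \<xi> \<eta> = dG x\<^sub>0 \<zeta> \<eta> \<xi>" for \<zeta> \<xi> \<eta>
    unfolding dG_def by (rule metric_deriv_sym[OF g c(1) x])
  have comm: "ddG \<zeta> \<xi> \<zeta>' = ddG \<zeta>' \<xi> \<zeta>" for \<zeta> \<xi> \<zeta>'
    unfolding ddG_def dG_def metric_deriv_def
    by (rule frechet_derivative_commute[OF open_chart_image[OF c(1)] smooth_metric_rep[OF g c(1)] x])
  have "ext_deriv2 (tangent_bundle A) (kaehler_form (sasaki_metric A g D') (bundle_J A D')) a U V W =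
      frechet_derivative (\<omega> (V ?c) (W ?c)) (at (x\<^sub>0, y\<^sub>0)) (U ?c)
      - frechet_derivative (\<omega> (U ?c) (W ?c)) (at (x\<^sub>0, y\<^sub>0)) (V ?c)
      + frechet_derivative (\<omega> (U ?c) (V ?c)) (at (x\<^sub>0, y\<^sub>0)) (W ?c)"
    unfolding ext_deriv2_def Let_def c(2) z \<omega>_def ..
  \<comment> \<open>The second-derivative terms cancel in pairs by \<open>comm\<close>, and the
    first-derivative terms in pairs, partly after exchanging the last two arguments by
    \<open>dG_sym\<close>.\<close>
  also have "\<dots> = 0"
    unfolding \<omega>' dG_sym[of "fst (U ?c)" "snd (V ?c)"] dG_sym[of "fst (V ?c)" "snd (U ?c)"]
      dG_sym[of "fst (W ?c)" "snd (U ?c)"] comm[of "fst (W ?c)" _ "fst (U ?c)"]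
      comm[of "fst (V ?c)" _ "fst (U ?c)"] comm[of "fst (W ?c)" _ "fst (V ?c)"]
    by simp
  finally show "ext_deriv2 (tangent_bundle A) (kaehler_form (sasaki_metric A g D') (bundle_J A D')) a U V W = 0" .
qed

subsection \<open>The metric and the connections of the frame\<close>

lemma coframe_add:
  "p \<in> points A \<Longrightarrow> i \<in> I \<Longrightarrow> u \<in> tangent_space A p \<Longrightarrow> v \<in> tangent_space A p \<Longrightarrow>
    \<theta> i p (u + v) = \<theta> i p u + \<theta> i p v"
  using coframe_linear[of p i] by (simp add: linear_map_on_def)

lemma coframe_scale:
  "p \<in> points A \<Longrightarrow> i \<in> I \<Longrightarrow> u \<in> tangent_space A p \<Longrightarrow> \<theta> i p (r *\<^sub>R u) = r * \<theta> i p u"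
  using coframe_linear[of p i] by (simp add: linear_map_on_def)

text \<open>Evaluating against \<open>e j\<close> leaves \<open>\<epsilon> j\<close> times the j-th
  coefficient. A vector orthogonal to the whole frame therefore has only zero coefficients.\<close>

lemma pseudo_riemannian_frame_metric:
  assumes \<epsilon>: "\<And>i. i \<in> I \<Longrightarrow> \<epsilon> i \<noteq> 0"
    and g: "\<And>p X Y. g p X Y = (\<Sum>i\<in>I. \<epsilon> i * (\<theta> i p X * \<theta> i p Y))"
  shows "pseudo_riemannian_metric A g"
  unfolding pseudo_riemannian_metric_def
proof (intro conjI ballI allI impI)
  fix p u assume p: "p \<in> points A" and u: "u \<in> tangent_space A p"
  show "linear_map_on (tangent_space A p) (g p u)"
    unfolding linear_map_on_def
  proof (intro conjI ballI allI)
    fix v w assume vw: "v \<in> tangent_space A p" "w \<in> tangent_space A p"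
    show "g p u (v + w) = g p u v + g p u w"
      unfolding g sum.distrib[symmetric]
      by (rule sum.cong[OF refl]) (simp add: coframe_add[OF p _ vw] algebra_simps)
  next
    fix r v assume v: "v \<in> tangent_space A p"
    show "g p u (r *\<^sub>R v) = r *\<^sub>R g p u v"
      unfolding g real_scaleR_def sum_distrib_left
      by (rule sum.cong[OF refl]) (simp add: coframe_scale[OF p _ v])
  qed
  show "g p u v = g p v u" if "v \<in> tangent_space A p" for v
    unfolding g by (simp only: mult.commute)
  assume 0: "\<forall>v\<in>tangent_space A p. g p u v = 0"
  have "\<theta> j p u = 0" if j: "j \<in> I" for j
  proof -
    have "g p u (e j p) = (\<Sum>i\<in>I. if i = j then \<epsilon> i * \<theta> i p u else 0)"
      unfolding g by (rule sum.cong[OF refl]) (simp add: coframe_frame[OF p _ j])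
    also have "\<dots> = \<epsilon> j * \<theta> j p u" using j finite_frame by simp
    finally show ?thesis
      using 0 vector_field_tangent[OF frame_field[OF j], of p] \<epsilon>[OF j] by simp
  qed
  then have "(\<Sum>i\<in>I. \<theta> i p u *\<^sub>R e i p) = 0" by (simp add: sum.neutral)
  then show "u = 0" using frame_expand[OF p u] by simp
next
  fix c \<xi> \<eta> assume c: "c \<in> A"
  note op = open_chart_image[OF c]
  have "smooth_on (chart_image c) (\<lambda>x. \<Sum>i\<in>I. \<epsilon> i * (coframe_rep c i x \<xi> * coframe_rep c i x \<eta>))"
    by (intro smooth_on_sum[OF op] smooth_on_mult[OF op] smooth_on_const smooth_coframe_rep[OF c])
  then show "smooth_on (chart_image c) (\<lambda>x. g (chart_inv c x)
      (coord_vec A c (chart_inv c x) \<xi>) (coord_vec A c (chart_inv c x) \<eta>))"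
    unfolding g coframe_rep_def .
qed

text \<open>The added term is tensorial in the field and in the direction. In the Leibniz rule the
  factor \<open>f\<close> simply comes out of it, so the derivative of \<open>f\<close> arises from
  \<open>D\<close> alone.\<close>

lemma affine_connection_add_coframe:
  assumes D: "affine_connection A D" and J: "almost_complex_structure A J" and i: "i \<in> I"
    and D': "\<And>p u Y. D' p u Y = D p u Y + \<theta> i p (Y p) *\<^sub>R J p u"
  shows "affine_connection A D'"
proof -
  have Jl: "linear_map_on (tangent_space A p) (J p)" if "p \<in> points A" for p
    using J that by (simp add: almost_complex_structure_def)
  have Jt: "J p u \<in> tangent_space A p" if "p \<in> points A" "u \<in> tangent_space A p" for p u
    using J that by (simp add: almost_complex_structure_def)
  show ?thesis
    unfolding affine_connection_def
  proof (intro conjI ballI allI impI)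
    fix p Y assume p: "p \<in> points A" and Y: "Y \<in> vector_fields A"
    note Dl = connection_linear[OF D p Y]
    show "linear_map_on (tangent_space A p) (\<lambda>u. D' p u Y)"
      using Dl Jl[OF p] unfolding linear_map_on_def D' by (simp add: scaleR_add_right scaleR_left_commute add_ac)
  next
    fix p u Y assume p: "p \<in> points A" and u: "u \<in> tangent_space A p" and Y: "Y \<in> vector_fields A"
    show "D' p u Y \<in> tangent_space A p"
      unfolding D' using connection_tangent[OF D p u Y] Jt[OF p u]
      by (intro subspace_add[OF subspace_tangent_space] subspace_scale[OF subspace_tangent_space])
  next
    fix p u Y Z assume p: "p \<in> points A" and u: "u \<in> tangent_space A p"
      and Y: "Y \<in> vector_fields A" and Z: "Z \<in> vector_fields A"
    have "D p u (Y + Z) = D p u Y + D p u Z"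
      using D p u Y Z unfolding affine_connection_def by blast
    moreover have "\<theta> i p ((Y + Z) p) = \<theta> i p (Y p) + \<theta> i p (Z p)"
      by (simp only: plus_fun_apply coframe_add[OF p i vector_field_tangent[OF Y] vector_field_tangent[OF Z]])
    ultimately show "D' p u (Y + Z) = D' p u Y + D' p u Z"
      by (simp only: D' scaleR_add_left add_ac)
  next
    fix p u Y f assume p: "p \<in> points A" and u: "u \<in> tangent_space A p"
      and Y: "Y \<in> vector_fields A" and f: "smooth_function A f"
    have "D p u (\<lambda>q. f q *\<^sub>R Y q) = dir_deriv A p u f *\<^sub>R Y p + f p *\<^sub>R D p u Y"
      using D p u Y f unfolding affine_connection_def by blast
    then show "D' p u (\<lambda>q. f q *\<^sub>R Y q) = dir_deriv A p u f *\<^sub>R Y p + f p *\<^sub>R D' p u Y"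
      by (simp only: D' coframe_scale[OF p i vector_field_tangent[OF Y]] scaleR_add_right scaleR_scaleR add_ac)
  next
    fix X Y assume X: "X \<in> vector_fields A" and Y: "Y \<in> vector_fields A"
    show "smooth_components A (\<lambda>p. D' p (X p) Y)"
      unfolding smooth_components_def
    proof
      fix c assume c: "c \<in> A"
      note op = open_chart_image[OF c]
      have Jrep: "linear (\<lambda>\<xi>. J (chart_inv c x) (coord_vec A c (chart_inv c x) \<xi>) c)"
        if x: "x \<in> chart_image c" for x
      proof -
        note q = chart_inv_in[OF x] and p = chart_inv_points[OF c x]
        note l = coord_vec_linear[OF c q]
        show ?thesis
          using Jl[OF p] coord_vec_tangent[OF c q] unfolding linear_map_on_def
          by (intro linearI) (simp_all add: linear_add[OF l] linear_scale[OF l])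
      qed
      have Jsm: "smooth_on (chart_image c) (\<lambda>x. J (chart_inv c x) (coord_vec A c (chart_inv c x) \<xi>) c)" for \<xi>
        using J c by (simp add: almost_complex_structure_def)
      have id: "(\<lambda>x. x) ` chart_image c \<subseteq> chart_image c" by simp
      \<comment> \<open>\<open>J\<close> is known to be smooth on vectors with constant coordinates;
        linearity extends this to the moving vector \<open>X\<close>.\<close>
      have "smooth_on (chart_image c) (\<lambda>x. J (chart_inv c x) (coord_vec A c (chart_inv c x) (local_rep c X x)) c)"
        by (rule smooth_on_linear_family[OF op op id smooth_on_ident smooth_local_rep[OF X c],
              where L = "\<lambda>x \<xi>. J (chart_inv c x) (coord_vec A c (chart_inv c x) \<xi>) c"])
          (assumption | rule Jrep Jsm)+
      then have JX: "smooth_on (chart_image c) (\<lambda>x. J (chart_inv c x) (X (chart_inv c x)) c)"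
        by (rule smooth_on_cong[OF op])
          (simp only: coord_vec_component[OF c chart_inv_in vector_field_tangent[OF X]])
      have \<theta>Y: "smooth_on (chart_image c) (\<lambda>x. \<theta> i (chart_inv c x) (Y (chart_inv c x)))"
        using smooth_coframe_field[OF Y i] c by (simp add: smooth_function_def comp_def)
      have DX: "smooth_on (chart_image c) (\<lambda>x. D (chart_inv c x) (X (chart_inv c x)) Y c)"
        using D X Y c unfolding affine_connection_def smooth_components_def by blast
      show "smooth_on (chart_image c) (\<lambda>x. D' (chart_inv c x) (X (chart_inv c x)) Y c)"
        unfolding D' plus_fun_apply scaleR_fun_apply
        by (rule smooth_on_add[OF op DX smooth_on_scaleR[OF op \<theta>Y JX]])
    qed
  qed
qed

end

theorem proposition6p9:
  fixes A :: "('p, 'e::euclidean_space) atlas"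
    and n \<alpha> :: nat
    and v w :: "nat \<Rightarrow> ('p, 'e) vfield"
    and v' w' :: "nat \<Rightarrow> 'p \<Rightarrow> ('p, 'e) tvec \<Rightarrow> real"
    and J :: "'p \<Rightarrow> ('p, 'e) tvec \<Rightarrow> ('p, 'e) tvec"
    and g :: "'p \<Rightarrow> ('p, 'e) tvec \<Rightarrow> ('p, 'e) tvec \<Rightarrow> real"
    and D :: "('p, 'e) connection"
    and Dbar :: "nat \<Rightarrow> ('p, 'e) connection"
  assumes manifold: "smooth_manifold A"
    and dim: "DIM('e) = 2 * n" "n \<ge> 2"
    and frame: "global_frame A {1..2 * n} (join n v w)"
    and coframe: "dual_coframe A {1..2 * n} (join n v w) (join n v' w')"
    and J: "almost_complex_structure A J"
      "\<And>p i. p \<in> points A \<Longrightarrow> i \<in> {1..n} \<Longrightarrow> J p (v i p) = w i p"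
      "\<And>p i. p \<in> points A \<Longrightarrow> i \<in> {1..n} \<Longrightarrow> J p (w i p) = - v i p"
    and g: "\<And>p X Y. g p X Y = - (\<Sum>i=1..n. v' i p X * v' i p Y) + (\<Sum>i=1..n. w' i p X * w' i p Y)"
    and levi_civita: "levi_civita_connection A g D"
    and Dbar:
      "\<And>i p X Y. i \<in> {1..n} \<Longrightarrow> Dbar i p X Y = D p X Y + v' i p (Y p) *\<^sub>R J p X"
      "\<And>i p X Y. i \<in> {1..n} \<Longrightarrow> Dbar (n + i) p X Y = D p X Y + w' i p (Y p) *\<^sub>R J p X"
    and \<alpha>: "\<alpha> \<in> {1..2 * n}"
  shows "almost_kaehler (tangent_bundle A) (sasaki_metric A g (Dbar \<alpha>)) (bundle_J A (Dbar \<alpha>))"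
proof -
  let ?e = "join n v w" and ?\<theta> = "join n v' w'"
  interpret framed_manifold A "{1..2 * n}" ?e ?\<theta>
    using manifold frame coframe by unfold_locales (simp_all add: smooth_manifold_def)
  have low: "?e i = v i" "?\<theta> i = v' i" if "i \<in> {1..n}" for i
    using that by (simp_all add: join_def)
  have high: "?e (n + i) = w i" "?\<theta> (n + i) = w' i" if "i \<in> {1..n}" for i
    using that by (simp_all add: join_def)
  have Jl: "linear_map_on (tangent_space A p) (J p)" if "p \<in> points A" for p
    using J(1) that by (simp add: almost_complex_structure_def)
  have Jt: "J p u \<in> tangent_space A p" if "p \<in> points A" "u \<in> tangent_space A p" for p u
    using J(1) that by (simp add: almost_complex_structure_def)
  \<comment> \<open>In the joined frame the indices up to \<open>n\<close> are the negative
    directions \<open>v\<close> and the others the positive directions \<open>w\<close>.\<close>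
  define \<epsilon> :: "nat \<Rightarrow> real" where "\<epsilon> = (\<lambda>i. if i \<le> n then -1 else 1)"
  have split: "(\<Sum>i\<in>{1..2 * n}. f i) = (\<Sum>i=1..n. f i) + (\<Sum>i=1..n. f (n + i))" for f :: "nat \<Rightarrow> real"
    using sum.ub_add_nat[of 1 n f n] sum.shift_bounds_cl_nat_ivl[of f 1 n n]
    by (simp add: mult_2 add.commute)
  have "g p X Y = (\<Sum>i\<in>{1..2 * n}. \<epsilon> i * (?\<theta> i p X * ?\<theta> i p Y))" for p X Y
    unfolding g split sum_negf[symmetric]
    by (intro arg_cong2[where f = "(+)"] sum.cong refl) (simp_all add: low high \<epsilon>_def)
  then have pr: "pseudo_riemannian_metric A g"
    by (rule pseudo_riemannian_frame_metric[rotated]) (simp add: \<epsilon>_def)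
  \<comment> \<open>The values of \<open>J\<close> are given only on the frame, so the covectors
    composed with \<open>J\<close> are obtained by expanding the argument.\<close>
  have \<theta>J: "?\<theta> i p (J p u) = (\<Sum>j\<in>{1..2 * n}. ?\<theta> j p u * ?\<theta> i p (J p (?e j p)))"
    if p: "p \<in> points A" and u: "u \<in> tangent_space A p" and i: "i \<in> {1..2 * n}" for p u i
  proof -
    note et = vector_field_tangent[OF frame_field]
    have "J p u = J p (\<Sum>j\<in>{1..2 * n}. ?\<theta> j p u *\<^sub>R ?e j p)"
      by (simp only: frame_expand[OF p u])
    also have "\<dots> = (\<Sum>j\<in>{1..2 * n}. ?\<theta> j p u *\<^sub>R J p (?e j p))"
      by (rule subspace_linear_map_on_sum[OF subspace_tangent_space Jl[OF p] finite_frame et])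
    finally have "?\<theta> i p (J p u) = ?\<theta> i p (\<Sum>j\<in>{1..2 * n}. ?\<theta> j p u *\<^sub>R J p (?e j p))"
      by (simp only:)
    also have "\<dots> = (\<Sum>j\<in>{1..2 * n}. ?\<theta> j p u *\<^sub>R ?\<theta> i p (J p (?e j p)))"
      by (rule subspace_linear_map_on_sum[OF subspace_tangent_space coframe_linear[OF p i] finite_frame Jt[OF p et]])
    finally show ?thesis by simp
  qed
  have \<theta>neg: "?\<theta> i p (- u) = - ?\<theta> i p u" if "p \<in> points A" "i \<in> {1..2 * n}" "u \<in> tangent_space A p" for i p u
    using coframe_scale[OF that, of "-1"] by simp
  have Jlow: "J p (?e j p) = ?e (n + j) p" and Jhigh: "J p (?e (n + j) p) = - ?e j p"
    if "p \<in> points A" "j \<in> {1..n}" for p j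
    using J(2,3)[OF that] that(2) by (simp_all only: low high)
  \<comment> \<open>The transpose of \<open>J\<close> on the coframe. In each sum over the joined
    frame one half vanishes by duality, and a single term of the other half survives.\<close>
  have v'J: "v' i p (J p u) = - w' i p u" and w'J: "w' i p (J p u) = v' i p u"
    if p: "p \<in> points A" and u: "u \<in> tangent_space A p" and i: "i \<in> {1..n}" for p u i
  proof -
    have I: "i \<in> {1..2 * n}" "n + i \<in> {1..2 * n}" using i by auto
    have inI: "j \<in> {1..2 * n}" "n + j \<in> {1..2 * n}" if "j \<in> {1..n}" for j using that by auto
    note et = vector_field_tangent[OF frame_field]
    have "?\<theta> i p (J p u) = (\<Sum>j=1..n. 0) + (\<Sum>j=1..n. if j = i then - ?\<theta> (n + j) p u else 0)"
      unfolding \<theta>J[OF p u I(1)] split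
    proof (intro arg_cong2[where f = "(+)"] sum.cong refl)
      fix j assume j: "j \<in> {1..n}"
      show "?\<theta> j p u * ?\<theta> i p (J p (?e j p)) = 0"
        unfolding Jlow[OF p j] coframe_frame[OF p I(1) inI(2)[OF j]] using i j by auto
      show "?\<theta> (n + j) p u * ?\<theta> i p (J p (?e (n + j) p)) = (if j = i then - ?\<theta> (n + j) p u else 0)"
        unfolding Jhigh[OF p j] \<theta>neg[OF p I(1) et[OF inI(1)[OF j]]] coframe_frame[OF p I(1) inI(1)[OF j]] by auto
    qed
    then show "v' i p (J p u) = - w' i p u"
      using i by (simp add: low[OF i] high[OF i])
    have "?\<theta> (n + i) p (J p u) = (\<Sum>j=1..n. if j = i then ?\<theta> j p u else 0) + (\<Sum>j=1..n. 0)"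
      unfolding \<theta>J[OF p u I(2)] split
    proof (intro arg_cong2[where f = "(+)"] sum.cong refl)
      fix j assume j: "j \<in> {1..n}"
      show "?\<theta> j p u * ?\<theta> (n + i) p (J p (?e j p)) = (if j = i then ?\<theta> j p u else 0)"
        unfolding Jlow[OF p j] coframe_frame[OF p I(2) inI(2)[OF j]] by auto
      show "?\<theta> (n + j) p u * ?\<theta> (n + i) p (J p (?e (n + j) p)) = 0"
        unfolding Jhigh[OF p j] \<theta>neg[OF p I(2) et[OF inI(1)[OF j]]] coframe_frame[OF p I(2) inI(1)[OF j]]
        using i j by auto
    qed
    then show "w' i p (J p u) = v' i p u"
      using i by (simp add: low[OF i] high[OF i])
  qed
  \<comment> \<open>The minus sign of \<open>g\<close> on the \<open>v\<close> part cancels the one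
    in \<open>v' \<circ> J = - w'\<close>. Both sides become the sum of
    \<open>w' i p u * v' i p z\<close> and \<open>v' i p u * w' i p z\<close> over all
    \<open>i\<close>, which is symmetric in \<open>u\<close> and \<open>z\<close>.\<close>
  have gJ: "g p (J p u) z = g p u (J p z)"
    if p: "p \<in> points A" and u: "u \<in> tangent_space A p" and z: "z \<in> tangent_space A p" for p u z
  proof -
    have "g p (J p u) z = (\<Sum>i=1..n. w' i p u * v' i p z) + (\<Sum>i=1..n. v' i p u * w' i p z)"
      unfolding g sum_negf[symmetric]
      by (intro arg_cong2[where f = "(+)"] sum.cong refl) (simp_all add: v'J[OF p u] w'J[OF p u])
    also have "\<dots> = (\<Sum>i=1..n. v' i p u * w' i p z) + (\<Sum>i=1..n. w' i p u * v' i p z)"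
      by (rule add.commute)
    also have "\<dots> = g p u (J p z)"
      unfolding g sum_negf[symmetric]
      by (intro arg_cong2[where f = "(+)"] sum.cong refl) (simp_all add: v'J[OF p z] w'J[OF p z])
    finally show ?thesis .
  qed
  \<comment> \<open>In terms of the joined coframe the two families of connections have one
    formula.\<close>
  have D': "Dbar \<alpha> p u Y = D p u Y + ?\<theta> \<alpha> p (Y p) *\<^sub>R J p u" for p u Y
  proof (cases "\<alpha> \<le> n")
    case True
    then have "\<alpha> \<in> {1..n}" using \<alpha> by simp
    then show ?thesis by (simp only: Dbar(1) low)
  next
    case False
    then have k: "\<alpha> - n \<in> {1..n}" "\<alpha> = n + (\<alpha> - n)" using \<alpha> by auto
    show ?thesis using Dbar(2)[OF k(1), of p u Y] high(2)[OF k(1)] k(2) by simp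
  qed
  have D: "affine_connection A D"
    using levi_civita by (simp add: levi_civita_connection_def)
  show ?thesis
  \<comment> \<open>For fixed \<open>y\<close> the difference tensor is the number
    \<open>?\<theta> \<alpha> p y\<close> times \<open>J\<close>, so it inherits self-adjointness
    from \<open>J\<close>.\<close>
  proof (rule almost_kaehler_sasaki[OF manifold pr levi_civita affine_connection_add_coframe[OF D J(1) \<alpha> D'],
        where S = "\<lambda>p u y. ?\<theta> \<alpha> p y *\<^sub>R J p u"])
    show "Dbar \<alpha> p u Y = D p u Y + ?\<theta> \<alpha> p (Y p) *\<^sub>R J p u" for p u Y by (rule D')
    fix p u y assume p: "p \<in> points A" and u: "u \<in> tangent_space A p"
    show "?\<theta> \<alpha> p y *\<^sub>R J p u \<in> tangent_space A p"
      by (rule subspace_scale[OF subspace_tangent_space Jt[OF p u]])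
    fix z assume z: "z \<in> tangent_space A p"
    show "g p (?\<theta> \<alpha> p y *\<^sub>R J p u) z = g p u (?\<theta> \<alpha> p y *\<^sub>R J p z)"
      unfolding metric_scale(2)[OF pr p z Jt[OF p u]] metric_scale(1)[OF pr p u Jt[OF p z]] gJ[OF p u z] ..
  qed
qed

end
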